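(* Let $\mathcal{E}$ be the elliptic curve over $\mathbb{Q}$ defined in $\mathbb{P}^2$ with homogeneous coordinates $(a:b:c)$ by $$q(a,b,c) = -c^3 - c^2(a+b) + c(a^2+ab+b^2) + (a^3+a^2b+ab^2+b^3)=0,$$ with identity element $O=(1:-1:0)$. Then, as abelian groups, $$\mathcal{E}(\mathbb{Q}) \cong \mathbb{Z}\oplus \mathbb{Z}/2\mathbb{Z}.$$
   Context: The curve $\mathcal{E}$ is a smooth plane cubic with inflexion point $O=(1:-1:0)$, and $\mathcal{E}(\mathbb{Q})$ carries the usual chord-and-tangent group law with identity $O$. *)

theory Defs
  imports
    "HOL-Algebra.Elementary_Groups"
    "HOL-Analysis.Cartesian_Space"
    "HOL-Computational_Algebra.Polynomial"
    "HOL-Library.Multiset"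
begin

definition same_point :: "rat ^ 3 \<Rightarrow> rat ^ 3 \<Rightarrow> bool" where
  "same_point v w \<longleftrightarrow> v \<noteq> 0 \<and> w \<noteq> 0 \<and> (\<exists>k. w = k *s v)"

lemma part_equivp_same_point: "part_equivp same_point"
proof (rule part_equivpI)
  show "\<exists>v. same_point v v"
    by (rule exI[of _ "1"], unfold same_point_def, metis vector_smult_lid zero_neq_one)
  show "symp same_point"
  proof (rule sympI)
    fix v w assume h: "same_point v w"
    then obtain k where k: "w = k *s v" by (auto simp: same_point_def)
    with h have "k \<noteq> 0" by (auto simp: same_point_def)
    with k have "v = inverse k *s w" by (simp add: vector_smult_assoc)
    with h show "same_point w v" by (auto simp: same_point_def)
  qed
  show "transp same_point"
    by (rule transpI) (auto simp: same_point_def vector_smult_assoc)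
qed

quotient_type proj_plane = "rat ^ 3" / partial: same_point
  by (rule part_equivp_same_point)

definition proj :: "rat \<Rightarrow> rat \<Rightarrow> rat \<Rightarrow> proj_plane" where
  "proj a b c = abs_proj_plane (vector [a, b, c])"

text \<open>The ring is left polymorphic because the form is also evaluated at polynomials
  when it is restricted to a line.\<close>

definition cubic_form :: "'a::comm_ring_1 \<Rightarrow> 'a \<Rightarrow> 'a \<Rightarrow> 'a" where
  "cubic_form a b c =
     - (c ^ 3) - c ^ 2 * (a + b) + c * (a ^ 2 + a * b + b ^ 2)
     + (a ^ 3 + a ^ 2 * b + a * b ^ 2 + b ^ 3)"

lift_definition on_curve :: "proj_plane \<Rightarrow> bool" is
  "\<lambda>v. cubic_form (v $ 1) (v $ 2) (v $ 3) = 0"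
proof -
  fix v w :: "rat ^ 3" assume "same_point v w"
  then obtain k where w: "w = k *s v" and k: "k \<noteq> 0" by (auto simp: same_point_def)
  have "cubic_form (w $ 1) (w $ 2) (w $ 3) = k ^ 3 * cubic_form (v $ 1) (v $ 2) (v $ 3)"
    unfolding w cubic_form_def vector_smult_component by algebra
  with k show "(cubic_form (v $ 1) (v $ 2) (v $ 3) = 0) = (cubic_form (w $ 1) (w $ 2) (w $ 3) = 0)"
    by simp
qed

text \<open>The polynomial $q(v + t w)$ in the variable $t$.\<close>

definition along :: "rat ^ 3 \<Rightarrow> rat ^ 3 \<Rightarrow> rat poly" where
  "along v w = cubic_form [:v $ 1, w $ 1:] [:v $ 2, w $ 2:] [:v $ 3, w $ 3:]"

definition cross :: "rat ^ 3 \<Rightarrow> rat ^ 3 \<Rightarrow> rat ^ 3" where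
  "cross v w = vector [v $ 2 * w $ 3 - v $ 3 * w $ 2,
                       v $ 3 * w $ 1 - v $ 1 * w $ 3,
                       v $ 1 * w $ 2 - v $ 2 * w $ 1]"

text \<open>A nonzero vector \<open>l\<close> stands for the line $l_1 a + l_2 b + l_3 c = 0$.\<close>

lift_definition on_line :: "rat ^ 3 \<Rightarrow> proj_plane \<Rightarrow> bool" is
  "\<lambda>l v. (\<Sum>i\<in>UNIV. l $ i * v $ i) = 0"
proof -
  fix l v w :: "rat ^ 3" assume "same_point v w"
  then obtain k where w: "w = k *s v" and k: "k \<noteq> 0" by (auto simp: same_point_def)
  have "(\<Sum>i\<in>UNIV. l $ i * w $ i) = k * (\<Sum>i\<in>UNIV. l $ i * v $ i)"
    by (simp add: w sum_distrib_left algebra_simps)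
  with k show "((\<Sum>i\<in>UNIV. l $ i * v $ i) = 0) = ((\<Sum>i\<in>UNIV. l $ i * w $ i) = 0)"
    by simp
qed

lemma along_cross_scale:
  "along (k *s v) (cross l (k *s v)) = smult (k ^ 3) (along v (cross l v))"
proof -
  have "[:k * x, k * y:] = [:k:] * [:x, y:]" for x y :: rat by simp
  moreover have "cross l (k *s v) = k *s cross l v"
    by (simp add: cross_def vec_eq_iff forall_3 algebra_simps)
  moreover have "cubic_form (r * x) (r * y) (r * z) = r ^ 3 * cubic_form x y z"
    for r x y z :: "rat poly"
    unfolding cubic_form_def by algebra
  moreover have "[:k:] ^ 3 = [:k ^ 3:]" by (simp add: numeral_3_eq_3)
  ultimately show ?thesis by (simp only: along_def vector_smult_component) simp
qed

text \<open>Intersection multiplicity of the curve with the line \<open>l\<close> at a point \<open>v\<close> of the line. The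
  line is parametrised as $v + t w$ with \<open>w = cross l v\<close>: that \<open>w\<close> satisfies the equation of
  the line, and it is not a multiple of \<open>v\<close> because it is orthogonal to \<open>v\<close> and nonzero (\<open>l\<close> and
  \<open>v\<close> are nonzero orthogonal vectors over an ordered field). Any other point of the line would
  give the same order of vanishing. The curve contains no line, so the polynomial is not zero.\<close>

lift_definition imult :: "rat ^ 3 \<Rightarrow> proj_plane \<Rightarrow> nat" is
  "\<lambda>l v. if (\<Sum>i\<in>UNIV. l $ i * v $ i) = 0 then Polynomial.order 0 (along v (cross l v)) else 0"
proof -
  fix l v w :: "rat ^ 3" assume "same_point v w"
  then obtain k where w: "w = k *s v" and k: "k \<noteq> 0" by (auto simp: same_point_def)
  have s: "(\<Sum>i\<in>UNIV. l $ i * w $ i) = k * (\<Sum>i\<in>UNIV. l $ i * v $ i)"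
    by (simp add: w sum_distrib_left algebra_simps)
  show "(if (\<Sum>i\<in>UNIV. l $ i * v $ i) = 0 then Polynomial.order 0 (along v (cross l v)) else 0) =
        (if (\<Sum>i\<in>UNIV. l $ i * w $ i) = 0 then Polynomial.order 0 (along w (cross l w)) else 0)"
    unfolding s using k by (simp add: w along_cross_scale order_smult)
qed

text \<open>The tangent line at \<open>v\<close> has the gradient of the form as its coefficient vector; the partial
  derivatives are formal derivatives along the coordinate axes.\<close>

definition gradient :: "rat ^ 3 \<Rightarrow> rat ^ 3" where
  "gradient v = (\<chi> i. poly (pderiv (along v (axis i 1))) 0)"

definition chord_or_tangent :: "proj_plane \<Rightarrow> proj_plane \<Rightarrow> rat ^ 3" where
  "chord_or_tangent P Q =
     (if P = Q then gradient (rep_proj_plane P)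
      else cross (rep_proj_plane P) (rep_proj_plane Q))"

text \<open>The third intersection point \<open>R\<close>: the line meets the curve in the divisor $P + Q + R$.\<close>

definition third_point :: "proj_plane \<Rightarrow> proj_plane \<Rightarrow> proj_plane" where
  "third_point P Q = (THE R. \<forall>X. imult (chord_or_tangent P Q) X = count {#P, Q, R#} X)"

definition base_point :: proj_plane where
  "base_point = proj 1 (-1) 0"

definition rational_points :: "proj_plane monoid" where
  "rational_points =
     \<lparr>carrier = {P. on_curve P},
      monoid.mult = (\<lambda>P Q. third_point base_point (third_point P Q)),
      one = base_point\<rparr>"

end

theory Submission
  imports Defs "HOL-Library.Set_Algebras" "HOL-Computational_Algebra.Squarefree"
begin

text \<open>A linear change of coordinates turns the cubic into the Weierstrass curve
  $y^2 = x^3 + 5x^2 - 32x$ with $O$ at infinity, so that the chord and tangent law becomes the usual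
  addition law. Its associativity comes from the ideal classes of the coordinate ring: the point
  $(a, b)$ corresponds to the ideal $(x - a, y - b)$, three points on a line have a principal product,
  and distinct points have distinct classes because a norm $p^2 - (x^3 + 5x^2 - 32x) q^2$ with
  $q \neq 0$ has degree at least $3$.

  The group is generated by the torsion point $T = (0, 0)$ and $G = (8, 24)$. Abscissae are
  $d M^2 / e^2$ with $d \in \{\pm 1, \pm 2\}$ (descent through the $2$-isogeny with kernel
  $\langle T \rangle$), and adding $0$, $T$, $\pm G$ or $\pm(G + T)$ makes the abscissa a square $r^2$,
  which on this curve means that the point is a double. Of the two signs one gives an $r$ with a small
  numerator, because the two values of $r$ are the roots of an explicit quadratic, whereas the numerator
  belonging to the double of a point with parameters $(M, e)$ is at least $(M^4 + 16 e^4)/96$; hence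
  halving decreases $M^2 + 4e^2$ unless it is at most $66$, and the points below that bound are listed. Finally $nG + \varepsilon T = O$ forces $n$ and
  $\varepsilon$ to be even, as $G$, $T$ and $G + T$ are not doubles, and one may halve $n$.\<close>

section \<open>Ideals of the coordinate ring\<close>

text \<open>Proving associativity from the addition formulas would split into many coincidences
  among the points, whereas products of ideals are associative for free. Ideals are carried as
  generating sets under elementwise multiplication, which already form a commutative monoid; only
  their spans are compared.

  The change of coordinates moves the tangent \<open>2(a + b) + c = 0\<close> at the inflexion O to
  infinity, and exchanging a and b becomes negation.

  Adding points multiplies the square classes of their abscissae, where T counts as the class of
  -32, which is that of -2. As 8 has class 2 and -4 has class -1, the points O, T, G and G + T
  account for all four classes. That a square abscissa already suffices for halving is special to
  this curve: on the isogenous curve the positive candidates 1, 3, 17, 51 are cut down modulo powers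
  of 3 to 1 and 17, and 17 is the class attached to its own 2-torsion point, because
  \<open>153 = 9 * 17\<close>.\<close>

definition ideal_span :: "'a::comm_ring_1 set \<Rightarrow> 'a set" where
  "ideal_span = module.span (*)"

context
begin

text \<open>Kept local because the interpretation adds \<open>scale_scale\<close>, which conflicts with
  associativity of multiplication, to the simplifier.\<close>

interpretation gen: module "(*) :: 'a::comm_ring_1 \<Rightarrow> 'a \<Rightarrow> 'a"
  by standard (auto simp: algebra_simps)

lemma ideal_span_base: "a \<in> S \<Longrightarrow> a \<in> ideal_span S"
  and ideal_span_zero: "0 \<in> ideal_span S"
  and ideal_span_add: "a \<in> ideal_span S \<Longrightarrow> b \<in> ideal_span S \<Longrightarrow> a + b \<in> ideal_span S"
  and ideal_span_diff: "a \<in> ideal_span S \<Longrightarrow> b \<in> ideal_span S \<Longrightarrow> a - b \<in> ideal_span S"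
  and ideal_span_scale: "a \<in> ideal_span S \<Longrightarrow> c * a \<in> ideal_span S"
  and ideal_span_span: "ideal_span (ideal_span S) = ideal_span S"
  and ideal_span_minimal: "S \<subseteq> ideal_span T \<Longrightarrow> ideal_span S \<subseteq> ideal_span T"
  for a b c :: "'a::comm_ring_1"
  unfolding ideal_span_def
  by (fact gen.span_base gen.span_zero gen.span_add gen.span_diff gen.span_scale gen.span_span
      gen.span_minimal[OF _ gen.subspace_span])+

lemma ideal_span_induct [consumes 1, case_names base step]:
  fixes x :: "'a::comm_ring_1"
  assumes "x \<in> ideal_span S" "P 0" "\<And>c x y. x \<in> S \<Longrightarrow> P y \<Longrightarrow> P (c * x + y)"
  shows "P x"
  using assms unfolding ideal_span_def by (rule gen.span_induct_alt)

lemma ideal_span_sing: "(x \<in> ideal_span {w}) = (w dvd x)" for x w :: "'a::comm_ring_1"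
  unfolding ideal_span_def by (auto simp: gen.span_singleton dvd_def image_iff mult.commute)

end

lemma ideal_span_superset: "S \<subseteq> ideal_span S"
  using ideal_span_base by blast

lemma ideal_span_mono_times:
  fixes S S' T :: "'a::comm_ring_1 set"
  assumes "S \<subseteq> ideal_span S'"
  shows "ideal_span (S * T) \<subseteq> ideal_span (S' * T)"
proof -
  have "s * t \<in> ideal_span (S' * T)" if "s \<in> ideal_span S'" "t \<in> T" for s t
    using that(1)
  proof (induction rule: ideal_span_induct)
    case (step c x y)
    have "x * t \<in> ideal_span (S' * T)" by (intro ideal_span_base set_times_intro step(1) that(2))
    then have "c * (x * t) + y * t \<in> ideal_span (S' * T)"
      by (rule ideal_span_add[OF ideal_span_scale step(2)])
    then show ?case by (simp only: distrib_right mult.assoc)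
  qed (simp add: ideal_span_zero)
  then show ?thesis
    using assms by (intro ideal_span_minimal) (blast elim: set_times_elim)
qed

text \<open>Lets generating sets be exchanged inside a product, so that products of ideals can be
  computed on convenient generators.\<close>

lemma ideal_span_times_cong:
  fixes S S' T T' :: "'a::comm_ring_1 set"
  assumes "ideal_span S = ideal_span S'" "ideal_span T = ideal_span T'"
  shows "ideal_span (S * T) = ideal_span (S' * T')"
proof -
  have *: "ideal_span (A * C) = ideal_span (B * C)" if "ideal_span A = ideal_span B" for A B C :: "'a set"
  proof (rule antisym)
    show "ideal_span (A * C) \<subseteq> ideal_span (B * C)"
      using ideal_span_superset[of A] that by (intro ideal_span_mono_times) simp
    show "ideal_span (B * C) \<subseteq> ideal_span (A * C)"
      using ideal_span_superset[of B] that by (intro ideal_span_mono_times) simp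
  qed
  show ?thesis using *[OF assms(1), of T] *[OF assms(2), of S'] by (simp add: mult.commute)
qed

lemma sing_times_sing: "{g} * {h} = {g * h}"
  by (auto simp: set_times_def)

lemma insert_set_times: "insert a A * S = (\<lambda>x. a * x) ` S \<union> A * S"
  and empty_set_times: "{} * S = {}"
  by (auto simp: set_times_def)

lemma ideal_span_sing_subset: "w \<in> S \<Longrightarrow> (\<And>x. x \<in> S \<Longrightarrow> w dvd x) \<Longrightarrow> ideal_span S = ideal_span {w}"
  for w :: "'a::comm_ring_1"
  by (intro antisym ideal_span_minimal) (auto simp: ideal_span_sing ideal_span_base)

text \<open>The pattern behind both ideal computations for lines: a common factor is pulled out of
  all products of generators, and the cofactors are shown to generate 1.\<close>

lemma ideal_span_sing_times_unit_ideal: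
  fixes l :: "'a::comm_ring_1"
  assumes "1 \<in> ideal_span J"
  shows "ideal_span ({l} * J) = ideal_span {l}"
proof -
  have "ideal_span J = ideal_span {1}"
    using assms by (intro antisym ideal_span_minimal) (auto simp: ideal_span_sing)
  then show ?thesis
    using ideal_span_times_cong[of "{l}" "{l}" J "{1}"] by (simp add: sing_times_sing)
qed

text \<open>Equality of ideal classes with denominators cleared, which avoids fractional ideals. The
  trivial class is represented by the unit set \<open>1\<close>.\<close>

definition ideal_equiv :: "'a::idom set \<Rightarrow> 'a set \<Rightarrow> bool" (infix "\<approx>" 50) where
  "S \<approx> T \<longleftrightarrow> (\<exists>g h. g \<noteq> 0 \<and> h \<noteq> 0 \<and> ideal_span ({g} * S) = ideal_span ({h} * T))"

lemma ideal_equiv_refl: "S \<approx> S"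
  unfolding ideal_equiv_def by (intro exI[of _ 1]) auto

lemma ideal_equiv_sym:
  assumes "S \<approx> T"
  shows "T \<approx> S"
proof -
  obtain g h where "g \<noteq> 0" "h \<noteq> 0" "ideal_span ({g} * S) = ideal_span ({h} * T)"
    using assms unfolding ideal_equiv_def by blast
  then show ?thesis unfolding ideal_equiv_def by (intro exI[of _ h] exI[of _ g] conjI) simp_all
qed

lemma ideal_equiv_trans [trans]:
  assumes "S \<approx> T" "T \<approx> U"
  shows "S \<approx> U"
proof -
  obtain g h g' h' where nz: "g \<noteq> 0" "h \<noteq> 0" "g' \<noteq> 0" "h' \<noteq> 0"
    and e: "ideal_span ({g} * S) = ideal_span ({h} * T)" "ideal_span ({g'} * T) = ideal_span ({h'} * U)"
    using assms unfolding ideal_equiv_def by blast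
  have "ideal_span ({g' * g} * S) = ideal_span ({g'} * ({g} * S))"
    by (simp add: sing_times_sing flip: mult.assoc)
  also have "\<dots> = ideal_span ({g'} * ({h} * T))" by (intro ideal_span_times_cong e refl)
  also have "{g'} * ({h} * T) = {h} * ({g'} * T)" by (simp only: mult.left_commute)
  also have "ideal_span \<dots> = ideal_span ({h} * ({h'} * U))" by (intro ideal_span_times_cong e refl)
  also have "\<dots> = ideal_span ({h * h'} * U)" by (simp add: sing_times_sing flip: mult.assoc)
  finally show ?thesis unfolding ideal_equiv_def using nz
    by (intro exI[of _ "g' * g"] exI[of _ "h * h'"] conjI) simp_all
qed

lemma ideal_equiv_times:
  assumes "S \<approx> S'" "T \<approx> T'"
  shows "S * T \<approx> S' * T'"
proof -
  obtain g h g' h' where nz: "g \<noteq> 0" "h \<noteq> 0" "g' \<noteq> 0" "h' \<noteq> 0"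
    and e: "ideal_span ({g} * S) = ideal_span ({h} * S')" "ideal_span ({g'} * T) = ideal_span ({h'} * T')"
    using assms unfolding ideal_equiv_def by blast
  have *: "{g * g'} * (S * T) = ({g} * S) * ({g'} * T)" for g g' :: 'a and S T
    unfolding sing_times_sing[symmetric] by (simp only: mult.assoc mult.left_commute)
  have "ideal_span ({g * g'} * (S * T)) = ideal_span ({h * h'} * (S' * T'))"
    unfolding * by (intro ideal_span_times_cong e)
  then show ?thesis unfolding ideal_equiv_def using nz
    by (intro exI[of _ "g * g'"] exI[of _ "h * h'"] conjI) simp_all
qed

text \<open>In a domain \<open>g\<close> can be cancelled: each element of the ideal of
  \<open>{g} * S\<close> is \<open>g\<close> times an element of the ideal of \<open>S\<close>. Thus
  \<open>h = g * w\<close> with \<open>w\<close> in the latter ideal, and \<open>w\<close> divides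
  all of its elements.\<close>

lemma ideal_equiv_one_iff:
  fixes S :: "'a::idom set"
  shows "S \<approx> 1 \<longleftrightarrow> (\<exists>w. w \<noteq> 0 \<and> ideal_span S = ideal_span {w})"
proof
  assume "S \<approx> 1"
  then obtain g h where nz: "g \<noteq> 0" "h \<noteq> 0" and e: "ideal_span ({g} * S) = ideal_span {h}"
    unfolding ideal_equiv_def by (auto simp: sing_times_sing)
  have scale: "x \<in> ideal_span S \<Longrightarrow> g * x \<in> ideal_span ({g} * S)" for x
  proof (induction rule: ideal_span_induct)
    case (step c s y)
    have "g * s \<in> ideal_span ({g} * S)" using step(1) by (intro ideal_span_base set_times_intro) auto
    then have "c * (g * s) + g * y \<in> ideal_span ({g} * S)"
      by (rule ideal_span_add[OF ideal_span_scale step(2)])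
    then show ?case by (simp only: distrib_left mult.left_commute)
  qed (simp add: ideal_span_zero)
  have unscale: "y \<in> ideal_span ({g} * S) \<Longrightarrow> \<exists>x\<in>ideal_span S. y = g * x" for y
  proof (induction rule: ideal_span_induct)
    case base
    show ?case by (rule bexI[of _ 0]) (simp_all add: ideal_span_zero)
  next
    case (step c s y)
    then obtain s' x where *: "s = g * s'" "s' \<in> S" "y = g * x" "x \<in> ideal_span S"
      by (auto elim!: set_times_elim)
    have "c * s' + x \<in> ideal_span S"
      by (rule ideal_span_add[OF ideal_span_scale[OF ideal_span_base[OF *(2)]] *(4)])
    then show ?case unfolding * by (rule rev_bexI) (simp add: algebra_simps)
  qed
  have "h \<in> ideal_span ({g} * S)" unfolding e by (simp add: ideal_span_base)
  then obtain w where w: "w \<in> ideal_span S" "h = g * w" using unscale by blast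
  have "w dvd x" if "x \<in> ideal_span S" for x
    using scale[OF that] nz unfolding e w(2) by (simp add: ideal_span_sing)
  then have "ideal_span S = ideal_span {w}"
    using w(1) ideal_span_sing_subset[of w "ideal_span S"] by (simp add: ideal_span_span)
  then show "\<exists>w. w \<noteq> 0 \<and> ideal_span S = ideal_span {w}" using w nz by auto
next
  assume "\<exists>w. w \<noteq> 0 \<and> ideal_span S = ideal_span {w}"
  then obtain w where "w \<noteq> 0" "ideal_span S = ideal_span {w}" by blast
  then show "S \<approx> 1" unfolding ideal_equiv_def by (intro exI[of _ 1] exI[of _ w]) (simp add: set_times_def)
qed

section \<open>The coordinate ring and its norm\<close>

definition wpoly :: "rat poly" where "wpoly = [:0, -32, 5, 1:]"

text \<open>\<open>Coord p q\<close> stands for $p(x) + q(x) y$ in the coordinate ring of $y^2 = x^3 + 5x^2 - 32x$.\<close>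

datatype coord = Coord (even_part: "rat poly") (odd_part: "rat poly")

instantiation coord :: comm_ring_1
begin
definition "0 = Coord 0 0"
definition "1 = Coord 1 0"
definition "u + v = Coord (even_part u + even_part v) (odd_part u + odd_part v)"
definition "u - v = Coord (even_part u - even_part v) (odd_part u - odd_part v)"
definition "- u = Coord (- even_part u) (- odd_part u)"
definition "u * v = Coord (even_part u * even_part v + wpoly * odd_part u * odd_part v)
                          (even_part u * odd_part v + odd_part u * even_part v)"
instance
  by standard (auto simp: zero_coord_def one_coord_def plus_coord_def minus_coord_def
      uminus_coord_def times_coord_def algebra_simps)
end

lemmas coord_defs = zero_coord_def one_coord_def plus_coord_def minus_coord_def
  uminus_coord_def times_coord_def

definition coord_norm :: "coord \<Rightarrow> rat poly" where
  "coord_norm u = even_part u ^ 2 - wpoly * odd_part u ^ 2"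

lemma coord_norm_mult: "coord_norm (u * v) = coord_norm u * coord_norm v"
  by (simp add: coord_norm_def times_coord_def) algebra

text \<open>The square of the even part has even degree and \<open>wpoly\<close> times a nonzero
  square has odd degree, so the leading terms cannot cancel.\<close>

lemma degree_coord_norm:
  assumes "odd_part u \<noteq> 0"
  shows "degree (coord_norm u) \<ge> 3"
proof -
  have w: "degree wpoly = 3" "wpoly \<noteq> 0" by (auto simp: wpoly_def)
  have q: "degree (wpoly * odd_part u ^ 2) = 3 + 2 * degree (odd_part u)"
    using assms w by (simp add: degree_mult_eq degree_power_eq)
  have p: "degree (even_part u ^ 2) = 2 * degree (even_part u)"
    by (cases "even_part u = 0") (auto simp: degree_power_eq)
  show ?thesis
  proof (cases "degree (even_part u ^ 2) < degree (wpoly * odd_part u ^ 2)")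
    case True
    then have "degree (coord_norm u) = degree (wpoly * odd_part u ^ 2)"
      unfolding coord_norm_def by (metis degree_add_eq_right degree_minus diff_conv_add_uminus)
    then show ?thesis using q by simp
  next
    case False
    then have *: "degree (wpoly * odd_part u ^ 2) < degree (even_part u ^ 2)"
      unfolding p q by presburger
    then have "degree (coord_norm u) = degree (even_part u ^ 2)"
      unfolding coord_norm_def by (metis degree_add_eq_left degree_minus diff_conv_add_uminus)
    then show ?thesis using * q by simp
  qed
qed

lemma coord_norm_eq_0_iff: "coord_norm u = 0 \<longleftrightarrow> u = 0"
proof
  assume "coord_norm u = 0"
  moreover from this degree_coord_norm[of u] have "odd_part u = 0" by fastforce
  ultimately show "u = 0" by (cases u) (auto simp: coord_norm_def zero_coord_def)
qed (simp add: coord_norm_def zero_coord_def)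

instance coord :: idom
proof
  fix u v :: coord assume "u \<noteq> 0" "v \<noteq> 0"
  then show "u * v \<noteq> 0" by (metis coord_norm_eq_0_iff coord_norm_mult mult_eq_0_iff)
qed

definition cconst :: "rat \<Rightarrow> coord" where "cconst c = Coord [:c:] 0"
definition coordx :: coord where "coordx = Coord [:0, 1:] 0"
definition coordy :: coord where "coordy = Coord 0 1"

lemma cconst_simps:
  "cconst (a + b) = cconst a + cconst b" "cconst (a - b) = cconst a - cconst b"
  "cconst (a * b) = cconst a * cconst b" "cconst (- a) = - cconst a"
  "cconst 0 = 0" "cconst 1 = 1" "cconst (a ^ n) = cconst a ^ n"
proof -
  show m: "cconst (a * b) = cconst a * cconst b" for a b by (auto simp: cconst_def coord_defs)
  show o: "cconst 1 = 1" by (auto simp: cconst_def coord_defs)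
  show "cconst (a ^ n) = cconst a ^ n" by (induction n) (auto simp: o m)
qed (auto simp: cconst_def coord_defs)

lemma cconst_numeral: "cconst (numeral n) = numeral n"
proof -
  have "cconst (of_nat k) = of_nat k" for k by (induction k) (auto simp: cconst_simps)
  from this[of "numeral n"] show ?thesis by simp
qed

lemma coordy_square: "coordy ^ 2 = coordx ^ 3 + 5 * coordx ^ 2 - 32 * coordx"
proof -
  have "coordy ^ 2 = coordx ^ 3 + cconst 5 * coordx ^ 2 - cconst 32 * coordx"
    by (simp add: power2_eq_square power3_eq_cube coordx_def coordy_def cconst_def coord_defs wpoly_def)
  then show ?thesis by (simp add: cconst_numeral)
qed

lemma one_in_ideal_span:
  assumes "cconst c \<in> ideal_span S" "c \<noteq> 0"
  shows "1 \<in> ideal_span S"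
proof -
  have "cconst (inverse c) * cconst c \<in> ideal_span S" by (intro ideal_span_scale assms)
  then show ?thesis using assms(2) by (simp flip: cconst_simps(3) add: cconst_simps)
qed

section \<open>Ideals of points and of lines\<close>

definition point_gens :: "rat \<Rightarrow> rat \<Rightarrow> coord set" where
  "point_gens a b = {coordx - cconst a, coordy - cconst b}"

definition wcurve :: "rat \<Rightarrow> rat \<Rightarrow> bool" where
  "wcurve x y \<longleftrightarrow> y ^ 2 = x ^ 3 + 5 * x ^ 2 - 32 * x"

lemma wcurve_cconst:
  assumes "wcurve a b"
  shows "cconst b ^ 2 = cconst a ^ 3 + 5 * cconst a ^ 2 - 32 * cconst a"
proof -
  have "cconst (b ^ 2) = cconst (a ^ 3 + 5 * a ^ 2 - 32 * a)" using assms by (simp add: wcurve_def)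
  then show ?thesis by (simp add: cconst_simps cconst_numeral)
qed

text \<open>Smoothness at the points with ordinate 0. A common zero is nonzero, hence a zero of the
  quadratic factor; subtracting three times that factor from the derivative leaves
  \<open>64 - 5 * x\<close>.\<close>

lemma wcurve_nonsingular:
  fixes x :: rat
  assumes "x ^ 3 + 5 * x ^ 2 - 32 * x = 0" "3 * x ^ 2 + 10 * x - 32 = 0"
  shows False
proof -
  have "x * (x ^ 2 + 5 * x - 32) = 0" using assms(1) by (simp add: algebra_simps eval_nat_numeral)
  moreover have "x \<noteq> 0" using assms(2) by auto
  ultimately have q: "x ^ 2 + 5 * x - 32 = 0" by simp
  with assms(2) have "x = 64 / 5" by simp
  with q show False by (simp add: power2_eq_square)
qed

text \<open>All four products of generators contain the factor \<open>coordx - cconst a\<close>. The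
  cofactors generate 1: two of them differ by \<open>2 * b\<close>, and if \<open>b = 0\<close> the
  quadratic cofactor is congruent modulo \<open>coordx - cconst a\<close> to the derivative of the
  cubic at \<open>a\<close>, nonzero by smoothness.\<close>

lemma vertical_ideal:
  assumes "wcurve a b"
  shows "ideal_span (point_gens a b * point_gens a (- b)) = ideal_span {coordx - cconst a}"
proof -
  define A B where AB: "A = cconst a" "B = cconst b"
  let ?g = "coordx ^ 2 + (A + 5) * coordx + A ^ 2 + 5 * A - 32"
  define J where "J = {coordx - A, coordy + B, coordy - B, ?g}"
  have "(coordy - B) * (coordy + B) = (coordx - A) * ?g"
    using coordy_square wcurve_cconst[OF assms] unfolding AB[symmetric] by algebra
  then have e: "point_gens a b * point_gens a (- b) = {coordx - A} * J"
    unfolding point_gens_def cconst_simps AB[symmetric] J_def set_times_def by (auto simp: mult.commute)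
  have in_J: "x \<in> ideal_span J" if "x \<in> J" for x using that by (rule ideal_span_base)
  have "1 \<in> ideal_span J"
  proof (cases "b = 0")
    case False
    have "coordy + B - (coordy - B) \<in> ideal_span J"
      by (intro ideal_span_diff in_J) (auto simp: J_def)
    also have "coordy + B - (coordy - B) = cconst (2 * b)" by (simp add: AB cconst_simps cconst_numeral)
    finally show ?thesis by (rule one_in_ideal_span) (use False in auto)
  next
    case True
    have "?g - (coordx + 2 * A + 5) * (coordx - A) \<in> ideal_span J"
      by (intro ideal_span_diff ideal_span_scale in_J) (auto simp: J_def)
    also have "?g - (coordx + 2 * A + 5) * (coordx - A) = cconst (3 * a ^ 2 + 10 * a - 32)"
      unfolding AB cconst_simps cconst_numeral by algebra
    finally show ?thesis
      by (rule one_in_ideal_span) (use wcurve_nonsingular[of a] assms True in \<open>auto simp: wcurve_def\<close>)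
  qed
  then show ?thesis unfolding e AB(1)[symmetric] by (rule ideal_span_sing_times_unit_ideal)
qed

text \<open>Vieta's formulas for the abscissae of the intersection of the curve with $y = \lambda x + \nu$.\<close>

definition line_section :: "rat \<Rightarrow> rat \<Rightarrow> rat \<Rightarrow> rat \<Rightarrow> rat \<Rightarrow> bool" where
  "line_section l n x1 x2 x3 \<longleftrightarrow> x1 + x2 + x3 = l ^ 2 - 5 \<and>
     x1 * x2 + x1 * x3 + x2 * x3 = - 32 - 2 * l * n \<and> x1 * x2 * x3 = n ^ 2"

text \<open>Here \<open>x\<close> is a double root of the cubic minus the square of
  \<open>l * x + n\<close>. If the linear form vanished at \<open>x\<close>, its square would vanish
  doubly there, and so would the cubic itself.\<close>

lemma line_section_double:
  assumes "line_section l n x x x'"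
  shows "l * x + n \<noteq> 0"
proof
  assume 0: "l * x + n = 0"
  have v: "x + x + x' = l ^ 2 - 5" "x * x + x * x' + x * x' = - 32 - 2 * l * n" "x * x * x' = n ^ 2"
    using assms by (auto simp: line_section_def)
  have "x ^ 3 + 5 * x ^ 2 - 32 * x = 0" using v 0 by algebra
  moreover have "3 * x ^ 2 + 10 * x - 32 = 0" using v 0 by algebra
  ultimately show False by (rule wcurve_nonsingular)
qed

text \<open>Modulo the first generator, the second generator of each point ideal may be replaced by
  the equation \<open>L\<close> of the line. By Vieta and the curve equation
  \<open>u1 * u2 * u3 = L * L'\<close>, so \<open>L\<close> divides every product of generators;
  what remains is to show that the cofactors \<open>J\<close> generate 1, that is, that no further
  common zero is left over.\<close>

lemma line_ideal:
  assumes sec: "line_section l n x1 x2 x3"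
  shows "ideal_span (point_gens x1 (l * x1 + n) * point_gens x2 (l * x2 + n) * point_gens x3 (l * x3 + n))
       = ideal_span {coordy - cconst l * coordx - cconst n}"
proof -
  define A1 A2 A3 M N where AB: "A1 = cconst x1" "A2 = cconst x2" "A3 = cconst x3" "M = cconst l" "N = cconst n"
  define u1 u2 u3 m L L' where uL: "u1 = coordx - A1" "u2 = coordx - A2" "u3 = coordx - A3"
    "m = M * coordx + N" "L = coordy - m" "L' = coordy + m"
  have gens: "ideal_span (point_gens x (l * x + n)) = ideal_span {coordx - cconst x, L}" for x
  proof -
    have e: "coordy - cconst (l * x + n) = L + M * (coordx - cconst x)"
      by (simp add: uL AB cconst_simps algebra_simps)
    have "L + M * (coordx - cconst x) \<in> ideal_span {coordx - cconst x, L}"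
      by (intro ideal_span_add ideal_span_scale ideal_span_base) auto
    moreover have "(L + M * (coordx - cconst x)) - M * (coordx - cconst x) \<in>
        ideal_span {coordx - cconst x, L + M * (coordx - cconst x)}"
      by (intro ideal_span_diff ideal_span_scale ideal_span_base) auto
    ultimately show ?thesis unfolding point_gens_def e
      by (intro antisym ideal_span_minimal) (auto intro: ideal_span_base)
  qed
  define J where "J = {L', u1 * u2, u1 * u3, u1 * L, u2 * u3, u2 * L, L * u3, L * L}"
  have "cconst (x1 + x2 + x3) = cconst (l ^ 2 - 5)"
    "cconst (x1 * x2 + x1 * x3 + x2 * x3) = cconst (- 32 - 2 * l * n)"
    "cconst (x1 * x2 * x3) = cconst (n ^ 2)"
    using sec by (simp_all add: line_section_def)
  then have "A1 + A2 + A3 = M ^ 2 - 5" "A1 * A2 + A1 * A3 + A2 * A3 = - 32 - 2 * M * N"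
    "A1 * A2 * A3 = N ^ 2"
    unfolding cconst_simps cconst_numeral AB .
  then have uuu: "u1 * u2 * u3 = L * L'" unfolding uL using coordy_square by algebra
  have "{u1, L} * {u2, L} * {u3, L} = {L} * J"
  proof -
    have "{u1, L} * {u2, L} * {u3, L} =
      {u1 * u2 * u3, u1 * u2 * L, u1 * L * u3, u1 * L * L, L * u2 * u3, L * u2 * L, L * L * u3, L * L * L}"
      by (simp add: insert_set_times empty_set_times insert_commute)
    also have "\<dots> = {L} * J" unfolding uuu J_def by (simp add: insert_set_times empty_set_times insert_commute ac_simps)
    finally show ?thesis .
  qed
  moreover have "1 \<in> ideal_span J"
  proof -
    have in_J: "x \<in> ideal_span J" if "x \<in> J" for x using that by (rule ideal_span_base)
    have uu: "u1 * u2 \<in> ideal_span J" "u1 * u3 \<in> ideal_span J" "u2 * u3 \<in> ideal_span J"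
      by (intro in_J; simp add: J_def)+
    have scalec: "x \<in> ideal_span J" if "cconst c * x \<in> ideal_span J" "c \<noteq> 0" for c x
    proof -
      have "cconst (inverse c) * (cconst c * x) \<in> ideal_span J" by (intro ideal_span_scale that)
      then show ?thesis using that(2) by (simp flip: cconst_simps(3) mult.assoc add: cconst_simps)
    qed
    \<comment> \<open>With \<open>L = y - m\<close> and \<open>L' = y + m\<close>, the multiplier
      \<open>3 * m - y\<close> is chosen to eliminate \<open>y\<close> and leave
      \<open>4 * m ^ 2\<close>.\<close>
    have "L * L + (3 * m - coordy) * L' \<in> ideal_span J"
      by (intro ideal_span_add ideal_span_scale in_J) (auto simp: J_def)
    also have "L * L + (3 * m - coordy) * L' = cconst 4 * m ^ 2"
      unfolding uL cconst_numeral by algebra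
    finally have mm: "m ^ 2 \<in> ideal_span J" by (rule scalec) simp
    have "u1 * L' - u1 * L \<in> ideal_span J"
      by (intro ideal_span_diff ideal_span_scale in_J) (auto simp: J_def)
    also have "u1 * L' - u1 * L = cconst 2 * (m * u1)"
      unfolding uL cconst_numeral by algebra
    finally have mu: "m * u1 \<in> ideal_span J" by (rule scalec) simp
    \<comment> \<open>Modulo \<open>coordx - cconst x\<close> the linear function \<open>m\<close>
      equals its value \<open>l * x + n\<close>, so \<open>m ^ 2\<close> becomes a nonzero
      constant.\<close>
    have unit: "1 \<in> ideal_span J" if "coordx - cconst x \<in> ideal_span J" "l * x + n \<noteq> 0" for x
    proof -
      have "m ^ 2 - (m + cconst (l * x + n)) * M * (coordx - cconst x) \<in> ideal_span J"
        by (intro ideal_span_diff ideal_span_scale mm that)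
      also have "m ^ 2 - (m + cconst (l * x + n)) * M * (coordx - cconst x) = cconst ((l * x + n) ^ 2)"
        unfolding uL AB cconst_simps by algebra
      finally show ?thesis by (rule one_in_ideal_span) (use that(2) in auto)
    qed
    show ?thesis
    proof (cases "x1 = x2")
      case True
      have y: "l * x1 + n \<noteq> 0" using line_section_double sec True by auto
      have "m * u1 - M * (u1 * u2) \<in> ideal_span J" by (intro ideal_span_diff ideal_span_scale mu uu)
      also have "m * u1 - M * (u1 * u2) = cconst (l * x1 + n) * u1"
        unfolding uL AB cconst_simps True by algebra
      finally have "u1 \<in> ideal_span J" using y by (rule scalec)
      then show ?thesis using unit[of x1] y unfolding uL AB by simp
    next
      case False
      have "u1 * u3 - u2 * u3 \<in> ideal_span J" by (intro ideal_span_diff uu)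
      also have "u1 * u3 - u2 * u3 = cconst (x2 - x1) * u3"
        unfolding uL AB cconst_simps by algebra
      finally have u3: "u3 \<in> ideal_span J" by (rule scalec) (use False in simp)
      show ?thesis
      proof (cases "l * x3 + n = 0")
        case y: True
        \<comment> \<open>An ordinate 0 at \<open>x3\<close> rules out a double intersection there,
          so \<open>x3\<close> differs from the other two abscissae and \<open>u1 * u2\<close> is a
          nonzero constant modulo \<open>u3\<close>.\<close>
        have "line_section l n x3 x3 x2 \<or> line_section l n x3 x3 x1" if "x3 = x1 \<or> x3 = x2"
          using sec that by (auto simp: line_section_def algebra_simps)
        then have ne: "x3 \<noteq> x1" "x3 \<noteq> x2" using line_section_double[of l n x3] y by auto
        have "u1 * u2 - (coordx + A3 - A1 - A2) * u3 \<in> ideal_span J"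
          by (intro ideal_span_diff ideal_span_scale uu u3)
        also have "u1 * u2 - (coordx + A3 - A1 - A2) * u3 = cconst ((x3 - x1) * (x3 - x2))"
          unfolding uL AB cconst_simps by algebra
        finally show ?thesis by (rule one_in_ideal_span) (use ne in auto)
      next
        case False
        then show ?thesis using unit u3 unfolding uL AB by simp
      qed
    qed
  qed
  ultimately have "ideal_span ({u1, L} * {u2, L} * {u3, L}) = ideal_span {L}"
    by (simp add: ideal_span_sing_times_unit_ideal)
  moreover have "ideal_span (point_gens x1 (l * x1 + n) * point_gens x2 (l * x2 + n) * point_gens x3 (l * x3 + n))
      = ideal_span ({u1, L} * {u2, L} * {u3, L})"
    unfolding uL(1-3) AB by (intro ideal_span_times_cong gens)
  ultimately show ?thesis by (simp add: uL AB algebra_simps)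
qed

section \<open>Addition of points\<close>

text \<open>As a simp rule, \<open>set_one\<close> turns the unit set \<open>1\<close> into \<open>{1}\<close> and thereby blocks the monoid laws.\<close>

declare set_one [simp del]

section \<open>Conjugation and the separation of ideal classes\<close>

definition coord_conj :: "coord \<Rightarrow> coord" where
  "coord_conj u = Coord (even_part u) (- odd_part u)"

lemma coord_conj_mult: "coord_conj (u * v) = coord_conj u * coord_conj v"
  and coord_conj_add: "coord_conj (u + v) = coord_conj u + coord_conj v"
  and coord_conj_zero: "coord_conj 0 = 0"
  and coord_conj_conj: "coord_conj (coord_conj u) = u"
  by (simp_all add: coord_conj_def coord_defs)

lemma coord_norm_conj: "coord_norm (coord_conj u) = coord_norm u"
  by (simp add: coord_conj_def coord_norm_def)

lemma coord_conj_ideal_span: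
  assumes "u \<in> ideal_span S"
  shows "coord_conj u \<in> ideal_span (coord_conj ` S)"
  using assms
proof (induction rule: ideal_span_induct)
  case (step c x y)
  have "coord_conj c * coord_conj x + coord_conj y \<in> ideal_span (coord_conj ` S)"
    using step by (intro ideal_span_add ideal_span_scale[OF ideal_span_base]) auto
  then show ?case by (simp add: coord_conj_mult coord_conj_add)
qed (simp add: coord_conj_zero ideal_span_zero)

lemma ideal_span_conj_image: "ideal_span (coord_conj ` S) = coord_conj ` ideal_span S"
proof
  show "coord_conj ` ideal_span S \<subseteq> ideal_span (coord_conj ` S)"
    using coord_conj_ideal_span by blast
  show "ideal_span (coord_conj ` S) \<subseteq> coord_conj ` ideal_span S"
  proof
    fix u assume "u \<in> ideal_span (coord_conj ` S)"
    then have "coord_conj u \<in> ideal_span S"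
      using coord_conj_ideal_span[of u "coord_conj ` S"] by (simp add: image_image coord_conj_conj)
    then show "u \<in> coord_conj ` ideal_span S" by (metis coord_conj_conj image_eqI)
  qed
qed

lemma coord_conj_set_times: "coord_conj ` (S * T) = coord_conj ` S * coord_conj ` T"
  unfolding set_times_def by (auto simp: coord_conj_mult[symmetric])

lemma ideal_span_conj_point_gens:
  "ideal_span (coord_conj ` point_gens a b) = ideal_span (point_gens a (- b))"
proof -
  have e: "coord_conj ` point_gens a b = {coordx - cconst a, - (coordy - cconst (- b))}"
    by (simp add: point_gens_def coord_conj_def coordx_def coordy_def cconst_def coord_defs)
  have "ideal_span {u, - v} = ideal_span {u, v}" for u v :: coord
  proof -
    have "(-1) * v \<in> ideal_span {u, v}" "(-1) * - v \<in> ideal_span {u, - v}"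
      by (intro ideal_span_scale ideal_span_base; simp)+
    then show ?thesis by (intro antisym ideal_span_minimal) (auto intro: ideal_span_base)
  qed
  then show ?thesis unfolding e by (simp only: point_gens_def)
qed

definition coord_eval :: "rat \<Rightarrow> rat \<Rightarrow> coord \<Rightarrow> rat" where
  "coord_eval a b u = poly (even_part u) a + b * poly (odd_part u) a"

lemma coord_eval_mult:
  assumes "wcurve a b"
  shows "coord_eval a b (u * v) = coord_eval a b u * coord_eval a b v"
proof -
  have "poly wpoly a = b * b" using assms
    by (simp add: wpoly_def wcurve_def algebra_simps eval_nat_numeral)
  then show ?thesis by (simp add: coord_eval_def times_coord_def algebra_simps)
qed

lemma coord_eval_add: "coord_eval a b (u + v) = coord_eval a b u + coord_eval a b v"
  by (simp add: coord_eval_def plus_coord_def algebra_simps)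

lemma coord_eval_ideal_span:
  assumes "wcurve a b" "\<And>s. s \<in> S \<Longrightarrow> coord_eval a b s = 0" "u \<in> ideal_span S"
  shows "coord_eval a b u = 0"
  using assms(3)
proof (induction rule: ideal_span_induct)
  case base
  show ?case by (simp add: coord_eval_def zero_coord_def)
qed (simp add: coord_eval_mult coord_eval_add assms)

lemma coord_eval_point_gens: "s \<in> point_gens a b \<Longrightarrow> coord_eval a b s = 0"
  by (auto simp: point_gens_def coord_eval_def coordx_def coordy_def cconst_def coord_defs)

text \<open>Taking norms, the square of the norm of \<open>w\<close> divides \<open>p ^ 2\<close>;
  so the norm of \<open>w\<close> has degree at most 2, while a nonzero odd part would force degree
  at least 3.\<close>

lemma odd_part_eq_0:
  assumes "w * coord_conj w dvd Coord p 0" "p \<noteq> 0" "degree p \<le> 2"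
  shows "odd_part w = 0"
proof (rule ccontr)
  assume o: "odd_part w \<noteq> 0"
  from assms(1) obtain v where "Coord p 0 = w * coord_conj w * v" by (auto simp: dvd_def)
  then have "coord_norm (Coord p 0) = coord_norm w ^ 2 * coord_norm v"
    by (simp add: coord_norm_mult coord_norm_conj power2_eq_square)
  then have dv: "coord_norm w ^ 2 dvd p ^ 2" by (simp add: coord_norm_def)
  have "2 * degree (coord_norm w) \<le> 2 * degree p"
    using dvd_imp_degree_le[OF dv] assms(2) coord_norm_eq_0_iff[of w] o
    by (auto simp: degree_power_eq zero_coord_def)
  then show False using degree_coord_norm[OF o] assms(3) by simp
qed

text \<open>If \<open>w\<close> generates the ideal, its conjugate generates that of the opposite
  point, and \<open>w * coord_conj w\<close> generates the ideal of
  \<open>coordx - cconst a\<close>. Hence \<open>w\<close> is a polynomial in x. It divides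
  \<open>coordy - cconst b\<close>, whose y-coefficient is 1, so it is a unit; but every element of
  the ideal vanishes at the point.\<close>

lemma point_gens_not_principal:
  assumes "wcurve a b"
  shows "\<not> point_gens a b \<approx> 1"
proof
  assume "point_gens a b \<approx> 1"
  then obtain w where w: "w \<noteq> 0" "ideal_span (point_gens a b) = ideal_span {w}"
    by (auto simp: ideal_equiv_one_iff)
  have "ideal_span (point_gens a (- b)) = ideal_span {coord_conj w}"
    unfolding ideal_span_conj_point_gens[symmetric] ideal_span_conj_image w(2)
    by (simp flip: ideal_span_conj_image)
  from ideal_span_times_cong[OF w(2) this]
  have "ideal_span {coordx - cconst a} = ideal_span {w * coord_conj w}"
    by (simp add: vertical_ideal assms sing_times_sing)
  then have "w * coord_conj w dvd coordx - cconst a"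
    using ideal_span_base[of "coordx - cconst a" "{coordx - cconst a}"]
    unfolding ideal_span_sing[symmetric] by simp
  moreover have "coordx - cconst a = Coord [:-a, 1:] 0"
    by (simp add: coordx_def cconst_def coord_defs)
  ultimately have o: "odd_part w = 0" by (intro odd_part_eq_0) auto
  have "w dvd coordy - cconst b"
    by (simp flip: ideal_span_sing w(2)) (simp add: ideal_span_base point_gens_def)
  then obtain v where v: "coordy - cconst b = w * v" by (auto simp: dvd_def)
  have "even_part w * odd_part v = 1" using arg_cong[OF v, of odd_part] o
    by (simp add: coordy_def cconst_def coord_defs)
  then have "w * Coord (odd_part v) 0 = 1" using o by (simp add: coord_defs)
  then have "1 \<in> ideal_span (point_gens a b)" unfolding w(2) ideal_span_sing by (metis dvd_triv_left)
  then have "coord_eval a b 1 = 0"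
    using coord_eval_ideal_span[OF assms coord_eval_point_gens] by blast
  then show False by (simp add: coord_eval_def one_coord_def)
qed

text \<open>Again multiplication by the conjugate shows that a generator \<open>w\<close> is a
  polynomial in x. It then divides the y-coefficients of all products of generators, among them
  \<open>x - c\<close>, \<open>x - a\<close> and \<open>- (b + d)\<close>, and it is not constant
  because the ideal vanishes at \<open>(a, b)\<close>.\<close>

lemma point_gens_times_principal:
  assumes "wcurve a b" "wcurve c d" "point_gens a b * point_gens c d \<approx> 1"
  shows "c = a \<and> d = - b"
proof -
  obtain w where w: "w \<noteq> 0" "ideal_span (point_gens a b * point_gens c d) = ideal_span {w}"
    using assms(3) by (auto simp: ideal_equiv_one_iff)
  have "ideal_span (point_gens a (- b) * point_gens c (- d)) =
      ideal_span (coord_conj ` (point_gens a b * point_gens c d))"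
    unfolding coord_conj_set_times by (intro ideal_span_times_cong ideal_span_conj_point_gens[symmetric])
  also have "\<dots> = ideal_span {coord_conj w}"
    unfolding ideal_span_conj_image w(2) by (simp flip: ideal_span_conj_image)
  finally have "ideal_span ({w} * {coord_conj w}) = ideal_span
      (point_gens a b * point_gens c d * (point_gens a (- b) * point_gens c (- d)))"
    by (rule sym[OF ideal_span_times_cong[OF w(2)]])
  also have "point_gens a b * point_gens c d * (point_gens a (- b) * point_gens c (- d))
      = (point_gens a b * point_gens a (- b)) * (point_gens c d * point_gens c (- d))"
    by (simp only: mult.assoc mult.left_commute)
  also have "ideal_span \<dots> = ideal_span ({coordx - cconst a} * {coordx - cconst c})"
    by (intro ideal_span_times_cong vertical_ideal assms)
  finally have "w * coord_conj w dvd (coordx - cconst a) * (coordx - cconst c)"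
    unfolding sing_times_sing ideal_span_sing[symmetric] by (simp add: ideal_span_base)
  moreover have "(coordx - cconst a) * (coordx - cconst c) = Coord ([:-a, 1:] * [:-c, 1:]) 0"
    by (simp add: coordx_def cconst_def coord_defs)
  moreover have "[:-a, 1:] * [:-c, 1:] \<noteq> 0" "degree ([:-a, 1:] * [:-c, 1:]) \<le> 2"
    by (auto simp: degree_mult_eq simp del: mult_pCons_left mult_pCons_right)
  ultimately have o: "odd_part w = 0" using odd_part_eq_0 by metis
  have dv: "even_part w dvd odd_part (s * t)" if "s \<in> point_gens a b" "t \<in> point_gens c d" for s t
  proof -
    have "w dvd s * t"
      unfolding ideal_span_sing[symmetric] w(2)[symmetric] by (intro ideal_span_base set_times_intro that)
    then obtain v where "s * t = w * v" by (auto simp: dvd_def)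
    then show ?thesis using o by (simp add: times_coord_def)
  qed
  have "even_part w dvd [:-c, 1:]" "even_part w dvd [:-a, 1:]" "even_part w dvd [:- (b + d):]"
    using dv[of "coordy - cconst b" "coordx - cconst c"] dv[of "coordx - cconst a" "coordy - cconst d"]
      dv[of "coordy - cconst b" "coordy - cconst d"]
    by (simp_all add: point_gens_def coordx_def coordy_def cconst_def coord_defs)
  moreover from dvd_diff[OF this(1,2)] have "even_part w dvd [:a - c:]" by simp
  moreover have "degree (even_part w) \<noteq> 0"
  proof
    assume "degree (even_part w) = 0"
    then obtain k where k: "even_part w = [:k:]" by (rule degree_eq_zeroE)
    with w(1) o have wk: "w = cconst k" "k \<noteq> 0" by (cases w; auto simp: cconst_def zero_coord_def)+
    have "w \<in> ideal_span (point_gens a b * point_gens c d)" unfolding w(2) by (simp add: ideal_span_base)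
    then have "coord_eval a b w = 0"
      by (rule coord_eval_ideal_span[OF assms(1), rotated])
         (auto elim!: set_times_elim simp: coord_eval_mult assms coord_eval_point_gens)
    then show False using wk by (simp add: coord_eval_def cconst_def)
  qed
  ultimately have "a - c = 0 \<and> b + d = 0"
    by (metis dvd_imp_degree_le degree_pCons_0 le_zero_eq neg_equal_0_iff_equal pCons_eq_0_iff)
  then show ?thesis by auto
qed

section \<open>The points as a group\<close>

typedef wpoint = "{P. case P of None \<Rightarrow> True | Some (x, y) \<Rightarrow> wcurve x y}"
  by (rule exI[of _ None]) simp

definition pt :: "rat \<Rightarrow> rat \<Rightarrow> wpoint" where "pt x y = Abs_wpoint (Some (x, y))"

instantiation wpoint :: "{zero, uminus, plus, minus}"
begin
definition "0 = Abs_wpoint None"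
definition "- P = (case Rep_wpoint P of None \<Rightarrow> 0 | Some (x, y) \<Rightarrow> pt x (- y))"
definition "P + Q = (case (Rep_wpoint P, Rep_wpoint Q) of
    (None, _) \<Rightarrow> Q
  | (_, None) \<Rightarrow> P
  | (Some (x1, y1), Some (x2, y2)) \<Rightarrow>
      if x1 = x2 \<and> y1 = - y2 then 0
      else let l = (if x1 = x2 then (3 * x1 ^ 2 + 10 * x1 - 32) / (2 * y1) else (y2 - y1) / (x2 - x1));
               x3 = l ^ 2 - 5 - x1 - x2
           in pt x3 (- (y1 + l * (x3 - x1))))"
definition "P - Q = P + - Q" for P Q :: wpoint
instance ..
end

lemma wcurve_minus: "wcurve x (- y) = wcurve x y" by (simp add: wcurve_def)

lemma Rep_wpoint_pt: "wcurve x y \<Longrightarrow> Rep_wpoint (pt x y) = Some (x, y)"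
  by (simp add: pt_def Abs_wpoint_inverse)

lemma Rep_wpoint_zero: "Rep_wpoint 0 = None"
  by (simp add: zero_wpoint_def Abs_wpoint_inverse)

lemma wpoint_cases:
  obtains "P = 0" | x y where "P = pt x y" "wcurve x y"
proof (cases "Rep_wpoint P")
  case None
  then show ?thesis using that(1) Rep_wpoint_inverse[of P] by (simp add: zero_wpoint_def)
next
  case (Some z)
  then show ?thesis using that(2)[of "fst z" "snd z"] Rep_wpoint[of P] Rep_wpoint_inverse[of P]
    by (simp add: pt_def case_prod_beta)
qed

lemma pt_eq_iff: "wcurve x y \<Longrightarrow> wcurve x' y' \<Longrightarrow> pt x y = pt x' y' \<longleftrightarrow> x = x' \<and> y = y'"
  by (metis Rep_wpoint_pt option.inject prod.inject)

lemma pt_neq_zero: "wcurve x y \<Longrightarrow> pt x y \<noteq> 0"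
  by (metis Rep_wpoint_pt Rep_wpoint_zero option.distinct(1))

lemma uminus_pt: "wcurve x y \<Longrightarrow> - pt x y = pt x (- y)"
  by (simp add: uminus_wpoint_def Rep_wpoint_pt)

lemma line_section_wcurve:
  assumes "line_section l n x1 x2 x3"
  shows "wcurve x1 (l * x1 + n)" "wcurve x2 (l * x2 + n)" "wcurve x3 (l * x3 + n)"
proof -
  have v: "x1 + x2 + x3 = l ^ 2 - 5" "x1 * x2 + x1 * x3 + x2 * x3 = - 32 - 2 * l * n"
    "x1 * x2 * x3 = n ^ 2" using assms by (auto simp: line_section_def)
  show "wcurve x1 (l * x1 + n)" "wcurve x2 (l * x2 + n)" "wcurve x3 (l * x3 + n)"
    unfolding wcurve_def using v by algebra+
qed

text \<open>Replaces the slope formulas by Vieta's relations, which treat chords and tangents alike;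
  later arguments about sums go through this case distinction.\<close>

lemma pt_add_cases:
  assumes "wcurve x1 y1" "wcurve x2 y2"
  obtains "x2 = x1" "y2 = - y1" "pt x1 y1 + pt x2 y2 = 0"
  | l n x3 where "line_section l n x1 x2 x3" "y1 = l * x1 + n" "y2 = l * x2 + n"
      "pt x1 y1 + pt x2 y2 = pt x3 (- (l * x3 + n))"
proof (cases "x1 = x2 \<and> y1 = - y2")
  case True
  then show ?thesis using that(1) assms by (simp add: plus_wpoint_def Rep_wpoint_pt)
next
  case False
  define l where "l = (if x1 = x2 then (3 * x1 ^ 2 + 10 * x1 - 32) / (2 * y1) else (y2 - y1) / (x2 - x1))"
  define x3 n where "x3 = l ^ 2 - 5 - x1 - x2" and "n = y1 - l * x1"
  have sum: "pt x1 y1 + pt x2 y2 = pt x3 (- (l * x3 + n))"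
    unfolding plus_wpoint_def Rep_wpoint_pt[OF assms(1)] Rep_wpoint_pt[OF assms(2)] option.case
      prod.case if_not_P[OF False] Let_def l_def[symmetric] x3_def[symmetric] n_def
    by (simp add: algebra_simps)
  have c: "y1 ^ 2 = x1 ^ 3 + 5 * x1 ^ 2 - 32 * x1" "y2 ^ 2 = x2 ^ 3 + 5 * x2 ^ 2 - 32 * x2"
    using assms by (auto simp: wcurve_def)
  have y1: "y1 = l * x1 + n" and s: "x1 + x2 + x3 = l ^ 2 - 5" by (simp_all add: n_def x3_def)
  have "y2 = l * x2 + n \<and> x1 * x2 + x1 * x3 + x2 * x3 = - 32 - 2 * l * n"
  proof (cases "x1 = x2")
    case True
    then have "y1 ^ 2 = y2 ^ 2" using c by simp
    then have yy: "y2 = y1" "y1 \<noteq> 0" using False True by (auto simp: power2_eq_iff)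
    then have "2 * y1 * l = 3 * x1 ^ 2 + 10 * x1 - 32" using True by (simp add: l_def)
    moreover have "x1 + x1 + x3 = l ^ 2 - 5" using s True by simp
    ultimately have "x1 * x1 + x1 * x3 + x1 * x3 = - 32 - 2 * l * n" using y1 by algebra
    then show ?thesis using True yy(1) y1 by simp
  next
    case False
    then have l: "(x2 - x1) * l = y2 - y1" by (simp add: l_def)
    then have y2: "y2 = l * x2 + n" using y1 by algebra
    \<comment> \<open>The second Vieta relation appears multiplied by \<open>x2 - x1\<close> when
      the two curve equations are subtracted. The third follows from the other two and one point of
      the curve.\<close>
    have "(x2 - x1) * (x1 * x2 + x1 * x3 + x2 * x3 + 32 + 2 * l * n) = 0"
      using c y1 y2 s by algebra
    then show ?thesis using False y2 by simp
  qed
  moreover from this have "x1 * x2 * x3 = n ^ 2" using c y1 s by algebra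
  ultimately show ?thesis using that(2) sum y1 s by (auto simp: line_section_def)
qed

definition wgens :: "wpoint \<Rightarrow> coord set" where
  "wgens P = (case Rep_wpoint P of None \<Rightarrow> 1 | Some (x, y) \<Rightarrow> point_gens x y)"

lemma wgens_pt: "wcurve x y \<Longrightarrow> wgens (pt x y) = point_gens x y"
  by (simp add: wgens_def Rep_wpoint_pt)

lemma wgens_zero: "wgens 0 = 1"
  by (simp add: wgens_def Rep_wpoint_zero)

lemma ideal_equivI: "ideal_span S = ideal_span {w} \<Longrightarrow> w \<noteq> 0 \<Longrightarrow> S \<approx> 1"
  by (auto simp: ideal_equiv_one_iff)

lemma wgens_line:
  assumes "line_section l n x1 x2 x3"
  shows "wgens (pt x1 (l * x1 + n)) * wgens (pt x2 (l * x2 + n)) * wgens (pt x3 (l * x3 + n)) \<approx> 1"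
proof -
  have "coordy - cconst l * coordx - cconst n \<noteq> 0"
    by (simp add: coordx_def coordy_def cconst_def coord_defs)
  then show ?thesis using ideal_equivI[OF line_ideal[OF assms]] line_section_wcurve[OF assms]
    by (simp add: wgens_pt)
qed

lemma wpoint_add_zero: "0 + P = P" "P + 0 = (P :: wpoint)"
  by (cases P rule: wpoint_cases; simp add: plus_wpoint_def Rep_wpoint_zero Rep_wpoint_pt)+

lemma wpoint_minus_zero: "- 0 = (0 :: wpoint)"
  by (simp add: uminus_wpoint_def Rep_wpoint_zero)

lemma wgens_uminus: "wgens P * wgens (- P) \<approx> 1"
proof (cases P rule: wpoint_cases)
  case 1
  then show ?thesis by (simp add: wgens_zero wpoint_minus_zero ideal_equiv_refl)
next
  case (2 x y)
  have "coordx - cconst x \<noteq> 0" by (simp add: coordx_def cconst_def coord_defs)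
  then show ?thesis using 2 ideal_equivI[OF vertical_ideal[OF 2(2)]]
    by (simp add: uminus_pt wgens_pt wcurve_minus)
qed

lemma ideal_equiv_cancel:
  assumes "A * U \<approx> B * U" "U * V \<approx> 1"
  shows "A \<approx> B"
proof -
  have *: "S * (U * V) \<approx> S" for S
    using ideal_equiv_times[OF ideal_equiv_refl assms(2), of S] by simp
  have "A \<approx> A * (U * V)" by (rule ideal_equiv_sym[OF *])
  also have "A * (U * V) = A * U * V" by (simp add: mult.assoc)
  also have "\<dots> \<approx> B * U * V" by (rule ideal_equiv_times[OF assms(1) ideal_equiv_refl])
  also have "B * U * V = B * (U * V)" by (simp add: mult.assoc)
  also have "\<dots> \<approx> B" by (rule *)
  finally show ?thesis .
qed

text \<open>For three points P, Q, R on a line the product of the three ideals is principal, and so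
  is the product for R and -R. Cancelling R leaves the class of -R, which is P + Q.\<close>

lemma wgens_add: "wgens P * wgens Q \<approx> wgens (P + Q)"
proof (cases P rule: wpoint_cases)
  case 1
  then show ?thesis by (simp add: wgens_zero wpoint_add_zero ideal_equiv_refl)
next
  case P: (2 x1 y1)
  show ?thesis
  proof (cases Q rule: wpoint_cases)
    case 1
    then show ?thesis by (simp add: wgens_zero wpoint_add_zero ideal_equiv_refl)
  next
    case Q: (2 x2 y2)
    show ?thesis using P(2) Q(2)
    proof (cases rule: pt_add_cases)
      case 1
      then show ?thesis using wgens_uminus[of P] P Q by (simp add: uminus_pt wgens_zero)
    next
      case (2 l n x3)
      let ?R = "pt x3 (l * x3 + n)"
      have "- ?R = P + Q" using 2 line_section_wcurve[OF 2(1)] P Q by (simp add: uminus_pt)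
      then have "wgens (P + Q) * wgens ?R \<approx> 1" using wgens_uminus[of ?R] by (simp add: mult.commute)
      from ideal_equiv_trans[OF wgens_line[OF 2(1)] ideal_equiv_sym[OF this]]
      show ?thesis using ideal_equiv_cancel[OF _ wgens_uminus] P Q 2 by simp
    qed
  qed
qed

lemma wgens_mult_eq_1_imp:
  assumes "wgens P * wgens Q \<approx> 1"
  shows "Q = - P"
proof (cases P rule: wpoint_cases)
  case 1
  then show ?thesis using assms point_gens_not_principal
    by (cases Q rule: wpoint_cases) (auto simp: wgens_zero wgens_pt wpoint_minus_zero)
next
  case P: (2 x1 y1)
  show ?thesis
  proof (cases Q rule: wpoint_cases)
    case 1
    then show ?thesis using assms P point_gens_not_principal by (auto simp: wgens_zero wgens_pt)
  next
    case Q: (2 x2 y2)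
    then show ?thesis using assms P point_gens_times_principal[of x1 y1 x2 y2]
      by (auto simp: wgens_pt uminus_pt)
  qed
qed

lemma wpoint_uminus_uminus: "- (- P) = (P :: wpoint)"
  by (cases P rule: wpoint_cases) (auto simp: wpoint_minus_zero uminus_pt wcurve_minus)

lemma wgens_inj:
  assumes "wgens P \<approx> wgens Q"
  shows "P = Q"
proof -
  have "wgens P * wgens (- Q) \<approx> wgens Q * wgens (- Q)"
    by (intro ideal_equiv_times assms ideal_equiv_refl)
  also have "\<dots> \<approx> 1" by (rule wgens_uminus)
  finally have "- Q = - P" by (rule wgens_mult_eq_1_imp)
  then show ?thesis by (metis wpoint_uminus_uminus)
qed

instance wpoint :: ab_group_add
proof
  fix P Q R :: wpoint
  have "wgens (P + Q + R) \<approx> wgens P * wgens Q * wgens R"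
    by (meson ideal_equiv_refl ideal_equiv_sym ideal_equiv_times ideal_equiv_trans wgens_add)
  also have "wgens P * wgens Q * wgens R = wgens P * (wgens Q * wgens R)" by (rule mult.assoc)
  also have "\<dots> \<approx> wgens (P + (Q + R))"
    by (meson ideal_equiv_refl ideal_equiv_sym ideal_equiv_times ideal_equiv_trans wgens_add)
  finally show "P + Q + R = P + (Q + R)" by (rule wgens_inj)
  have "wgens (P + Q) \<approx> wgens P * wgens Q" by (rule ideal_equiv_sym[OF wgens_add])
  also have "wgens P * wgens Q = wgens Q * wgens P" by (rule mult.commute)
  also have "\<dots> \<approx> wgens (Q + P)" by (rule wgens_add)
  finally show "P + Q = Q + P" by (rule wgens_inj)
  have "wgens (- P + P) \<approx> wgens (- P) * wgens P" by (rule ideal_equiv_sym[OF wgens_add])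
  also have "\<dots> = wgens P * wgens (- P)" by (rule mult.commute)
  also have "\<dots> \<approx> wgens 0" unfolding wgens_zero by (rule wgens_uminus)
  finally show "- P + P = 0" by (rule wgens_inj)
qed (simp_all add: wpoint_add_zero minus_wpoint_def)

text \<open>Obtained from the ideal classes: no slope has to be computed and no tangent case
  separated, so explicit sums reduce to checking Vieta's relations.\<close>

lemma line_sum:
  assumes "line_section l n x1 x2 x3"
  shows "pt x1 (l * x1 + n) + pt x2 (l * x2 + n) = pt x3 (- (l * x3 + n))"
proof -
  let ?P = "pt x1 (l * x1 + n)" and ?Q = "pt x2 (l * x2 + n)" and ?R = "pt x3 (l * x3 + n)"
  have "wgens (?P + ?Q) * wgens ?R \<approx> wgens ?P * wgens ?Q * wgens ?R"
    by (intro ideal_equiv_times ideal_equiv_refl ideal_equiv_sym[OF wgens_add])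
  also have "\<dots> \<approx> 1" by (rule wgens_line[OF assms])
  finally have "?R = - (?P + ?Q)" by (rule wgens_mult_eq_1_imp)
  then have "?P + ?Q = - ?R" by (simp del: minus_add_distrib)
  then show ?thesis by (simp only: uminus_pt[OF line_section_wcurve(3)[OF assms]])
qed

section \<open>Halving a point\<close>

lemma rat_square_int:
  fixes y :: rat
  assumes "y ^ 2 = of_int n"
  obtains m where "y = of_int m"
proof -
  obtain p q where pq: "quotient_of y = (p, q)" by (cases "quotient_of y")
  have y: "y = of_int p / of_int q" and q: "q > 0" and cop: "coprime p q"
    using quotient_of_div[OF pq] quotient_of_denom_pos[OF pq] quotient_of_coprime[OF pq] by auto
  have "of_int (p ^ 2) = (of_int (n * q ^ 2) :: rat)"
    using assms q unfolding y by (simp add: field_simps)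
  then have "p ^ 2 = n * q ^ 2" by (simp only: of_int_eq_iff)
  then have "q ^ 2 dvd p ^ 2" by simp
  then have "q dvd p" by simp
  then have "q = 1" using cop q by (metis coprime_absorb_right zdvd1_eq abs_of_pos)
  then show ?thesis using y that by simp
qed

text \<open>The root is \<open>gcd q m\<close>: its square is
  \<open>gcd (q * q) (q * K) = q * gcd q K = q\<close>.\<close>

lemma coprime_mult_square_imp_square:
  fixes q K m :: int
  assumes "coprime q K" "q > 0" "q * K = m ^ 2"
  obtains e where "e > 0" "q = e ^ 2"
proof -
  have "gcd q m ^ 2 = gcd (q ^ 2) (m ^ 2)" by (simp add: gcd_exp_weak)
  also have "\<dots> = gcd (q * q) (q * K)" by (simp add: assms(3) power2_eq_square)
  also have "\<dots> = q * gcd q K" using assms(2) by (simp flip: gcd_mult_distrib_int)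
  finally show ?thesis using that[of "gcd q m"] assms(1,2) by auto
qed

lemma squarefree_dvd_square_imp_dvd:
  fixes d z :: int
  assumes "squarefree d" "d dvd z ^ 2"
  shows "d dvd z"
proof -
  have d: "d \<noteq> 0" using assms(1) by auto
  define g where "g = gcd d z"
  then have g: "g \<noteq> 0" using d by simp
  obtain d' z' where dz: "d = g * d'" "z = g * z'" "coprime d' z'"
    unfolding g_def using gcd_coprime_exists[of d z] d by (auto simp: mult.commute)
  have "g * d' dvd g * (g * z' ^ 2)" using assms(2) dz by (simp add: power2_eq_square ac_simps)
  then have "d' dvd g * z' ^ 2" using g by simp
  then have "d' dvd g" using dz(3) by (simp add: coprime_dvd_mult_left_iff)
  then have "d' ^ 2 dvd d" unfolding dz(1) power2_eq_square by (intro mult_dvd_mono) auto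
  then have "d' dvd 1" using assms(1) by (rule squarefreeD[rotated])
  then have "d dvd g" unfolding dz(1) by (simp add: mult_unit_dvd_iff)
  then show ?thesis using g_def dvd_trans by blast
qed

text \<open>Kept general in \<open>a\<close> and \<open>b\<close> because it serves both the curve
  and the isogenous curve. For \<open>x = p / q\<close> in lowest terms the product
  \<open>q * (p * s)\<close> is a square with \<open>q\<close> coprime to \<open>p * s\<close>, so
  \<open>q\<close> and \<open>p * s\<close> are squares up to sign considerations settled by
  \<open>q > 0\<close>; \<open>d\<close> is the square class of \<open>p\<close>.\<close>

lemma square_class_parametrization:
  fixes x y :: rat and a b :: int
  assumes eq: "y ^ 2 = x ^ 3 + of_int a * x ^ 2 + of_int b * x" and "x \<noteq> 0"
  obtains d b' M e N :: int
  where "squarefree d" "b = d * b'" "M > 0" "e > 0" "coprime (d * M) e"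
    "x = of_int (d * M ^ 2) / of_int (e ^ 2)" "y = of_int (d * M * N) / of_int (e ^ 3)"
    "N ^ 2 = d * M ^ 4 + a * M ^ 2 * e ^ 2 + b' * e ^ 4"
proof -
  obtain p q where pq: "quotient_of x = (p, q)" by (cases "quotient_of x")
  have x: "x = of_int p / of_int q" and q: "q > 0" and cop: "coprime p q"
    using quotient_of_div[OF pq] quotient_of_denom_pos[OF pq] quotient_of_coprime[OF pq] by auto
  define s where "s = p ^ 2 + a * p * q + b * q ^ 2"
  have p0: "p \<noteq> 0" using x \<open>x \<noteq> 0\<close> by auto
  have "(y * of_int q ^ 2) ^ 2 = y ^ 2 * of_int q ^ 4" by (simp add: power_mult_distrib flip: power_mult)
  also have "\<dots> = of_int (q * (p * s))"
    unfolding eq s_def x using q by (simp add: field_simps eval_nat_numeral)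
  finally have Y2: "(y * of_int q ^ 2) ^ 2 = of_int (q * (p * s))" .
  then obtain m where m: "y * of_int q ^ 2 = of_int m" by (rule rat_square_int)
  have m2: "q * (p * s) = m ^ 2" using Y2 unfolding m by (metis of_int_eq_iff of_int_power)
  have "coprime q s"
  proof -
    have "s = p ^ 2 + q * (a * p + b * q)" by (simp add: s_def power2_eq_square algebra_simps)
    moreover have "coprime q (p ^ 2)" using cop by (simp add: coprime_commute)
    ultimately show ?thesis by (metis add.commute coprime_iff_gcd_eq_1 gcd_add_mult mult.commute)
  qed
  then have copq: "coprime q (p * s)" using cop by (simp add: coprime_commute)
  from copq q m2 obtain e where e: "e > 0" "q = e ^ 2" by (rule coprime_mult_square_imp_square)
  from copq have "coprime (p * s) q" by (simp add: coprime_commute)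
  have "e dvd m"
  proof -
    have "e ^ 2 dvd m ^ 2" using m2 e by (metis dvd_triv_left)
    then show ?thesis by simp
  qed
  then obtain n where n: "m = e * n" ..
  have n2: "p * s = n ^ 2" using m2 e n by (simp add: power_mult_distrib)
  define d where "d = squarefree_part p"
  define M where "M = \<bar>square_part p\<bar>"
  have d: "squarefree d" "d \<noteq> 0" by (simp_all add: d_def squarefree_squarefree_part)
  have pM: "p = d * M ^ 2" unfolding d_def M_def power2_abs by (rule squarefree_decompose)
  have M: "M > 0" using p0 unfolding M_def by simp
  have "M ^ 2 dvd n ^ 2" using n2 pM by (metis dvd_mult dvd_mult2 dvd_refl mult.commute)
  then have "M dvd n" by simp
  then obtain n1 where n1: "n = M * n1" ..
  have n1': "d * s = n1 ^ 2" using n2 pM n1 M by (simp add: power_mult_distrib)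
  then have "d dvd n1 ^ 2" by (rule dvdI[OF sym])
  with d(1) have "d dvd n1" by (rule squarefree_dvd_square_imp_dvd)
  then obtain N where N: "n1 = d * N" ..
  have sN: "s = d * N ^ 2" using n1' N d(2) by (simp add: power2_eq_square)
  have cdq: "coprime (d * M) e" using cop unfolding pM e by simp
  \<comment> \<open>Of the terms of \<open>s\<close>, only \<open>b * q ^ 2\<close> is not visibly
    divisible by \<open>d\<close>; since \<open>d\<close> is coprime to \<open>q\<close>, it divides
    \<open>b\<close>.\<close>
  have "b * q ^ 2 = d * (N ^ 2 - M ^ 2 * p - a * M ^ 2 * q)"
    using sN unfolding s_def pM by (simp add: algebra_simps power2_eq_square)
  then have "d dvd b * q ^ 2" by simp
  moreover have "coprime d (q ^ 2)" using cdq e by simp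
  ultimately have "d dvd b" by (simp add: coprime_dvd_mult_left_iff)
  then obtain b' where b': "b = d * b'" ..
  have "d * N ^ 2 = d * (d * M ^ 4 + a * M ^ 2 * e ^ 2 + b' * e ^ 4)"
    using sN unfolding s_def pM e b' by (simp add: algebra_simps eval_nat_numeral)
  then have N2: "N ^ 2 = d * M ^ 4 + a * M ^ 2 * e ^ 2 + b' * e ^ 4" using d(2) by simp
  have "y * of_int (e ^ 4) = of_int (e * (M * (d * N)))" using m unfolding e n n1 N by (simp flip: power_mult)
  then have "y = of_int (d * M * N) / of_int (e ^ 3)"
    using e(1) by (simp add: field_simps eval_nat_numeral)
  then show ?thesis using that[OF d(1) b' M e(1) cdq _ _ N2] x pM e by simp
qed

lemma three_dvd_sum_squares:
  fixes a b :: int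
  assumes "3 dvd a ^ 2 + b ^ 2"
  shows "3 dvd a" "3 dvd b"
proof -
  define i j where ij: "i = a mod 3" "j = b mod 3"
  obtain A B where "a = 3 * A + i" "b = 3 * B + j"
    unfolding ij by (metis mult_div_mod_eq)
  then have "a ^ 2 + b ^ 2 = 3 * (3 * A ^ 2 + 2 * A * i + 3 * B ^ 2 + 2 * B * j) + (i ^ 2 + j ^ 2)"
    by algebra
  then have "3 dvd i ^ 2 + j ^ 2" using assms by (simp only: dvd_add_right_iff dvd_triv_left)
  moreover have "i \<in> {0, 1, 2}" "j \<in> {0, 1, 2}" unfolding ij by auto
  ultimately have "i = 0 \<and> j = 0" by auto
  then show "3 dvd a" "3 dvd b" unfolding ij by auto
qed

text \<open>Since $(2r^2 + 5 + 2u)(2r^2 + 5 - 2u) = 153$, both factors are abscissae on the isogenous curve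
  $y^2 = x^3 - 10x^2 + 153x$, and one of the two is a square.\<close>

lemma halving_class:
  fixes r u :: rat
  assumes r: "r \<noteq> 0" and u: "u ^ 2 = r ^ 4 + 5 * r ^ 2 - 32"
  obtains h v where "v = u \<or> v = - u" "h ^ 2 = 2 * r ^ 2 + 5 + 2 * v"
proof -
  define g g' where g: "g = 2 * r ^ 2 + 5 + 2 * u" "g' = 2 * r ^ 2 + 5 - 2 * u"
  have gg: "g * g' = 153" using u unfolding g by algebra
  have "g + g' > 0" unfolding g by (simp add: add_nonneg_pos)
  then have pos: "g > 0" using gg zero_less_mult_iff[of g g'] by auto
  have "g + g' - 10 = 4 * r ^ 2" unfolding g by simp
  \<comment> \<open>The right-hand side is \<open>g ^ 2 * (g + g' - 10)\<close>, which exhibits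
    \<open>g\<close> as an abscissa on the isogenous curve.\<close>
  then have "(2 * r * g) ^ 2 = g ^ 3 - 10 * g ^ 2 + (g * g') * g" by algebra
  then have E: "(2 * r * g) ^ 2 = g ^ 3 + of_int (- 10) * g ^ 2 + of_int 153 * g" unfolding gg by simp
  have "g \<noteq> 0" using pos by simp
  with E obtain d b' M e N :: int
  where d: "squarefree d" "153 = d * b'" "M > 0" "e > 0" "coprime (d * M) e"
    and gd: "g = of_int (d * M ^ 2) / of_int (e ^ 2)"
    and N: "N ^ 2 = d * M ^ 4 + (- 10) * M ^ 2 * e ^ 2 + b' * e ^ 4"
    by (rule square_class_parametrization)
  have "d > 0"
    using pos d(3,4) unfolding gd by (simp add: zero_less_divide_iff zero_less_mult_iff)
  have "d \<in> {1, 3, 17, 51}"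
  proof -
    have "d dvd 153" unfolding d(2) by simp
    then have "d \<le> 153" by (rule zdvd_imp_le) simp
    moreover have "\<not> 3 ^ 2 dvd d" using squarefreeD[OF d(1), of 3] by auto
    ultimately have "d \<in> {k \<in> {1..153}. k dvd 153 \<and> \<not> 9 dvd k}" using \<open>d > 0\<close> \<open>d dvd 153\<close> by simp
    also have "{k \<in> {1..153}. k dvd 153 \<and> \<not> 9 dvd k} = {1, 3, 17, 51 :: int}" by code_simp
    finally show ?thesis .
  qed
  moreover have "\<not> 3 dvd d"
  proof
    assume "3 dvd d"
    then have db: "d = 3 \<and> b' = 51 \<or> d = 51 \<and> b' = 3" using \<open>d \<in> _\<close> d(2) by auto
    have e3: "\<not> 3 dvd e" using d(5) \<open>3 dvd d\<close> by (auto dest: coprime_common_divisor)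
    \<comment> \<open>Since -10 is congruent to -1 modulo 3, both classes divisible by 3 lead to a
      sum of two squares divisible by 3. Then 3 divides \<open>N\<close> and \<open>M\<close>, and
      comparison modulo 9 forces it to divide \<open>e\<close>.\<close>
    have *: "N ^ 2 + (M * e) ^ 2 = d * M ^ 4 + b' * e ^ 4 - 9 * (M * e) ^ 2"
      using N by (simp add: power_mult_distrib)
    have "3 dvd b'" using db by auto
    with \<open>3 dvd d\<close> have "3 dvd N ^ 2 + (M * e) ^ 2" unfolding * by (intro dvd_diff dvd_add) auto
    then have NM: "3 dvd N" "3 dvd M * e" by (rule three_dvd_sum_squares)+
    have "3 dvd M" using NM(2) e3 by (simp add: prime_dvd_mult_iff)
    then obtain M' N' where MN: "M = 3 * M'" "N = 3 * N'" using NM(1) by (auto elim!: dvdE)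
    have "b' * e ^ 4 = 9 * (N' ^ 2 - 9 * d * M' ^ 4 + 10 * M' ^ 2 * e ^ 2)"
      using N unfolding MN by (simp add: power_mult_distrib)
    then have "9 dvd b' * e ^ 4" by simp
    moreover have "b' = 51 \<or> b' = 3" using db by auto
    moreover have "3 dvd t" if "9 dvd 51 * t \<or> 9 dvd 3 * t" for t :: int using that by presburger
    ultimately have "3 dvd e ^ 4" by auto
    then show False using e3 prime_dvd_power[of 3 e 4] by simp
  qed
  ultimately consider "d = 1" | "d = 17" by auto
  then show ?thesis
  proof cases
    case 1
    then have "(of_int M / of_int e) ^ 2 = g" using gd by (simp add: power_divide)
    then show ?thesis using that[of u] g by auto
  next
    case 2
    \<comment> \<open>If \<open>g\<close> is 17 times a square, then \<open>g' = 153 / g\<close> is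
      a square because \<open>153 = 9 * 17\<close>; changing the sign of \<open>u\<close> exchanges
      \<open>g\<close> and \<open>g'\<close>.\<close>
    have "(3 * of_int e / (of_int M)) ^ 2 * g = 153" using gd 2 d by (simp add: power_divide field_simps)
    then have "(3 * of_int e / (of_int M)) ^ 2 = g'" using gg pos by (metis less_irrefl mult.commute mult_cancel_left)
    then show ?thesis using that[of "- u"] g by auto
  qed
qed

text \<open>A half \<open>(X, h * X)\<close> of a point with abscissa \<open>r ^ 2\<close> satisfies
  \<open>X + 32 / X = 2 * r * h\<close> by the duplication formula and
  \<open>X - 32 / X = h ^ 2 - 5\<close> by the curve equation. The sum of the two determines
  \<open>X\<close>; \<open>rh\<close> is the compatibility of the two. The tangent at the half has
  slope \<open>h + r\<close>.\<close>

lemma halving_point: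
  fixes r u :: rat
  assumes r: "r \<noteq> 0" and u: "u ^ 2 = r ^ 4 + 5 * r ^ 2 - 32"
  obtains h X v where "v = u \<or> v = - u" "h \<noteq> 0" "X \<noteq> 0" "X ^ 2 + 32 = 2 * r * h * X"
    "wcurve X (h * X)" "pt X (h * X) + pt X (h * X) = pt (r ^ 2) (r * v)"
proof -
  obtain h v where v: "v = u \<or> v = - u" and h: "h ^ 2 = 2 * r ^ 2 + 5 + 2 * v"
    using r u by (rule halving_class)
  have v2: "v ^ 2 = r ^ 4 + 5 * r ^ 2 - 32" using u v by auto
  have h0: "h \<noteq> 0"
  proof
    assume "h = 0"
    then have "2 * v = - (2 * r ^ 2 + 5)" using h by simp
    then have "153 = (0 :: rat)" using v2 by algebra
    then show False by simp
  qed
  have rh: "(2 * r * h) ^ 2 = h ^ 4 - 10 * h ^ 2 + 153"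
  proof -
    have "h ^ 2 * (2 * r ^ 2 + 5 - 2 * v) = 153" using h v2 by algebra
    moreover have "(2 * r * h) ^ 2 =
        h ^ 2 * (2 * r ^ 2 + 5 + 2 * v) + h ^ 2 * (2 * r ^ 2 + 5 - 2 * v) - 10 * h ^ 2" by algebra
    ultimately show ?thesis unfolding h[symmetric] by simp
  qed
  define X where "X = (2 * r * h + h ^ 2 - 5) / 2"
  have X: "2 * X = 2 * r * h + h ^ 2 - 5" by (simp add: X_def)
  have XX: "X ^ 2 + 32 = 2 * r * h * X" using rh X by algebra
  then have X0: "X \<noteq> 0" by auto
  have "X + X + r ^ 2 = (h + r) ^ 2 - 5" using X by algebra
  moreover have "X * X + X * r ^ 2 + X * r ^ 2 = - 32 - 2 * (h + r) * (- r * X)" using XX by algebra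
  moreover have "X * X * r ^ 2 = (- r * X) ^ 2" by algebra
  ultimately have "line_section (h + r) (- r * X) X X (r ^ 2)" by (simp add: line_section_def)
  from line_sum[OF this] line_section_wcurve(1)[OF this]
  have "pt X (h * X) + pt X (h * X) = pt (r ^ 2) (- ((h + r) * r ^ 2 - r * X))" "wcurve X (h * X)"
    by (simp_all add: algebra_simps)
  moreover have "- ((h + r) * r ^ 2 - r * X) = r * v" using X h by algebra
  ultimately show ?thesis using that v h0 X0 XX by auto
qed

section \<open>The size of a half\<close>

text \<open>The division is exact for the four values of \<open>d\<close>, so
  \<open>- (32 div d)\<close> is the cofactor of \<open>d\<close> in -32.\<close>

definition descent_rep :: "int \<Rightarrow> int \<Rightarrow> int \<Rightarrow> int \<Rightarrow> bool" where
  "descent_rep d M e N \<longleftrightarrow> d \<in> {1, -1, 2, -2} \<and> M > 0 \<and> e > 0 \<and> coprime (d * M) e \<and>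
     N ^ 2 = d * M ^ 4 + 5 * M ^ 2 * e ^ 2 - (32 div d) * e ^ 4"

definition descent_pt :: "int \<Rightarrow> int \<Rightarrow> int \<Rightarrow> int \<Rightarrow> wpoint" where
  "descent_pt d M e N = pt (of_int (d * M ^ 2) / of_int (e ^ 2)) (of_int (d * M * N) / of_int (e ^ 3))"

lemma wcurve_imp_descent_rep:
  assumes "wcurve x y" "x \<noteq> 0"
  obtains d M e N where "descent_rep d M e N"
    "x = of_int (d * M ^ 2) / of_int (e ^ 2)" "y = of_int (d * M * N) / of_int (e ^ 3)"
proof -
  have E: "y ^ 2 = x ^ 3 + of_int 5 * x ^ 2 + of_int (- 32) * x" using assms(1) by (simp add: wcurve_def)
  from E assms(2) obtain d b' M e N :: int
    where d: "squarefree d" "- 32 = d * b'" "M > 0" "e > 0" "coprime (d * M) e"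
      and xy: "x = of_int (d * M ^ 2) / of_int (e ^ 2)" "y = of_int (d * M * N) / of_int (e ^ 3)"
      and N: "N ^ 2 = d * M ^ 4 + 5 * M ^ 2 * e ^ 2 + b' * e ^ 4"
    by (rule square_class_parametrization)
  have "d dvd - 32" unfolding d(2) by simp
  then have dv: "d dvd 32" by simp
  then have "\<bar>d\<bar> \<le> 32" by (metis abs_numeral dvd_imp_le_int zero_neq_numeral)
  moreover have "\<not> 2 ^ 2 dvd d" using squarefreeD[OF d(1), of 2] by auto
  ultimately have "d \<in> {k \<in> {-32..32}. k dvd 32 \<and> \<not> 4 dvd k}" using dv by auto
  also have "{k \<in> {-32..32}. k dvd 32 \<and> \<not> 4 dvd k} = {1, -1, 2, -2 :: int}" by code_simp
  finally have d4: "d \<in> {1, -1, 2, -2}" .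
  then have "b' = - (32 div d)" using d(2) by auto
  then show ?thesis using that[of d M e N] d d4 xy N by (simp add: descent_rep_def)
qed

lemma descent_pt_wcurve:
  assumes "descent_rep d M e N"
  shows "wcurve (of_int (d * M ^ 2) / of_int (e ^ 2)) (of_int (d * M * N) / of_int (e ^ 3))"
proof -
  have d: "d \<in> {1, -1, 2, -2}" and e: "e > 0"
    and N: "N ^ 2 = d * M ^ 4 + 5 * M ^ 2 * e ^ 2 - (32 div d) * e ^ 4"
    using assms by (auto simp: descent_rep_def)
  define c where "c = 32 div d"
  have dc: "d * c = 32" using d by (auto simp: c_def)
  have "(d * M * N) ^ 2 = (d * M) ^ 2 * N ^ 2" by algebra
  also have "\<dots> = (d * M ^ 2) ^ 3 + 5 * (d * M ^ 2) ^ 2 * e ^ 2 - d * c * (d * M ^ 2) * e ^ 4"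
    unfolding N c_def[symmetric] by algebra
  finally have "(d * M * N) ^ 2 = (d * M ^ 2) ^ 3 + 5 * (d * M ^ 2) ^ 2 * e ^ 2 - 32 * (d * M ^ 2) * e ^ 4"
    unfolding dc .
  then have "(of_int (d * M * N) :: rat) ^ 2 =
      of_int (d * M ^ 2) ^ 3 + 5 * of_int (d * M ^ 2) ^ 2 * of_int e ^ 2 - 32 * of_int (d * M ^ 2) * of_int e ^ 4"
    by (metis (mono_tags, lifting) of_int_add of_int_diff of_int_mult of_int_numeral of_int_power)
  moreover define x y :: rat where "x = of_int (d * M ^ 2) / of_int (e ^ 2)"
    and "y = of_int (d * M * N) / of_int (e ^ 3)"
  moreover from this have "x * of_int e ^ 2 = of_int (d * M ^ 2)" "y * of_int e ^ 3 = of_int (d * M * N)"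
    using e by simp_all
  ultimately have "y ^ 2 * of_int e ^ 6 = (x ^ 3 + 5 * x ^ 2 - 32 * x) * of_int e ^ 6" by algebra
  then show ?thesis using e unfolding wcurve_def x_def[symmetric] y_def[symmetric] by simp
qed

lemma descent_pt_uminus:
  "descent_rep d M e N \<Longrightarrow> - descent_pt d M e N = descent_pt d M e (- N)"
  using descent_pt_wcurve by (simp add: descent_pt_def uminus_pt)

lemma descent_rep_uminus: "descent_rep d M e (- N) = descent_rep d M e N"
  by (simp add: descent_rep_def)

text \<open>The factor $96 = 16 \cdot 6$ bounds the cancellation in
  $r = (d M^4 + (32/d) e^4) / (2 N M e)$: with $G = \gcd(N, M e)$ it is a divisor of $6$ times $G^2$,
  and $G^2$ divides $32$.\<close>

lemma halving_numerator_bound: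
  assumes rep: "descent_rep d M e N" and cop: "coprime a b"
    and eq: "(d * M ^ 4 + 32 div d * e ^ 4) * b = a * (2 * N * M * e)" and "b \<noteq> 0"
  shows "M ^ 4 + 16 * e ^ 4 \<le> 96 * \<bar>a\<bar>"
proof -
  define c where "c = 32 div d"
  have d: "d \<in> {1, -1, 2, -2}" and Me: "M > 0" "e > 0" "coprime (d * M) e"
    and N: "N ^ 2 = d * M ^ 4 + 5 * M ^ 2 * e ^ 2 - c * e ^ 4"
    using rep by (auto simp: descent_rep_def c_def)
  have dc: "d * c = 32" using d by (auto simp: c_def)
  define A where "A = d * M ^ 4 + c * e ^ 4"
  \<comment> \<open>\<open>A\<close> is the sum of two terms whose difference is
    \<open>N ^ 2 - 5 * (M * e) ^ 2\<close> and whose product is \<open>32 * (M * e) ^ 4\<close>;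
    hence its square is a form in \<open>N\<close> and \<open>M * e\<close>, with
    \<open>153 = 25 + 128\<close>.\<close>
  have A2: "A ^ 2 = N ^ 4 - 10 * N ^ 2 * (M * e) ^ 2 + 153 * (M * e) ^ 4"
  proof -
    have "A ^ 2 = (d * M ^ 4 - c * e ^ 4) ^ 2 + 4 * (d * c) * (M * e) ^ 4" unfolding A_def by algebra
    also have "d * M ^ 4 - c * e ^ 4 = N ^ 2 - 5 * (M * e) ^ 2" using N by (simp add: power_mult_distrib)
    finally show ?thesis unfolding dc by algebra
  qed
  define G where "G = gcd N (M * e)"
  have G: "G > 0" using Me by (simp add: G_def)
  obtain H f where Hf: "N = G * H" "M * e = G * f" "coprime H f"
    using gcd_coprime_exists[of N "M * e"] G unfolding G_def by (auto simp: mult.commute)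
  have "coprime G e"
  proof (rule coprimeI)
    fix k assume k: "k dvd G" "k dvd e"
    have "k dvd N" using k(1) by (simp add: G_def)
    then have "k dvd N ^ 2 - e * (5 * M ^ 2 * e - c * e ^ 3)"
      using k(2) by (intro dvd_diff dvd_mult2) (auto simp: power2_eq_square)
    also have "N ^ 2 - e * (5 * M ^ 2 * e - c * e ^ 3) = d * M ^ 4"
      using N by (simp add: algebra_simps eval_nat_numeral)
    finally have "k dvd d * M ^ 4" .
    moreover have "coprime (d * M ^ 4) e" using Me(3) by simp
    ultimately show "is_unit k" using k(2) by (metis coprime_common_divisor)
  qed
  have "G dvd M"
  proof -
    have "G dvd M * e" by (simp add: G_def)
    with \<open>coprime G e\<close> show ?thesis by (simp add: coprime_dvd_mult_left_iff)
  qed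
  have "G ^ 2 dvd c"
  proof -
    have "c * e ^ 4 = M ^ 2 * (d * M ^ 2 + 5 * e ^ 2) - N ^ 2" using N by (simp add: algebra_simps eval_nat_numeral)
    moreover have "G ^ 2 dvd M ^ 2" "G ^ 2 dvd N ^ 2" using \<open>G dvd M\<close> by (auto simp: G_def)
    ultimately have "G ^ 2 dvd c * e ^ 4" by (metis dvd_diff dvd_mult2)
    moreover have "coprime (G ^ 2) (e ^ 4)" using \<open>coprime G e\<close> by simp
    ultimately show ?thesis by (simp add: coprime_dvd_mult_left_iff)
  qed
  then have G32: "G ^ 2 dvd 32" unfolding dc[symmetric] by (rule dvd_mult)
  then have "G ^ 2 \<le> 32" by (rule zdvd_imp_le) simp
  then have "G < 6" using power_mono[of 6 G 2] by (cases "G < 6") auto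
  moreover have "G \<noteq> 5" using G32 by auto
  ultimately have G16: "G ^ 2 \<le> 16" using power_mono[of G 4 2] G by auto
  define K where "K = H ^ 4 - 10 * H ^ 2 * f ^ 2 + 153 * f ^ 4"
  have A2K: "A ^ 2 = (G ^ 2) ^ 2 * K" using A2 unfolding Hf(2) Hf(1) K_def by algebra
  then have "(G ^ 2) ^ 2 dvd A ^ 2" by simp
  then have "G ^ 2 dvd A" by (simp only: pow_divides_pow_iff zero_less_numeral)
  then obtain A' where A': "A = G ^ 2 * A'" ..
  have A'K: "A' ^ 2 = K" using A2K G unfolding A' by (simp add: power_mult_distrib)
  have "G ^ 2 * (A' * b) = G ^ 2 * (a * (2 * H * f))"
    using eq unfolding c_def[symmetric] A_def[symmetric] A' mult.assoc[of "2 * N"] Hf(2) unfolding Hf(1) by algebra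
  then have A'b: "A' * b = a * (2 * H * f)" using G by simp
  then have "b dvd a * (2 * H * f)" by (metis dvd_triv_right)
  then have "b dvd 2 * H * f" using cop by (simp add: coprime_commute coprime_dvd_mult_right_iff)
  \<comment> \<open>\<open>t\<close> is the factor cancelled when \<open>A' / (2 * H * f)\<close> is
    reduced to \<open>a / b\<close>.\<close>
  then obtain t where t: "2 * H * f = b * t" ..
  have A't: "A' = a * t" using A'b \<open>b \<noteq> 0\<close> unfolding t by simp
  have "t ^ 2 dvd K" unfolding A'K[symmetric] A't by (simp add: power_mult_distrib)
  have "coprime t f"
  proof (rule coprimeI)
    fix k assume k: "k dvd t" "k dvd f"
    have "k dvd K" using k(1) \<open>t ^ 2 dvd K\<close> by (metis dvd_mult2 dvd_trans power2_eq_square)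
    then have "k dvd K + f * (10 * H ^ 2 * f - 153 * f ^ 3)" using k(2) by (intro dvd_add dvd_mult2)
    also have "K + f * (10 * H ^ 2 * f - 153 * f ^ 3) = H ^ 4" unfolding K_def by algebra
    finally have "k dvd H ^ 4" .
    moreover have "coprime (H ^ 4) f" using Hf(3) by simp
    ultimately show "is_unit k" using k(2) by (metis coprime_common_divisor)
  qed
  have "t dvd 2 * H * f" unfolding t by simp
  then have "t dvd 2 * H" using \<open>coprime t f\<close> by (simp add: coprime_dvd_mult_left_iff)
  then have "t ^ 2 dvd (2 * H) ^ 2" by (rule dvd_power_same)
  \<comment> \<open>The multiple of \<open>(2 * H) ^ 2\<close> is chosen to leave only the term in
    \<open>f ^ 4\<close>, to which \<open>t\<close> is coprime. As
    \<open>612 = 2^2 * 3^2 * 17\<close>, \<open>t\<close> divides 6.\<close>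
  then have "t ^ 2 dvd 4 * K - (2 * H) ^ 2 * (H ^ 2 - 10 * f ^ 2)"
    using \<open>t ^ 2 dvd K\<close> by (intro dvd_diff dvd_mult2[of _ "(2 * H) ^ 2"] dvd_mult)
  also have "4 * K - (2 * H) ^ 2 * (H ^ 2 - 10 * f ^ 2) = 612 * f ^ 4" unfolding K_def by algebra
  finally have "t ^ 2 dvd 612 * f ^ 4" .
  moreover have "coprime (t ^ 2) (f ^ 4)" using \<open>coprime t f\<close> by simp
  ultimately have t612: "\<bar>t\<bar> ^ 2 dvd 612" by (simp add: coprime_dvd_mult_left_iff)
  then have "\<bar>t\<bar> ^ 2 \<le> 612" by (rule zdvd_imp_le) simp
  then have "\<bar>t\<bar> < 25" using power_mono[of 25 "\<bar>t\<bar>" 2] by (cases "\<bar>t\<bar> < 25") auto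
  then have "\<bar>t\<bar> \<in> {k \<in> {0..24}. k ^ 2 dvd 612}" using t612 by auto
  also have "{k \<in> {0..24}. k ^ 2 dvd 612} = {1, 2, 3, 6 :: int}" by code_simp
  finally have t6: "\<bar>t\<bar> \<le> 6" by auto
  \<comment> \<open>The two coefficients have the same sign, and their absolute values are 1 and 32
    or 2 and 16.\<close>
  have "m + 16 * k \<le> \<bar>d * m + 32 div d * k\<bar>" if "m \<ge> 0" "k \<ge> 0" for m k :: int
    using d that by auto
  then have "M ^ 4 + 16 * e ^ 4 \<le> \<bar>A\<bar>" by (simp add: A_def c_def)
  also have "\<bar>A\<bar> = \<bar>a\<bar> * (G ^ 2 * \<bar>t\<bar>)" unfolding A' A't by (simp add: abs_mult)
  also have "\<dots> \<le> \<bar>a\<bar> * (16 * 6)" by (intro mult_left_mono mult_mono G16 t6) auto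
  finally show ?thesis by simp
qed

lemma halving_descent:
  fixes r :: rat
  assumes "wcurve (r ^ 2) y" "r \<noteq> 0" "quotient_of r = (a, b)"
  obtains d M e N where "descent_rep d M e N"
    "pt (r ^ 2) y = descent_pt d M e N + descent_pt d M e N" "M ^ 4 + 16 * e ^ 4 \<le> 96 * \<bar>a\<bar>"
proof -
  define u where "u = y / r"
  have y: "y = r * u" using assms(2) by (simp add: u_def)
  have "r ^ 2 * u ^ 2 = r ^ 2 * (r ^ 4 + 5 * r ^ 2 - 32)"
    using assms(1) unfolding wcurve_def y by (simp add: algebra_simps eval_nat_numeral)
  then have "u ^ 2 = r ^ 4 + 5 * r ^ 2 - 32" using assms(2) by simp
  with assms(2) obtain h X v where v: "v = u \<or> v = - u" and hX: "h \<noteq> 0" "X \<noteq> 0"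
    "X ^ 2 + 32 = 2 * r * h * X" "wcurve X (h * X)"
    and dbl: "pt X (h * X) + pt X (h * X) = pt (r ^ 2) (r * v)"
    by (rule halving_point)
  from hX(4,2) obtain d M e N where rep: "descent_rep d M e N"
    and X: "X = of_int (d * M ^ 2) / of_int (e ^ 2)" "h * X = of_int (d * M * N) / of_int (e ^ 3)"
    by (rule wcurve_imp_descent_rep)
  have r: "r = of_int a / of_int b" and b: "b > 0" and cop: "coprime a b"
    using quotient_of_div[OF assms(3)] quotient_of_denom_pos[OF assms(3)] quotient_of_coprime[OF assms(3)] by auto
  have d: "d \<in> {1, -1, 2, -2}" and e: "e > 0" using rep by (auto simp: descent_rep_def)
  have d0: "d \<noteq> 0" "d * (32 div d) = 32" using d by auto
  have "X ^ 2 + 32 = 2 * r * (h * X)" using hX(3) by simp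
  moreover have "X * of_int e ^ 2 = of_int d * of_int M ^ 2"
    "(h * X) * of_int e ^ 3 = of_int d * of_int M * of_int N" "r * of_int b = of_int a"
    unfolding X(2) unfolding X(1) r using e b by simp_all
  ultimately have "((of_int d ^ 2 * of_int M ^ 4 + 32 * of_int e ^ 4) * of_int b :: rat) =
      of_int a * (2 * (of_int d * of_int M * of_int N) * of_int e)" by algebra
  then have "(of_int ((d ^ 2 * M ^ 4 + 32 * e ^ 4) * b) :: rat) = of_int (a * (2 * (d * M * N) * e))"
    by simp
  then have "(d ^ 2 * M ^ 4 + 32 * e ^ 4) * b = a * (2 * (d * M * N) * e)" by (simp only: of_int_eq_iff)
  then have "d * ((d * M ^ 4 + 32 div d * e ^ 4) * b) = d * (a * (2 * N * M * e))"
    using d0(2) by algebra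
  then have "(d * M ^ 4 + 32 div d * e ^ 4) * b = a * (2 * N * M * e)" using d0 by simp
  then have bound: "M ^ 4 + 16 * e ^ 4 \<le> 96 * \<bar>a\<bar>"
    using b by (intro halving_numerator_bound[OF rep cop]) auto
  have P: "pt X (h * X) = descent_pt d M e N" using X by (simp add: descent_pt_def)
  from v show ?thesis
  proof
    assume "v = u"
    then show ?thesis using that[OF rep _ bound] dbl P y by simp
  next
    assume "v = - u"
    \<comment> \<open>Here the half found belongs to the opposite point; reversing the sign of
      \<open>N\<close> corrects this without affecting the bound.\<close>
    then have "pt (r ^ 2) y = - pt (r ^ 2) (r * v)" using assms(1) y by (simp add: uminus_pt wcurve_minus)
    also have "\<dots> = descent_pt d M e (- N) + descent_pt d M e (- N)"
      using descent_pt_uminus[OF rep] unfolding dbl[symmetric] P by simp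
    finally show ?thesis using that[of d M e "- N"] rep bound by (simp add: descent_rep_uminus)
  qed
qed

text \<open>By Gauss's lemma the product of the numerators divides the constant coefficient
  \<open>C\<close>, so at least one numerator is at most the square root of
  \<open>\<bar>C\<bar>\<close> in absolute value.\<close>

lemma quadratic_root_numerators:
  fixes r1 r2 :: rat and A B C :: int
  assumes "A \<noteq> 0" "C \<noteq> 0" "of_int A * (r1 + r2) = of_int B" "of_int A * (r1 * r2) = of_int C"
    and q: "quotient_of r1 = (a1, b1)" "quotient_of r2 = (a2, b2)"
  shows "a1 ^ 2 \<le> \<bar>C\<bar> \<or> a2 ^ 2 \<le> \<bar>C\<bar>"
proof -
  have r: "r1 = of_int a1 / of_int b1" "r2 = of_int a2 / of_int b2" and b: "b1 > 0" "b2 > 0"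
    and cop: "coprime a1 b1" "coprime a2 b2"
    using q[THEN quotient_of_div] q[THEN quotient_of_denom_pos] q[THEN quotient_of_coprime] by auto
  have "(of_int (A * (a1 * b2 + a2 * b1)) :: rat) = of_int (B * (b1 * b2))"
    using assms(3) b unfolding r by (simp add: field_simps)
  then have sum: "A * (a1 * b2 + a2 * b1) = B * (b1 * b2)" by (simp only: of_int_eq_iff)
  have "(of_int (A * (a1 * a2)) :: rat) = of_int (C * (b1 * b2))"
    using assms(4) b unfolding r by (simp add: field_simps)
  then have prod: "A * (a1 * a2) = C * (b1 * b2)" by (simp only: of_int_eq_iff)
  \<comment> \<open>The linear factors are primitive since the fractions are reduced, so comparing
    contents gives that \<open>b1 * b2\<close> divides \<open>A\<close>.\<close>
  have 1: "smult A ([:- a1, b1:] * [:- a2, b2:]) = smult (b1 * b2) [:C, - B, A:]"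
    using sum prod by (simp add: algebra_simps)
  have "content [:- a, b:] = 1" if "coprime a b" "b > 0" for a b :: int
    using that by (simp add: content_def cCons_def)
  then have "content ([:- a1, b1:] * [:- a2, b2:]) = 1" using cop b by (simp only: content_mult mult_1)
  with arg_cong[OF 1, of content] have "\<bar>A\<bar> = \<bar>b1 * b2\<bar> * content [:C, - B, A:]"
    by (simp only: content_smult normalize_int_def)
  then have "b1 * b2 dvd A" by (metis abs_dvd_iff dvd_abs_iff dvd_triv_left)
  then obtain k where k: "A = b1 * b2 * k" ..
  have "k * (a1 * a2) = C" using prod b unfolding k by simp
  then have "a1 * a2 dvd C" by (metis dvd_triv_right)
  then have le: "\<bar>a1\<bar> * \<bar>a2\<bar> \<le> \<bar>C\<bar>" using assms(2) by (metis abs_mult dvd_imp_le_int)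
  show ?thesis
  proof (rule ccontr)
    assume "\<not> ?thesis"
    then have "\<bar>C\<bar> * \<bar>C\<bar> < a1 ^ 2 * a2 ^ 2" by (intro mult_strict_mono) auto
    also have "\<dots> = (\<bar>a1\<bar> * \<bar>a2\<bar>) ^ 2" by (simp add: power_mult_distrib)
    also have "\<dots> \<le> \<bar>C\<bar> ^ 2" using le by (intro power_mono) auto
    finally show False by (simp add: power2_eq_square)
  qed
qed

section \<open>The descent step\<close>

lemma pt_add_chord:
  assumes "wcurve x y" "wcurve x0 y0" "x \<noteq> x0"
  obtains y3 where "pt x y + pt x0 y0 = pt (((y - y0) / (x - x0)) ^ 2 - 5 - x - x0) y3"
    "wcurve (((y - y0) / (x - x0)) ^ 2 - 5 - x - x0) y3"
  using assms(1,2)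
proof (cases rule: pt_add_cases)
  case 1
  then show ?thesis using assms(3) by simp
next
  case (2 l n x3)
  have "y - y0 = l * (x - x0)" using 2(2,3) by (simp add: algebra_simps)
  then have l: "(y - y0) / (x - x0) = l" using assms(3) by simp
  have "((y - y0) / (x - x0)) ^ 2 - 5 - x - x0 = x3"
    using 2(1) unfolding l line_section_def by (simp add: algebra_simps)
  then show ?thesis using that[of "- (l * x3 + n)"] 2(4) line_section_wcurve(3)[OF 2(1)]
    by (simp only: wcurve_minus)
qed

inductive_set mw :: "wpoint set" where
  mw_zero: "0 \<in> mw"
| mw_torsion: "pt 0 0 \<in> mw"
| mw_gen: "pt 8 24 \<in> mw"
| mw_add: "P \<in> mw \<Longrightarrow> Q \<in> mw \<Longrightarrow> P + Q \<in> mw"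
| mw_uminus: "P \<in> mw \<Longrightarrow> - P \<in> mw"

lemma wcurve_special: "wcurve 0 0" "wcurve 8 24" "wcurve 8 (- 24)" "wcurve (- 4) 12" "wcurve (- 4) (- 12)"
  by (simp_all add: wcurve_def eval_nat_numeral)

lemma mw_line:
  assumes "line_section l n x1 x2 x3" "pt x1 (l * x1 + n) \<in> mw" "pt x2 (l * x2 + n) \<in> mw"
  shows "pt x3 (- (l * x3 + n)) \<in> mw"
  using mw_add[OF assms(2,3)] unfolding line_sum[OF assms(1)] .

text \<open>These are, in order, G + T, 2G, 2G + T, 3G, 3G + T, 4G and 4G + T; together with G they
  are, up to sign, the points found by the finite search.\<close>

lemma mw_small:
  "pt (- 4) 12 \<in> mw" "pt 4 (- 4) \<in> mw" "pt (- 8) (- 8) \<in> mw" "pt 32 (- 192) \<in> mw"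
  "pt (- 1) (- 6) \<in> mw" "pt 36 228 \<in> mw" "pt (- 8 / 9) (152 / 27) \<in> mw"
proof -
  show "pt (- 4) 12 \<in> mw" using mw_line[of 3 0 0 8 "- 4"] mw_torsion mw_gen by (simp add: line_section_def)
  show 2: "pt 4 (- 4) \<in> mw" using mw_line[of 5 "- 16" 8 8 4] mw_gen by (simp add: line_section_def)
  show "pt (- 8) (- 8) \<in> mw" using mw_line[of "- 1" 0 0 4 "- 8"] mw_torsion 2 by (simp add: line_section_def)
  show 3: "pt 32 (- 192) \<in> mw" using mw_line[of 7 "- 32" 8 4 32] mw_gen 2 by (simp add: line_section_def)
  show "pt (- 1) (- 6) \<in> mw" using mw_line[of "- 6" 0 0 32 "- 1"] mw_torsion 3 by (simp add: line_section_def)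
  show 4: "pt 36 228 \<in> mw" using mw_line[of "- 7" 24 4 4 36] 2 by (simp add: line_section_def)
  show "pt (- 8 / 9) (152 / 27) \<in> mw" using mw_line[of "19 / 3" 0 0 36 "- 8 / 9"] mw_torsion 4
    by (simp add: line_section_def power2_eq_square)
qed

lemma quotient_of_numerator_dvd:
  assumes "r = of_int m / of_int k" "k \<noteq> 0" "quotient_of r = (a, b)"
  shows "a dvd m"
proof -
  have r: "r = of_int a / of_int b" and b: "b > 0" and cop: "coprime a b"
    using quotient_of_div[OF assms(3)] quotient_of_denom_pos[OF assms(3)] quotient_of_coprime[OF assms(3)] by auto
  have "(of_int (a * k) :: rat) = of_int (m * b)" using r assms(1,2) b by (simp add: field_simps)
  then have "a * k = m * b" by (simp only: of_int_eq_iff)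
  then have "a dvd m * b" by (metis dvd_triv_left)
  then show ?thesis using cop by (simp add: coprime_dvd_mult_left_iff)
qed

text \<open>The constant is $96^2 \cdot 8$; the factor $8$ comes from the bound on the numerator of $r$ in the
  rule \<open>descendsI\<close>.\<close>

definition descends :: "wpoint \<Rightarrow> int \<Rightarrow> bool" where
  "descends Q h \<longleftrightarrow> (\<exists>d M e N S. descent_rep d M e N \<and> S \<in> mw \<and>
     Q = descent_pt d M e N + descent_pt d M e N + S \<and> (M ^ 4 + 16 * e ^ 4) ^ 2 \<le> 73728 * h)"

lemma descendsI:
  assumes "Q + S = pt (r ^ 2) y" "S \<in> mw" "wcurve (r ^ 2) y" "r \<noteq> 0" "quotient_of r = (a, b)" "a ^ 2 \<le> 8 * h"
  shows "descends Q h"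
proof -
  from assms(3,4,5) obtain d M e N where rep: "descent_rep d M e N"
    and P: "pt (r ^ 2) y = descent_pt d M e N + descent_pt d M e N" and le: "M ^ 4 + 16 * e ^ 4 \<le> 96 * \<bar>a\<bar>"
    by (rule halving_descent)
  have "(M ^ 4 + 16 * e ^ 4) ^ 2 \<le> (96 * \<bar>a\<bar>) ^ 2" using le by (intro power_mono) auto
  also have "\<dots> \<le> 73728 * h" using assms(6) by (simp add: power_mult_distrib)
  finally have "(M ^ 4 + 16 * e ^ 4) ^ 2 \<le> 73728 * h" .
  moreover have "Q = descent_pt d M e N + descent_pt d M e N + - S"
    unfolding P[symmetric] assms(1)[symmetric] by simp
  ultimately show ?thesis unfolding descends_def using rep mw_uminus[OF assms(2)] by blast
qed

text \<open>The three abscissae on the chord multiply to the square of its intercept, and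
  \<open>8 * x = (4 * m / k) ^ 2\<close>, so the third abscissa is a square. Its root, intercept
  times \<open>k / (4 * m)\<close>, is \<open>r\<close> up to sign after cancellation.\<close>

lemma chord_abscissa_two:
  fixes m k n s x y :: rat
  assumes "k \<noteq> 0" "m ^ 2 - 4 * k ^ 2 \<noteq> 0" "s ^ 2 = 1" "n ^ 2 = 2 * m ^ 4 + 5 * m ^ 2 * k ^ 2 - 16 * k ^ 4"
    and x: "x * k ^ 2 = 2 * m ^ 2" and y: "y * k ^ 3 = 2 * m * n" and r: "r = 2 * (3 * m * k - s * n) / (m ^ 2 - 4 * k ^ 2)"
  shows "x \<noteq> 8" "((y - 24 * s) / (x - 8)) ^ 2 - 5 - x - 8 = r ^ 2"
proof -
  define D where "D = m ^ 2 - 4 * k ^ 2"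
  have xD: "(x - 8) * k ^ 2 = 2 * D" unfolding D_def using x by algebra
  show "x \<noteq> 8" using xD assms(2) by (auto simp: D_def)
  define l where "l = (y - 24 * s) / (x - 8)"
  have "l * (x - 8) = y - 24 * s" using \<open>x \<noteq> 8\<close> by (simp add: l_def)
  then have "2 * (l * k * D) = 2 * (m * n - 12 * s * k ^ 3)" using xD y by algebra
  then have l: "l * k * D = m * n - 12 * s * k ^ 3" by simp
  have rD: "r * D = 2 * (3 * m * k - s * n)" using assms(2) by (simp add: r D_def)
  have key: "(m * n - 12 * s * k ^ 3) ^ 2 = (13 * k ^ 2 + 2 * m ^ 2) * D ^ 2 + k ^ 2 * (2 * (3 * m * k - s * n)) ^ 2"
    unfolding D_def using assms(3,4) by algebra
  have "(l ^ 2 - 5 - x - 8) * (k ^ 2 * D ^ 2) = (l * k * D) ^ 2 - (13 * k ^ 2 + x * k ^ 2) * D ^ 2" by algebra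
  also have "\<dots> = r ^ 2 * (k ^ 2 * D ^ 2)" unfolding l key x rD[symmetric] by algebra
  finally show "((y - 24 * s) / (x - 8)) ^ 2 - 5 - x - 8 = r ^ 2"
    unfolding l_def using assms(1,2) by (simp add: D_def)
qed

text \<open>The same computation with \<open>- 4 * x = (2 * m / k) ^ 2\<close>.\<close>

lemma chord_abscissa_minus_one:
  fixes m k n s x y :: rat
  assumes "k \<noteq> 0" "4 * k ^ 2 - m ^ 2 \<noteq> 0" "s ^ 2 = 1" "n ^ 2 = - (m ^ 4) + 5 * m ^ 2 * k ^ 2 + 32 * k ^ 4"
    and x: "x * k ^ 2 = - (m ^ 2)" and y: "y * k ^ 3 = - (m * n)" and r: "r = 2 * (3 * m * k + s * n) / (4 * k ^ 2 - m ^ 2)"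
  shows "x \<noteq> - 4" "((y - 12 * s) / (x - - 4)) ^ 2 - 5 - x - - 4 = r ^ 2"
proof -
  define D where "D = 4 * k ^ 2 - m ^ 2"
  have xD: "(x + 4) * k ^ 2 = D" unfolding D_def using x by algebra
  show "x \<noteq> - 4" using xD assms(2) by (auto simp: D_def)
  define l where "l = (y - 12 * s) / (x - - 4)"
  have "x + 4 \<noteq> 0" using \<open>x \<noteq> - 4\<close> by (simp add: add_eq_0_iff2)
  then have "l * (x + 4) = y - 12 * s" by (simp add: l_def)
  then have l: "l * k * D = - (m * n + 12 * s * k ^ 3)" using xD y by algebra
  have rD: "r * D = 2 * (3 * m * k + s * n)" using assms(2) by (simp add: r D_def)
  have key: "(m * n + 12 * s * k ^ 3) ^ 2 = (k ^ 2 - m ^ 2) * D ^ 2 + k ^ 2 * (2 * (3 * m * k + s * n)) ^ 2"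
    unfolding D_def using assms(3,4) by algebra
  have "(l ^ 2 - 5 - x - - 4) * (k ^ 2 * D ^ 2) = (l * k * D) ^ 2 - (k ^ 2 + x * k ^ 2) * D ^ 2" by algebra
  also have "\<dots> = r ^ 2 * (k ^ 2 * D ^ 2)" unfolding l x power2_minus key rD[symmetric] by algebra
  finally show "((y - 12 * s) / (x - - 4)) ^ 2 - 5 - x - - 4 = r ^ 2"
    unfolding l_def using assms(1,2) by (simp add: D_def)
qed

lemma descends_two:
  assumes rep: "descent_rep 2 M e N" and ne: "M ^ 2 \<noteq> 4 * e ^ 2"
  shows "descends (descent_pt 2 M e N) (M ^ 2 + 4 * e ^ 2)"
proof -
  define m k n :: rat where "m = of_int M" and "k = of_int e" and "n = of_int N"
  have e: "e > 0" "M > 0" and N: "N ^ 2 = 2 * M ^ 4 + 5 * M ^ 2 * e ^ 2 - 16 * e ^ 4"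
    using rep by (auto simp: descent_rep_def)
  have k: "k \<noteq> 0" using e by (simp add: k_def)
  define D where "D = M ^ 2 - 4 * e ^ 2"
  have D0: "D \<noteq> 0" using ne by (simp add: D_def)
  have Dr: "of_int D = m ^ 2 - 4 * k ^ 2" by (simp add: D_def m_def k_def)
  then have D: "m ^ 2 - 4 * k ^ 2 \<noteq> 0" using D0 by (metis of_int_eq_0_iff)
  have n2: "n ^ 2 = 2 * m ^ 4 + 5 * m ^ 2 * k ^ 2 - 16 * k ^ 4"
    using arg_cong[OF N, of "of_int :: int \<Rightarrow> rat"] by (simp add: m_def n_def k_def)
  define x y where "x = 2 * m ^ 2 / k ^ 2" and "y = 2 * m * n / k ^ 3"
  have Q: "descent_pt 2 M e N = pt x y" "wcurve x y"
    using descent_pt_wcurve[OF rep] by (simp_all add: descent_pt_def x_def y_def m_def n_def k_def)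
  have xy: "x * k ^ 2 = 2 * m ^ 2" "y * k ^ 3 = 2 * m * n" using k by (simp_all add: x_def y_def)
  define r where "r s = 2 * (3 * m * k - s * n) / (m ^ 2 - 4 * k ^ 2)" for s
  have "r 1 + r (- 1) = 2 * (6 * m * k) / (m ^ 2 - 4 * k ^ 2)"
    unfolding r_def add_divide_distrib[symmetric] by (simp add: algebra_simps)
  then have sum: "of_int D * (r 1 + r (- 1)) = of_int (12 * M * e)"
    using D unfolding Dr by (simp add: m_def k_def)
  have "r 1 * r (- 1) * (m ^ 2 - 4 * k ^ 2) ^ 2 = 4 * (9 * m ^ 2 * k ^ 2 - n ^ 2)"
    using D by (simp add: r_def power2_eq_square) (simp add: algebra_simps)
  \<comment> \<open>One factor of the squared denominator cancels here. This makes the constant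
    coefficient of the quadratic with roots \<open>r 1\<close> and \<open>r (- 1)\<close> only
    quadratic in \<open>M\<close> and \<open>e\<close>, and so keeps one numerator small.\<close>
  also have "\<dots> = - 8 * (m ^ 2 + 2 * k ^ 2) * (m ^ 2 - 4 * k ^ 2)" unfolding n2 by algebra
  finally have prod: "of_int D * (r 1 * r (- 1)) = of_int (- 8 * (M ^ 2 + 2 * e ^ 2))"
    using D unfolding Dr power2_eq_square[of "m ^ 2 - 4 * k ^ 2"] by (simp add: m_def k_def ac_simps)
  have "M ^ 2 + 2 * e ^ 2 > 0" using e by (intro add_pos_pos) auto
  then have C: "- 8 * (M ^ 2 + 2 * e ^ 2) \<noteq> 0" by (intro less_imp_neq mult_neg_pos) simp_all
  obtain a1 b1 a2 b2 where q: "quotient_of (r 1) = (a1, b1)" "quotient_of (r (- 1)) = (a2, b2)"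
    by (metis surj_pair)
  have "a1 ^ 2 \<le> \<bar>- 8 * (M ^ 2 + 2 * e ^ 2)\<bar> \<or> a2 ^ 2 \<le> \<bar>- 8 * (M ^ 2 + 2 * e ^ 2)\<bar>"
    by (rule quadratic_root_numerators[OF D0 C sum prod q])
  moreover have "\<bar>- 8 * (p + 2 * q)\<bar> \<le> 8 * (p + 4 * q)" if "p \<ge> 0" "q \<ge> 0" for p q :: int
    using that by auto
  then have "\<bar>- 8 * (M ^ 2 + 2 * e ^ 2)\<bar> \<le> 8 * (M ^ 2 + 4 * e ^ 2)" by (simp only: zero_le_power2)
  ultimately have "a1 ^ 2 \<le> 8 * (M ^ 2 + 4 * e ^ 2) \<or> a2 ^ 2 \<le> 8 * (M ^ 2 + 4 * e ^ 2)"
    by (blast intro: order_trans)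
  then obtain s a b where s: "s = 1 \<or> s = - 1" "quotient_of (r s) = (a, b)" "a ^ 2 \<le> 8 * (M ^ 2 + 4 * e ^ 2)"
    using q by blast
  have r0: "r s \<noteq> 0"
  proof
    assume "r s = 0"
    then have "r 1 * r (- 1) = 0" using s(1) by auto
    then show False using prod C by (metis mult_zero_right of_int_eq_0_iff)
  qed
  have s2: "s ^ 2 = 1" using s(1) by auto
  note chord = chord_abscissa_two[OF k D s2 n2 xy r_def]
  have w: "wcurve 8 (24 * s)" using s(1) wcurve_special by auto
  have S: "pt 8 (24 * s) \<in> mw"
    using s(1) mw_gen mw_uminus[OF mw_gen] wcurve_special by (auto simp: uminus_pt)
  from Q(2) w chord(1) obtain y3 where "pt x y + pt 8 (24 * s) = pt (r s ^ 2) y3" "wcurve (r s ^ 2) y3"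
    unfolding chord(2)[symmetric] by (rule pt_add_chord)
  then show ?thesis using descendsI[OF _ S _ r0 s(2,3)] Q(1) by simp
qed

lemma descends_minus_one:
  assumes rep: "descent_rep (- 1) M e N" and ne: "M ^ 2 \<noteq> 4 * e ^ 2"
  shows "descends (descent_pt (- 1) M e N) (M ^ 2 + 4 * e ^ 2)"
proof -
  define m k n :: rat where "m = of_int M" and "k = of_int e" and "n = of_int N"
  have e: "e > 0" "M > 0" and N: "N ^ 2 = - (M ^ 4) + 5 * M ^ 2 * e ^ 2 + 32 * e ^ 4"
    using rep by (auto simp: descent_rep_def)
  have k: "k \<noteq> 0" using e by (simp add: k_def)
  define D where "D = 4 * e ^ 2 - M ^ 2"
  have D0: "D \<noteq> 0" using ne by (simp add: D_def)
  have Dr: "of_int D = 4 * k ^ 2 - m ^ 2" by (simp add: D_def m_def k_def)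
  then have D: "4 * k ^ 2 - m ^ 2 \<noteq> 0" using D0 by (metis of_int_eq_0_iff)
  have n2: "n ^ 2 = - (m ^ 4) + 5 * m ^ 2 * k ^ 2 + 32 * k ^ 4"
    using arg_cong[OF N, of "of_int :: int \<Rightarrow> rat"] by (simp add: m_def n_def k_def)
  define x y where "x = - (m ^ 2) / k ^ 2" and "y = - (m * n) / k ^ 3"
  have Q: "descent_pt (- 1) M e N = pt x y" "wcurve x y"
    using descent_pt_wcurve[OF rep] by (simp_all add: descent_pt_def x_def y_def m_def n_def k_def)
  have xy: "x * k ^ 2 = - (m ^ 2)" "y * k ^ 3 = - (m * n)" using k by (simp_all add: x_def y_def)
  define r where "r s = 2 * (3 * m * k + s * n) / (4 * k ^ 2 - m ^ 2)" for s
  have "r 1 + r (- 1) = 2 * (6 * m * k) / (4 * k ^ 2 - m ^ 2)"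
    unfolding r_def add_divide_distrib[symmetric] by (simp add: algebra_simps)
  then have sum: "of_int D * (r 1 + r (- 1)) = of_int (12 * M * e)"
    using D unfolding Dr by (simp add: m_def k_def)
  have "r 1 * r (- 1) * (4 * k ^ 2 - m ^ 2) ^ 2 = 4 * (9 * m ^ 2 * k ^ 2 - n ^ 2)"
    using D by (simp add: r_def power2_eq_square) (simp add: algebra_simps)
  also have "\<dots> = - 4 * (m ^ 2 + 8 * k ^ 2) * (4 * k ^ 2 - m ^ 2)" unfolding n2 by algebra
  finally have prod: "of_int D * (r 1 * r (- 1)) = of_int (- 4 * (M ^ 2 + 8 * e ^ 2))"
    using D unfolding Dr power2_eq_square[of "4 * k ^ 2 - m ^ 2"] by (simp add: m_def k_def ac_simps)
  have "M ^ 2 + 8 * e ^ 2 > 0" using e by (intro add_pos_pos) auto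
  then have C: "- 4 * (M ^ 2 + 8 * e ^ 2) \<noteq> 0" by (intro less_imp_neq mult_neg_pos) simp_all
  obtain a1 b1 a2 b2 where q: "quotient_of (r 1) = (a1, b1)" "quotient_of (r (- 1)) = (a2, b2)"
    by (metis surj_pair)
  have "a1 ^ 2 \<le> \<bar>- 4 * (M ^ 2 + 8 * e ^ 2)\<bar> \<or> a2 ^ 2 \<le> \<bar>- 4 * (M ^ 2 + 8 * e ^ 2)\<bar>"
    by (rule quadratic_root_numerators[OF D0 C sum prod q])
  moreover have "\<bar>- 4 * (p + 8 * q)\<bar> \<le> 8 * (p + 4 * q)" if "p \<ge> 0" "q \<ge> 0" for p q :: int
    using that by auto
  then have "\<bar>- 4 * (M ^ 2 + 8 * e ^ 2)\<bar> \<le> 8 * (M ^ 2 + 4 * e ^ 2)" by (simp only: zero_le_power2)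
  ultimately have "a1 ^ 2 \<le> 8 * (M ^ 2 + 4 * e ^ 2) \<or> a2 ^ 2 \<le> 8 * (M ^ 2 + 4 * e ^ 2)"
    by (blast intro: order_trans)
  then obtain s a b where s: "s = 1 \<or> s = - 1" "quotient_of (r s) = (a, b)" "a ^ 2 \<le> 8 * (M ^ 2 + 4 * e ^ 2)"
    using q by blast
  have r0: "r s \<noteq> 0"
  proof
    assume "r s = 0"
    then have "r 1 * r (- 1) = 0" using s(1) by auto
    then show False using prod C by (metis mult_zero_right of_int_eq_0_iff)
  qed
  have s2: "s ^ 2 = 1" using s(1) by auto
  note chord = chord_abscissa_minus_one[OF k D s2 n2 xy r_def]
  have w: "wcurve (- 4) (12 * s)" using s(1) wcurve_special by auto
  have S: "pt (- 4) (12 * s) \<in> mw"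
    using s(1) mw_small(1) mw_uminus[OF mw_small(1)] wcurve_special by (auto simp: uminus_pt)
  from Q(2) w chord(1) obtain y3 where "pt x y + pt (- 4) (12 * s) = pt (r s ^ 2) y3" "wcurve (r s ^ 2) y3"
    unfolding chord(2)[symmetric] by (rule pt_add_chord)
  then show ?thesis using descendsI[OF _ S _ r0 s(2,3)] Q(1) by simp
qed

lemma descends_one:
  assumes rep: "descent_rep 1 M e N"
  shows "descends (descent_pt 1 M e N) (M ^ 2 + 4 * e ^ 2)"
proof -
  define r :: rat where "r = of_int M / of_int e"
  have e: "e > 0" "M > 0" using rep by (auto simp: descent_rep_def)
  obtain a b where q: "quotient_of r = (a, b)" by (cases "quotient_of r")
  have "a dvd M" using quotient_of_numerator_dvd[OF r_def _ q] e by simp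
  then have "a ^ 2 dvd M ^ 2" by simp
  then have "a ^ 2 \<le> M ^ 2" using e by (intro zdvd_imp_le) auto
  also have "p \<le> 8 * (p + 4 * q)" if "p \<ge> 0" "q \<ge> 0" for p q :: int using that by simp
  then have "M ^ 2 \<le> 8 * (M ^ 2 + 4 * e ^ 2)" by simp
  finally have a: "a ^ 2 \<le> 8 * (M ^ 2 + 4 * e ^ 2)" .
  show ?thesis
    using descendsI[OF _ mw_zero _ _ q a, of "descent_pt 1 M e N"] descent_pt_wcurve[OF rep] e
    by (simp add: descent_pt_def r_def power_divide)
qed

text \<open>Adding T sends the abscissa \<open>x\<close> to \<open>- 32 / x\<close>, here
  \<open>(4 * e / M) ^ 2\<close>.\<close>

lemma descends_minus_two:
  assumes rep: "descent_rep (- 2) M e N"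
  shows "descends (descent_pt (- 2) M e N) (M ^ 2 + 4 * e ^ 2)"
proof -
  define m k n :: rat where "m = of_int M" and "k = of_int e" and "n = of_int N"
  have e: "e > 0" "M > 0" and N: "N ^ 2 = - 2 * M ^ 4 + 5 * M ^ 2 * e ^ 2 + 16 * e ^ 4"
    using rep by (auto simp: descent_rep_def)
  have k: "k \<noteq> 0" "m \<noteq> 0" using e by (simp_all add: k_def m_def)
  have n2: "n ^ 2 = - 2 * m ^ 4 + 5 * m ^ 2 * k ^ 2 + 16 * k ^ 4"
    using arg_cong[OF N, of "of_int :: int \<Rightarrow> rat"] by (simp add: m_def n_def k_def)
  define x y where "x = - 2 * m ^ 2 / k ^ 2" and "y = - 2 * m * n / k ^ 3"
  have Q: "descent_pt (- 2) M e N = pt x y" "wcurve x y"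
    using descent_pt_wcurve[OF rep] by (simp_all add: descent_pt_def x_def y_def m_def n_def k_def)
  define r where "r = of_int (4 * e) / (of_int M :: rat)"
  have x0: "x \<noteq> 0" using k by (simp add: x_def)
  have "(y - 0) / (x - 0) = n / (m * k)" using k by (simp add: x_def y_def power2_eq_square power3_eq_cube)
  then have "((y - 0) / (x - 0)) ^ 2 - 5 - x - 0 = n ^ 2 / (m ^ 2 * k ^ 2) - 5 - x"
    by (simp add: power_divide power_mult_distrib)
  also have "\<dots> = r ^ 2" unfolding n2 x_def r_def using k
    by (simp add: field_simps eval_nat_numeral flip: m_def k_def)
  finally have r: "((y - 0) / (x - 0)) ^ 2 - 5 - x - 0 = r ^ 2" .
  obtain a b where q: "quotient_of r = (a, b)" by (cases "quotient_of r")
  have "a dvd 4 * e" using quotient_of_numerator_dvd[OF r_def _ q] e by simp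
  then have "a ^ 2 dvd (4 * e) ^ 2" by (rule dvd_power_same)
  then have "a ^ 2 \<le> (4 * e) ^ 2" using e by (intro zdvd_imp_le) auto
  also have "16 * q \<le> 8 * (p + 4 * q)" if "p \<ge> 0" "q \<ge> 0" for p q :: int using that by simp
  then have "(4 * e) ^ 2 \<le> 8 * (M ^ 2 + 4 * e ^ 2)" by (simp add: power_mult_distrib)
  finally have a: "a ^ 2 \<le> 8 * (M ^ 2 + 4 * e ^ 2)" .
  from Q(2) wcurve_special(1) x0 obtain y3 where "pt x y + pt 0 0 = pt (r ^ 2) y3" "wcurve (r ^ 2) y3"
    unfolding r[symmetric] by (rule pt_add_chord)
  then show ?thesis using descendsI[OF _ mw_torsion _ _ q a] Q(1) e by (simp add: r_def)
qed

section \<open>Generators and relations\<close>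

text \<open>The ranges contain all positive \<open>M\<close> and \<open>e\<close> below the bound,
  and \<open>v < 10000\<close> makes the search for \<open>n\<close> up to 99 exhaustive.
  Coprimality enters only through the primes 2 and 3, the only ones that can divide an
  \<open>e\<close> of at most 4.\<close>

lemma small_descent_solutions:
  "\<forall>d\<in>set [1, -1, 2, -2]. \<forall>M\<in>set [1..7]. \<forall>e\<in>set [1..4].
     M ^ 2 + 4 * e ^ 2 \<le> 66 \<longrightarrow> \<not> (2 dvd d * M \<and> 2 dvd e) \<longrightarrow> \<not> (3 dvd d * M \<and> 3 dvd e) \<longrightarrow>
     (let v = d * M ^ 4 + 5 * M ^ 2 * e ^ 2 - (32 div d) * e ^ 4 in
       v < 10000 \<and> (\<forall>n\<in>set [0..99]. n * n = v \<longrightarrow>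
         (d, M, e, n) \<in> set [(1, 2, 1, 2), (1, 6, 1, 38), (-1, 1, 1, 6), (-1, 2, 1, 6), (2, 2, 1, 6),
            (2, 4, 1, 24), (-2, 2, 1, 2), (-2, 2, 3, 38 :: int)]))"
  by code_simp

lemma descent_pt_abs:
  assumes "descent_rep d M e N" "descent_pt d M e \<bar>N\<bar> \<in> mw \<or> descent_pt d M e (- \<bar>N\<bar>) \<in> mw"
  shows "descent_pt d M e N \<in> mw"
proof -
  have "descent_pt d M e N \<in> mw \<or> descent_pt d M e (- N) \<in> mw" using assms(2) by (cases "N \<ge> 0") auto
  then show ?thesis
    using mw_uminus[of "descent_pt d M e (- N)"] descent_pt_uminus[of d M e "- N"] assms(1)
    by (auto simp: descent_rep_uminus)
qed

lemma descent_pt_small_in_mw: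
  assumes rep: "descent_rep d M e N" and small: "M ^ 2 + 4 * e ^ 2 \<le> 66"
  shows "descent_pt d M e N \<in> mw"
proof -
  have d: "d \<in> set [1, -1, 2, -2]" and Me: "M > 0" "e > 0" "coprime (d * M) e"
    and N: "N ^ 2 = d * M ^ 4 + 5 * M ^ 2 * e ^ 2 - (32 div d) * e ^ 4"
    using rep by (auto simp: descent_rep_def)
  have "p < 8 ^ 2 \<and> q < 5 ^ 2" if "p + 4 * q \<le> 66" "p > 0" "q > 0" for p q :: int
    using that by simp
  from this[OF small] have "M ^ 2 < 8 ^ 2" "e ^ 2 < 5 ^ 2" using Me by simp_all
  then have "M < 8" "e < 5" using power_less_imp_less_base[of M 2 8] power_less_imp_less_base[of e 2 5] by simp_all
  then have M: "M \<in> set [1..7]" and e: "e \<in> set [1..4]" using Me by auto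
  have "\<not> (2 dvd d * M \<and> 2 dvd e)" "\<not> (3 dvd d * M \<and> 3 dvd e)"
    using coprime_common_divisor[OF Me(3), of 2] coprime_common_divisor[OF Me(3), of 3] by auto
  from small_descent_solutions[rule_format, OF d M e small this]
  have v: "N ^ 2 < 10000" and sol: "\<And>n. n \<in> set [0..99] \<Longrightarrow> n * n = N ^ 2 \<Longrightarrow>
      (d, M, e, n) \<in> set [(1, 2, 1, 2), (1, 6, 1, 38), (-1, 1, 1, 6), (-1, 2, 1, 6), (2, 2, 1, 6),
            (2, 4, 1, 24), (-2, 2, 1, 2), (-2, 2, 3, 38)]"
    unfolding Let_def N[symmetric] by blast+
  have "\<bar>N\<bar> < 100" using v power_mono[of 100 "\<bar>N\<bar>" 2] by (cases "\<bar>N\<bar> < 100") auto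
  define n where "n = \<bar>N\<bar>"
  with \<open>\<bar>N\<bar> < 100\<close> have "n \<in> set [0..99]" by simp
  from sol[OF this] have "(d, M, e, n) \<in> set [(1, 2, 1, 2), (1, 6, 1, 38), (-1, 1, 1, 6), (-1, 2, 1, 6),
      (2, 2, 1, 6), (2, 4, 1, 24), (-2, 2, 1, 2), (-2, 2, 3, 38)]"
    by (simp add: n_def power2_eq_square)
  then have "descent_pt d M e n \<in> mw \<or> descent_pt d M e (- n) \<in> mw"
    using mw_small mw_gen by (auto simp: descent_pt_def)
  with rep show ?thesis unfolding n_def by (rule descent_pt_abs)
qed

lemma descends_all:
  assumes rep: "descent_rep d M e N" and large: "M ^ 2 + 4 * e ^ 2 > 66"
  shows "descends (descent_pt d M e N) (M ^ 2 + 4 * e ^ 2)"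
proof -
  have d: "d \<in> {1, -1, 2, -2}" and Me: "M > 0" "e > 0" "coprime (d * M) e"
    using rep by (auto simp: descent_rep_def)
  \<comment> \<open>Equality would make the chord through the auxiliary point degenerate. With
    coprimality it gives \<open>e = 1\<close> and the value 8, far below the bound.\<close>
  have ne: "M ^ 2 \<noteq> 4 * e ^ 2"
  proof
    assume *: "M ^ 2 = 4 * e ^ 2"
    then have "e ^ 2 dvd M ^ 2" by simp
    then have "e dvd M" by simp
    then have "e = 1" using Me by (metis coprime_common_divisor dvd_mult dvd_refl zdvd1_eq abs_of_pos)
    then show False using * large by simp
  qed
  show ?thesis
    using d rep ne descends_one descends_minus_one descends_two descends_minus_two by auto
qed

lemma descent_pt_in_mw: "descent_rep d M e N \<Longrightarrow> descent_pt d M e N \<in> mw"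
proof (induction "nat (M ^ 2 + 4 * e ^ 2)" arbitrary: d M e N rule: less_induct)
  case less
  define h where "h = M ^ 2 + 4 * e ^ 2"
  show ?case
  proof (cases "h \<le> 66")
    case True
    then show ?thesis using descent_pt_small_in_mw less.prems by (simp add: h_def)
  next
    case False
    then obtain d' M' e' N' S where rep: "descent_rep d' M' e' N'" and S: "S \<in> mw"
      and eq: "descent_pt d M e N = descent_pt d' M' e' N' + descent_pt d' M' e' N' + S"
      and bound: "(M' ^ 4 + 16 * e' ^ 4) ^ 2 \<le> 73728 * h"
      using descends_all[OF less.prems] unfolding descends_def h_def by auto
    define h' where "h' = M' ^ 2 + 4 * e' ^ 2"
    have "h' < h"
    proof (rule ccontr)
      assume "\<not> h' < h"
      then have hh: "h ^ 4 \<le> h' ^ 4" using False by (intro power_mono) auto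
      \<comment> \<open>The inequality between \<open>(p + q) ^ 2\<close> and
        \<open>2 * (p ^ 2 + q ^ 2)\<close> for \<open>p = M' ^ 2\<close> and
        \<open>q = 4 * e' ^ 2\<close>.\<close>
      have h2: "h' ^ 2 \<le> 2 * (M' ^ 4 + 16 * e' ^ 4)"
        using zero_le_power2[of "M' ^ 2 - 4 * e' ^ 2"] unfolding h'_def
        by (simp add: power2_eq_square power4_eq_xxxx algebra_simps)
      have "h' ^ 4 = (h' ^ 2) ^ 2" by simp
      also have "\<dots> \<le> (2 * (M' ^ 4 + 16 * e' ^ 4)) ^ 2" using h2 by (intro power_mono) auto
      also have "\<dots> = 4 * (M' ^ 4 + 16 * e' ^ 4) ^ 2" by (subst power_mult_distrib) simp
      finally have "h ^ 3 * h \<le> 294912 * h" using hh bound by (simp add: eval_nat_numeral)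
      then have "h ^ 3 \<le> 294912" using False by simp
      \<comment> \<open>This is where 66 comes from: \<open>294912 = 4 * 73728\<close> lies between
        \<open>66 ^ 3\<close> and \<open>67 ^ 3\<close>.\<close>
      moreover have "67 ^ 3 \<le> h ^ 3" using False by (intro power_mono) auto
      ultimately show False by simp
    qed
    then have "nat h' < nat h" using False by simp
    then have "descent_pt d' M' e' N' \<in> mw"
      using less.hyps[OF _ rep] unfolding h_def h'_def by blast
    then show ?thesis unfolding eq using S by (intro mw_add)
  qed
qed

lemma mw_UNIV: "P \<in> mw"
proof (cases P rule: wpoint_cases)
  case 1
  then show ?thesis using mw_zero by simp
next
  case (2 x y)
  show ?thesis
  proof (cases "x = 0")
    case True
    then show ?thesis using 2 mw_torsion by (simp add: wcurve_def)
  next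
    case False
    from 2(2) False obtain d M e N where "descent_rep d M e N"
      "x = of_int (d * M ^ 2) / of_int (e ^ 2)" "y = of_int (d * M * N) / of_int (e ^ 3)"
      by (rule wcurve_imp_descent_rep)
    then show ?thesis using 2(1) descent_pt_in_mw by (simp add: descent_pt_def)
  qed
qed

section \<open>Independence of the generators\<close>

lemma double_abscissa_square:
  assumes "R + R = pt x y" "wcurve x y"
  obtains s where "s \<noteq> 0" "x = s ^ 2"
proof (cases R rule: wpoint_cases)
  case 1
  then show ?thesis using assms pt_neq_zero[OF assms(2)] by simp
next
  case (2 a b)
  show ?thesis using 2(2) 2(2)
  proof (cases rule: pt_add_cases)
    case 1
    then show ?thesis using assms 2 pt_neq_zero[OF assms(2)] by simp
  next
    case (2 l n x3)
    have "wcurve x3 (- (l * x3 + n))" using line_section_wcurve(3)[OF 2(1)] by (simp only: wcurve_minus)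
    then have "x = x3" using 2(4) assms pt_eq_iff unfolding \<open>R = pt a b\<close> by metis
    \<comment> \<open>On the tangent at \<open>(a, b)\<close> the product of abscissae reads
      \<open>a * a * x = n ^ 2\<close>, so \<open>n / a\<close> is the required root.\<close>
    then have v: "a * a + a * x + a * x = - 32 - 2 * l * n" "a * a * x = n ^ 2"
      using 2(1) by (auto simp: line_section_def)
    have "a \<noteq> 0" using line_section_double[OF 2(1)] v(2) by auto
    have "n \<noteq> 0"
    proof
      assume "n = 0"
      then have "a * a = - 32" using v \<open>a \<noteq> 0\<close> by auto
      then show False using zero_le_square[of a] by simp
    qed
    moreover have "x = (n / a) ^ 2" using v(2) \<open>a \<noteq> 0\<close> by (simp add: power_divide power2_eq_square field_simps)
    ultimately show ?thesis using that[of "n / a"] \<open>a \<noteq> 0\<close> by simp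
  qed
qed

lemma int_square_strictly_between:
  fixes m k :: int
  assumes "k \<ge> 0" "k ^ 2 < m ^ 2" "m ^ 2 < (k + 1) ^ 2"
  shows False
proof -
  have "k < \<bar>m\<bar>" "\<bar>m\<bar> < k + 1"
    using assms power2_less_imp_less[of k "\<bar>m\<bar>"] power2_less_imp_less[of "\<bar>m\<bar>" "k + 1"] by auto
  then show False by simp
qed

text \<open>The abscissa of a double is the square of a nonzero rational, which 0, 8 and -4 are not.
  The three points are T, G and G + T.\<close>

lemma generator_not_double:
  "R + R \<noteq> pt 0 0" "R + R \<noteq> pt 8 24" "R + R \<noteq> pt (- 4) 12"
proof -
  show "R + R \<noteq> pt 0 0" using double_abscissa_square[OF _ wcurve_special(1)] by fastforce
  show "R + R \<noteq> pt 8 24"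
  proof
    assume "R + R = pt 8 24"
    then obtain s :: rat where "8 = s ^ 2" using double_abscissa_square wcurve_special(2) by metis
    then have "s ^ 2 = of_int 8" by simp
    then obtain m where "s = of_int m" by (rule rat_square_int)
    then have "of_int (m ^ 2) = (of_int 8 :: rat)" using \<open>s ^ 2 = of_int 8\<close> by simp
    then have "m ^ 2 = 8" by (simp only: of_int_eq_iff)
    then show False using int_square_strictly_between[of 2 m] by simp
  qed
  show "R + R \<noteq> pt (- 4) 12"
  proof
    assume "R + R = pt (- 4) 12"
    then obtain s :: rat where "- 4 = s ^ 2" using double_abscissa_square wcurve_special(4) by metis
    then show False using zero_le_power2[of s] by simp
  qed
qed

lemma two_torsion:
  assumes "R + R = 0"
  shows "R = 0 \<or> R = pt 0 0"
proof (cases R rule: wpoint_cases)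
  case (2 a b)
  have "pt a b = pt a (- b)" using assms 2 by (metis add_eq_0_iff uminus_pt)
  then have b: "b = 0" using 2(2) by (simp add: pt_eq_iff wcurve_minus)
  have "a = 0"
  proof (rule ccontr)
    assume "a \<noteq> 0"
    have "a * (a ^ 2 + 5 * a - 32) = 0" using 2(2) b by (simp add: wcurve_def algebra_simps eval_nat_numeral)
    then have "a ^ 2 + 5 * a - 32 = 0" using \<open>a \<noteq> 0\<close> by simp
    \<comment> \<open>The discriminant 153 of the quadratic factor lies strictly between
      \<open>12 ^ 2\<close> and \<open>13 ^ 2\<close>.\<close>
    then have s: "(2 * a + 5) ^ 2 = of_int 153" by (simp add: power2_eq_square algebra_simps)
    then obtain m where "2 * a + 5 = of_int m" by (rule rat_square_int)
    then have "of_int (m ^ 2) = (of_int 153 :: rat)" using s by simp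
    then have "m ^ 2 = 153" by (simp only: of_int_eq_iff)
    then show False using int_square_strictly_between[of 12 m] by simp
  qed
  then show ?thesis using 2 b by simp
qed simp

section \<open>The abstract structure of the group\<close>

definition wgroup :: "wpoint monoid" where
  "wgroup = \<lparr>carrier = UNIV, monoid.mult = (+), one = 0\<rparr>"

lemma wgroup_simps [simp]:
  "carrier wgroup = UNIV" "P \<otimes>\<^bsub>wgroup\<^esub> Q = P + Q" "\<one>\<^bsub>wgroup\<^esub> = 0"
  by (simp_all add: wgroup_def)

lemma comm_group_wgroup: "comm_group wgroup"
  by (rule comm_groupI) (auto simp: ac_simps intro: exI[of _ "- x" for x])

interpretation W: comm_group wgroup by (rule comm_group_wgroup)

definition mw_map :: "int \<times> int \<Rightarrow> wpoint" where
  "mw_map z = pt 8 24 [^]\<^bsub>wgroup\<^esub> fst z + (if snd z = 0 then 0 else pt 0 0)"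

lemma torsion_double: "pt 0 0 + pt 0 0 = 0"
  using uminus_pt[OF wcurve_special(1)] by (simp add: add_eq_0_iff)

lemma gen_pow_add: "pt 8 24 [^]\<^bsub>wgroup\<^esub> (m + n :: int) = pt 8 24 [^]\<^bsub>wgroup\<^esub> m + pt 8 24 [^]\<^bsub>wgroup\<^esub> n"
  using W.int_pow_mult[of "pt 8 24" m n] by simp

lemma mw_map_eq_zero:
  assumes "mw_map (n, e) = 0" "e \<in> {0, 1}"
  shows "n = 0 \<and> e = 0"
  using assms
proof (induction "nat \<bar>n\<bar>" arbitrary: n e rule: less_induct)
  case less
  define k where "k = n div 2"
  define R where "R = pt 8 24 [^]\<^bsub>wgroup\<^esub> k"
  have one: "pt 8 24 [^]\<^bsub>wgroup\<^esub> (1 :: int) = pt 8 24" by (simp add: W.int_pow_1)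
  have neg: "- R + - R = S" if "R + R + S = 0" for S
    using that by (simp add: add_eq_0_iff)
  show ?case
  proof (cases "even n")
    case False
    then have n: "n = k + k + 1" by (auto simp: k_def elim!: oddE)
    have "R + R + pt 8 24 + (if e = 0 then 0 else pt 0 0) = 0"
      using less.prems(1) unfolding n mw_map_def by (simp only: gen_pow_add one R_def fst_conv snd_conv)
    then have "- R + - R = pt 8 24 + (if e = 0 then 0 else pt 0 0)"
      unfolding add.assoc[of "R + R"] by (rule neg)
    moreover have "pt 8 24 + pt 0 0 = pt (- 4) 12"
      using line_sum[of 3 0 0 8 "- 4"] by (simp add: line_section_def add.commute)
    ultimately show ?thesis using generator_not_double[of "- R"] by (auto split: if_splits)
  next
    case True
    then have n: "n = k + k" by (auto simp: k_def)
    have sum: "R + R + (if e = 0 then 0 else pt 0 0) = 0"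
      using less.prems(1) unfolding n mw_map_def by (simp only: gen_pow_add R_def fst_conv snd_conv)
    have e: "e = 0"
    proof (rule ccontr)
      assume "e \<noteq> 0"
      then have "- R + - R = pt 0 0" using sum by (intro neg) simp
      then show False using generator_not_double(1) by blast
    qed
    show ?thesis
    proof (cases "n = 0")
      case False
      then have lt: "nat \<bar>k\<bar> < nat \<bar>n\<bar>" unfolding n by auto
      have "R = 0 \<or> R = pt 0 0" using sum e by (intro two_torsion) simp
      \<comment> \<open>Halving may leave T behind: \<open>kG = T\<close> is the relation
        \<open>kG + T = 0\<close>. The induction therefore ranges over both values of the second
        component.\<close>
      then have "mw_map (k, 0) = 0 \<or> mw_map (k, 1) = 0"
        using torsion_double by (auto simp: mw_map_def R_def)
      then have "k = 0" using less.hyps[OF lt] by auto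
      then show ?thesis using n e by simp
    qed (use e in simp)
  qed
qed

lemma mw_map_iso: "mw_map \<in> iso (integer_group \<times>\<times> integer_mod_group 2) wgroup"
proof (rule isoI)
  have mult: "mw_map (m + n, (d + e) mod 2) = mw_map (m, d) + mw_map (n, e)"
    if "d \<in> {0, 1}" "e \<in> {0, 1}" for m n d e
    using that torsion_double by (auto simp: mw_map_def gen_pow_add algebra_simps)
  have C: "carrier (integer_group \<times>\<times> integer_mod_group 2) = UNIV \<times> {0, 1}"
    by (auto simp: carrier_integer_mod_group)
  show hom: "mw_map \<in> hom (integer_group \<times>\<times> integer_mod_group 2) wgroup"
    unfolding hom_def C using mult[of 0 0] mult[of 0 1] mult[of 1 0] mult[of 1 1] by auto
  interpret group_hom "integer_group \<times>\<times> integer_mod_group 2" wgroup mw_map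
    using hom W.is_group by (simp add: group_hom_def group_hom_axioms_def DirProd_group)
  have inj: "inj_on mw_map (carrier (integer_group \<times>\<times> integer_mod_group 2))"
    unfolding inj_iff_trivial_ker
  proof -
    have "mw_map (0, 0) = 0" by (simp add: mw_map_def)
    then have "{z \<in> UNIV \<times> {0, 1}. mw_map z = 0} = {(0, 0)}" using mw_map_eq_zero by auto
    then show "kernel (integer_group \<times>\<times> integer_mod_group 2) wgroup mw_map = {\<one>\<^bsub>integer_group \<times>\<times> integer_mod_group 2\<^esub>}"
      unfolding kernel_def C by simp
  qed
  have "P \<in> mw_map ` (UNIV \<times> {0, 1})" if "P \<in> mw" for P
    using that
  proof induction
    case mw_zero
    then show ?case by (intro image_eqI[of _ _ "(0, 0)"]) (auto simp: mw_map_def)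
  next
    case mw_torsion
    then show ?case by (intro image_eqI[of _ _ "(0, 1)"]) (auto simp: mw_map_def)
  next
    case mw_gen
    then show ?case by (intro image_eqI[of _ _ "(1, 0)"]) (auto simp: mw_map_def W.int_pow_1)
  next
    case (mw_add P Q)
    then obtain m d n e where "P = mw_map (m, d)" "Q = mw_map (n, e)" "d \<in> {0, 1}" "e \<in> {0, 1}" by auto
    then show ?case using mult[of d e m n] by (intro image_eqI[of _ _ "(m + n, (d + e) mod 2)"]) auto
  next
    case (mw_uminus P)
    then obtain m d where "P = mw_map (m, d)" "d \<in> {0, 1}" by auto
    have "mw_map (m, d) + mw_map (- m, d) = 0"
      using mult[of d d m "- m"] \<open>d \<in> {0, 1}\<close> by (auto simp: mw_map_def)
    then have "- P = mw_map (- m, d)" unfolding \<open>P = _\<close> by (simp add: add_eq_0_iff)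
    then show ?case using \<open>d \<in> {0, 1}\<close> by blast
  qed
  then show "bij_betw mw_map (carrier (integer_group \<times>\<times> integer_mod_group 2)) (carrier wgroup)"
    using inj mw_UNIV unfolding bij_betw_def C by auto
qed

section \<open>Lines and intersection multiplicities\<close>

lemma same_point_refl: "same_point v v \<longleftrightarrow> v \<noteq> 0"
  by (auto simp: same_point_def intro: exI[of _ 1])

lemma abs_proj_plane_eq_iff:
  "v \<noteq> 0 \<Longrightarrow> w \<noteq> 0 \<Longrightarrow> abs_proj_plane v = abs_proj_plane w \<longleftrightarrow> (\<exists>k. w = k *s v)"
  using Quotient3_rel[OF Quotient3_proj_plane, of v w] by (simp add: same_point_refl) (simp add: same_point_def)

lemma abs_rep_proj_plane: "abs_proj_plane (rep_proj_plane P) = P"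
  by (rule Quotient3_abs_rep[OF Quotient3_proj_plane])

lemma rep_proj_plane_nonzero: "rep_proj_plane P \<noteq> 0"
  using Quotient3_rep_reflp[OF Quotient3_proj_plane, of P] by (simp add: same_point_refl)

text \<open>\<open>chord_or_tangent\<close> works with an arbitrarily chosen representative; this
  isolates the unknown scalar, which only rescales the line.\<close>

lemma rep_abs_proj_plane:
  assumes "v \<noteq> 0"
  obtains k where "k \<noteq> 0" "rep_proj_plane (abs_proj_plane v) = k *s v"
proof -
  have "abs_proj_plane v = abs_proj_plane (rep_proj_plane (abs_proj_plane v))"
    by (simp add: abs_rep_proj_plane)
  then obtain k where k: "rep_proj_plane (abs_proj_plane v) = k *s v"
    using assms rep_proj_plane_nonzero by (auto simp: abs_proj_plane_eq_iff)
  then have "k \<noteq> 0" using rep_proj_plane_nonzero[of "abs_proj_plane v"] by auto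
  then show ?thesis using that k by blast
qed

lemma on_curve_abs:
  "v \<noteq> 0 \<Longrightarrow> on_curve (abs_proj_plane v) \<longleftrightarrow> cubic_form (v $ 1) (v $ 2) (v $ 3) = 0"
  by (rule on_curve.abs_eq) (simp add: same_point_refl)

definition dot :: "rat ^ 3 \<Rightarrow> rat ^ 3 \<Rightarrow> rat" where
  "dot l v = l $ 1 * v $ 1 + l $ 2 * v $ 2 + l $ 3 * v $ 3"

lemma imult_abs:
  "v \<noteq> 0 \<Longrightarrow> imult l (abs_proj_plane v) =
     (if dot l v = 0 then Polynomial.order 0 (along v (cross l v)) else 0)"
  by (subst imult.abs_eq) (simp_all add: same_point_refl dot_def sum_3)

lemmas vec3_simps = vec_eq_iff forall_3 cross_def dot_def vector_3 vector_smult_component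
  vector_add_component vector_minus_component vector_uminus_component zero_index

lemma dot_self_eq_0: "dot v v = 0 \<longleftrightarrow> v = 0"
proof
  assume "dot v v = 0"
  then have "v $ 1 ^ 2 + v $ 2 ^ 2 + v $ 3 ^ 2 = 0" by (simp add: dot_def power2_eq_square)
  then show "v = 0" by (simp add: vec3_simps add_nonneg_eq_0_iff)
qed (simp add: dot_def)

lemma dot_diff: "dot l (v - w) = dot l v - dot l w"
  and dot_scale: "dot l (k *s v) = k * dot l v" "dot (k *s l) v = k * dot l v"
  by (simp_all add: vec3_simps algebra_simps)

lemma dot_cross: "dot (cross v w) v = 0" "dot (cross v w) w = 0"
  and dot_cross_right: "dot l (cross l v) = 0"
  by (simp_all add: vec3_simps algebra_simps)

text \<open>Cramer's rule for \<open>v\<close>, \<open>w\<close> and \<open>cross v w\<close>, with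
  the determinant cleared.\<close>

lemma cross_basis_decomposition:
  "dot (cross v w) (cross v w) *s u =
     dot (cross u w) (cross v w) *s v + dot (cross v u) (cross v w) *s w + dot (cross v w) u *s cross v w"
  unfolding vec3_simps by (intro conjI; algebra)

lemma dot_cross_cross: "dot (cross a b) (cross c d) = dot a c * dot b d - dot a d * dot b c"
  unfolding vec3_simps by algebra

text \<open>Being orthogonal to \<open>v\<close> and \<open>w\<close>, \<open>l\<close> is a
  multiple of \<open>cross v w\<close>; orthogonality to \<open>l\<close> then makes the third
  coordinate of \<open>u\<close> vanish.\<close>

lemma plane_coordinates:
  assumes n: "cross v w \<noteq> 0" and l: "l \<noteq> 0" "dot l v = 0" "dot l w = 0" and u: "dot l u = 0"
  obtains s t where "u = s *s v + t *s w"
proof -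
  define N where "N = dot (cross v w) (cross v w)"
  have N: "N \<noteq> 0" using n by (simp add: N_def dot_self_eq_0)
  have sym: "dot a b = dot b a" for a b by (simp add: dot_def)
  have "N *s l = dot (cross v w) l *s cross v w"
    using cross_basis_decomposition[of v w l] l(2,3)
    by (simp add: N_def dot_cross_cross sym[of w l] sym[of v l])
  then have "N * dot l u = dot (cross v w) l * dot (cross v w) u" by (metis dot_scale(2))
  moreover have "dot (cross v w) l \<noteq> 0"
  proof
    assume "dot (cross v w) l = 0"
    then have "N *s l = 0" using \<open>N *s l = _\<close> by simp
    then show False using N l(1) by (simp add: vec3_simps)
  qed
  ultimately have 0: "dot (cross v w) u = 0" using u by simp
  have "N *s u = dot (cross u w) (cross v w) *s v + dot (cross v u) (cross v w) *s w"
    using cross_basis_decomposition[of v w u] 0 by (simp add: N_def)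
  then have "u = (dot (cross u w) (cross v w) / N) *s v + (dot (cross v u) (cross v w) / N) *s w"
    using N by (simp add: vec_eq_iff field_simps)
  then show ?thesis by (rule that)
qed

lemma cross_combination:
  "cross (s *s v + t *s w) (s' *s v + t' *s w) = (s * t' - s' * t) *s cross v w"
  unfolding vec3_simps by (intro conjI; algebra)

lemma cross_cross_self: "cross u (cross l u) = dot u u *s l - dot u l *s u"
  unfolding vec3_simps by (intro conjI; algebra)

lemma combination_eq_iff:
  assumes "cross v w \<noteq> 0"
  shows "s *s v + t *s w = s' *s v + t' *s w \<longleftrightarrow> s = s' \<and> t = t'"
proof
  assume eq: "s *s v + t *s w = s' *s v + t' *s w"
  have "(s * 1 - 0 * t) *s cross v w = (s' * 1 - 0 * t') *s cross v w"
    using arg_cong[OF eq, of "\<lambda>u. cross u (0 *s v + 1 *s w)"] unfolding cross_combination .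
  moreover have "(s * 0 - 1 * t) *s cross v w = (s' * 0 - 1 * t') *s cross v w"
    using arg_cong[OF eq, of "\<lambda>u. cross u (1 *s v + 0 *s w)"] unfolding cross_combination .
  ultimately show "s = s' \<and> t = t'" using assms by (auto simp: vec_eq_iff)
qed simp

lemma along_poly: "poly (along v w) t = cubic_form (v $ 1 + t * w $ 1) (v $ 2 + t * w $ 2) (v $ 3 + t * w $ 3)"
  by (simp only: along_def cubic_form_def poly_add poly_diff poly_minus poly_mult poly_power poly_pCons
      poly_0 mult_zero_right add_0_right)

lemma order_0_linear: "a \<noteq> 0 \<or> b \<noteq> 0 \<Longrightarrow> Polynomial.order 0 [:a, b:] = (if a = 0 then 1 else 0)" for a b :: rat
proof (cases "a = 0")
  case True
  assume "a \<noteq> 0 \<or> b \<noteq> 0"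
  then have "Polynomial.order 0 (smult b [:- 0, 1:]) = 1"
    using True order_power_n_n[of "0 :: rat" 1] by (subst order_smult) simp_all
  then show ?thesis using True by simp
qed (simp add: order_0I)

text \<open>The restriction of the cubic form to the line through \<open>v\<close> and \<open>w\<close> splits into linear forms
  $p_i s + q_i t$; such a form vanishes at the point $q_i v - p_i w$.\<close>

definition splits_on_line :: "rat ^ 3 \<Rightarrow> rat ^ 3 \<Rightarrow> rat \<times> rat \<Rightarrow> rat \<times> rat \<Rightarrow> rat \<times> rat \<Rightarrow> bool" where
  "splits_on_line v w f1 f2 f3 \<longleftrightarrow> cross v w \<noteq> 0 \<and> f1 \<noteq> (0, 0) \<and> f2 \<noteq> (0, 0) \<and> f3 \<noteq> (0, 0) \<and>
     (\<exists>c. c \<noteq> 0 \<and> (\<forall>s t. cubic_form (s * v $ 1 + t * w $ 1) (s * v $ 2 + t * w $ 2) (s * v $ 3 + t * w $ 3)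
        = c * (fst f1 * s + snd f1 * t) * (fst f2 * s + snd f2 * t) * (fst f3 * s + snd f3 * t)))"

definition line_zero :: "rat ^ 3 \<Rightarrow> rat ^ 3 \<Rightarrow> rat \<times> rat \<Rightarrow> rat ^ 3" where
  "line_zero v w f = snd f *s v + (- fst f) *s w"

lemma line_zero_nonzero:
  assumes "cross v w \<noteq> 0" "f \<noteq> (0, 0)"
  shows "line_zero v w f \<noteq> 0"
proof
  assume "line_zero v w f = 0"
  then have "snd f *s v + (- fst f) *s w = 0 *s v + 0 *s w" by (simp add: line_zero_def)
  then have "snd f = 0 \<and> - fst f = 0" unfolding combination_eq_iff[OF assms(1)] .
  then show False using assms(2) by (cases f) simp
qed

lemma combination_same_point_line_zero:
  assumes n: "cross v w \<noteq> 0" and f: "f \<noteq> (0, 0)" and u: "s *s v + t *s w \<noteq> 0"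
  shows "abs_proj_plane (s *s v + t *s w) = abs_proj_plane (line_zero v w f) \<longleftrightarrow> fst f * s + snd f * t = 0"
proof -
  obtain p q where pq: "f = (p, q)" by (cases f)
  have "abs_proj_plane (s *s v + t *s w) = abs_proj_plane (line_zero v w f) \<longleftrightarrow>
      abs_proj_plane (line_zero v w f) = abs_proj_plane (s *s v + t *s w)" by auto
  also have "\<dots> \<longleftrightarrow> (\<exists>k. s *s v + t *s w = k *s line_zero v w f)"
    by (intro abs_proj_plane_eq_iff line_zero_nonzero n f u)
  also have "\<dots> \<longleftrightarrow> (\<exists>k. s = k * q \<and> t = - (k * p))"
  proof -
    have "k *s line_zero v w f = (k * q) *s v + (- (k * p)) *s w" for k
      by (simp add: line_zero_def pq vec_eq_iff algebra_simps)
    then show ?thesis by (simp only: combination_eq_iff[OF n])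
  qed
  also have "\<dots> \<longleftrightarrow> p * s + q * t = 0"
  proof
    assume 0: "p * s + q * t = 0"
    show "\<exists>k. s = k * q \<and> t = - (k * p)"
    proof (cases "q = 0")
      case True
      then have "p \<noteq> 0" using f pq by simp
      then show ?thesis using 0 True by (intro exI[of _ "- t / p"]) simp
    next
      case False
      then have "t = - (s / q * p)" using 0 by (simp add: field_simps add_eq_0_iff)
      then show ?thesis using False by (intro exI[of _ "s / q"]) simp
    qed
  qed auto
  finally show ?thesis by (simp add: pq)
qed

text \<open>Along the parametrisation of the line from a representative of \<open>X\<close>, each
  linear form becomes a nonzero polynomial of degree at most 1, vanishing at 0 exactly when
  \<open>X\<close> is its zero. The order of the product thus counts the matching factors.\<close>

lemma imult_splits_on_line:
  assumes split: "splits_on_line v w f1 f2 f3" and l: "l \<noteq> 0" "dot l v = 0" "dot l w = 0"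
  shows "imult l X = count {#abs_proj_plane (line_zero v w f1), abs_proj_plane (line_zero v w f2),
            abs_proj_plane (line_zero v w f3)#} X"
proof -
  have n: "cross v w \<noteq> 0" and f: "f1 \<noteq> (0, 0)" "f2 \<noteq> (0, 0)" "f3 \<noteq> (0, 0)"
    using split by (auto simp: splits_on_line_def)
  define u where "u = rep_proj_plane X"
  have X: "X = abs_proj_plane u" "u \<noteq> 0" by (simp_all add: u_def abs_rep_proj_plane rep_proj_plane_nonzero)
  show ?thesis
  proof (cases "dot l u = 0")
    case False
    have ne: "X \<noteq> abs_proj_plane (line_zero v w f)" if nz: "f \<noteq> (0, 0)" for f
    proof
      assume "X = abs_proj_plane (line_zero v w f)"
      then obtain k where "line_zero v w f = k *s u"
        using X abs_proj_plane_eq_iff[OF X(2) line_zero_nonzero[OF n nz]] by auto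
      moreover from this have "k \<noteq> 0" using line_zero_nonzero[OF n nz] by auto
      moreover have "dot l (line_zero v w f) = 0" using l by (simp add: line_zero_def dot_diff dot_scale)
      ultimately show False using False by (simp add: dot_scale)
    qed
    show ?thesis using False X(2) ne[OF f(1), symmetric] ne[OF f(2), symmetric] ne[OF f(3), symmetric]
      unfolding X(1) by (simp add: imult_abs)
  next
    case True
    obtain s t where st: "u = s *s v + t *s w" using plane_coordinates[OF n l True] .
    obtain s' t' where st': "cross l u = s' *s v + t' *s w"
      using plane_coordinates[OF n l dot_cross_right] .
    \<comment> \<open>Base point and direction are independent, since
      \<open>cross u (cross l u)\<close> is \<open>dot u u\<close> times \<open>l\<close>.\<close>
    have det: "s * t' - s' * t \<noteq> 0"
    proof
      assume "s * t' - s' * t = 0"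
      then have "cross u (cross l u) = 0" unfolding st' by (simp add: st cross_combination)
      moreover have "dot u l = 0" using True by (simp add: dot_def mult.commute)
      ultimately have "dot u u *s l = 0" by (simp add: cross_cross_self)
      then show False using X(2) l(1) by (simp add: dot_self_eq_0)
    qed
    define g where "g f = [:fst f * s + snd f * t, fst f * s' + snd f * t':]" for f
    obtain c where c: "c \<noteq> 0" and fac: "\<And>s t. cubic_form (s * v $ 1 + t * w $ 1) (s * v $ 2 + t * w $ 2)
        (s * v $ 3 + t * w $ 3) = c * (fst f1 * s + snd f1 * t) * (fst f2 * s + snd f2 * t) * (fst f3 * s + snd f3 * t)"
      using split by (auto simp: splits_on_line_def)
    have "along u (cross l u) = smult c (g f1 * g f2 * g f3)"
    proof (rule poly_eq_poly_eq_iff[THEN iffD1], rule ext)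
      fix a :: rat
      have "poly (along u (cross l u)) a = cubic_form ((s + a * s') * v $ 1 + (t + a * t') * w $ 1)
          ((s + a * s') * v $ 2 + (t + a * t') * w $ 2) ((s + a * s') * v $ 3 + (t + a * t') * w $ 3)"
        unfolding along_poly st' by (simp add: st algebra_simps)
      also have "\<dots> = poly (smult c (g f1 * g f2 * g f3)) a"
        unfolding fac by (simp add: g_def algebra_simps)
      finally show "poly (along u (cross l u)) a = poly (smult c (g f1 * g f2 * g f3)) a" .
    qed
    moreover have nz: "fst f * s + snd f * t \<noteq> 0 \<or> fst f * s' + snd f * t' \<noteq> 0" if "f \<noteq> (0, 0)" for f
    proof (rule ccontr)
      assume "\<not> ?thesis"
      then have "fst f * (s * t' - s' * t) = 0" "snd f * (s * t' - s' * t) = 0" by algebra+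
      then show False using det that by (cases f) auto
    qed
    moreover have "Polynomial.order 0 (g f) = (if X = abs_proj_plane (line_zero v w f) then 1 else 0)"
      if "f \<noteq> (0, 0)" for f
      using order_0_linear[OF nz[OF that]] combination_same_point_line_zero[OF n that, of s t] X
      unfolding g_def st by simp
    moreover have "g f \<noteq> 0" if "f \<noteq> (0, 0)" for f using nz[OF that] by (auto simp: g_def)
    ultimately have "Polynomial.order 0 (along u (cross l u)) =
        (if X = abs_proj_plane (line_zero v w f1) then 1 else 0)
      + (if X = abs_proj_plane (line_zero v w f2) then 1 else 0)
      + (if X = abs_proj_plane (line_zero v w f3) then 1 else 0)"
      using c f by (simp add: order_smult order_mult)
    moreover have "imult l X = Polynomial.order 0 (along u (cross l u))"
      using True X by (simp add: imult_abs)
    ultimately show ?thesis by auto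
  qed
qed

text \<open>The multiplicities determine the divisor as a multiset, and cancelling P and Q
  determines R; so the definite description is well defined.\<close>

lemma third_point_eqI:
  assumes "\<And>X. imult (chord_or_tangent P Q) X = count {#P, Q, R#} X"
  shows "third_point P Q = R"
  unfolding third_point_def
proof (rule the_equality)
  show "\<forall>X. imult (chord_or_tangent P Q) X = count {#P, Q, R#} X" using assms by blast
next
  fix R' assume "\<forall>X. imult (chord_or_tangent P Q) X = count {#P, Q, R'#} X"
  then have "{#P, Q, R'#} = {#P, Q, R#}" using assms by (intro multiset_eqI) simp
  then show "R' = R" by simp
qed

lemma third_point_chord:
  assumes split: "splits_on_line v w f1 f2 f3" and ne: "fst f1 * snd f2 \<noteq> fst f2 * snd f1"
  shows "third_point (abs_proj_plane (line_zero v w f1)) (abs_proj_plane (line_zero v w f2))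
    = abs_proj_plane (line_zero v w f3)"
proof (rule third_point_eqI)
  fix X
  have n: "cross v w \<noteq> 0" and f: "f1 \<noteq> (0, 0)" "f2 \<noteq> (0, 0)"
    using split by (auto simp: splits_on_line_def)
  let ?P = "abs_proj_plane (line_zero v w f1)" and ?Q = "abs_proj_plane (line_zero v w f2)"
  have "?P \<noteq> ?Q"
    using combination_same_point_line_zero[OF n f(2), of "snd f1" "- fst f1"] line_zero_nonzero[OF n f(1)] ne
    by (simp add: line_zero_def algebra_simps)
  obtain k where k: "k \<noteq> 0" "rep_proj_plane ?P = k *s line_zero v w f1"
    using rep_abs_proj_plane[OF line_zero_nonzero[OF n f(1)]] .
  obtain k' where k': "k' \<noteq> 0" "rep_proj_plane ?Q = k' *s line_zero v w f2"
    using rep_abs_proj_plane[OF line_zero_nonzero[OF n f(2)]] .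
  have "chord_or_tangent ?P ?Q = cross (k *s line_zero v w f1) (k' *s line_zero v w f2)"
    unfolding chord_or_tangent_def using \<open>?P \<noteq> ?Q\<close> k k' by simp
  also have "\<dots> = (k * k') *s cross (line_zero v w f1) (line_zero v w f2)"
    by (simp add: vec3_simps algebra_simps)
  also have "\<dots> = (k * k' * (fst f1 * snd f2 - fst f2 * snd f1)) *s cross v w"
    unfolding line_zero_def cross_combination by (simp add: vector_smult_assoc algebra_simps)
  finally obtain m where m: "chord_or_tangent ?P ?Q = m *s cross v w" "m \<noteq> 0"
    using k(1) k'(1) ne by (metis mult_eq_0_iff right_minus_eq)
  show "imult (chord_or_tangent ?P ?Q) X = count {#?P, ?Q, abs_proj_plane (line_zero v w f3)#} X"
    by (rule imult_splits_on_line[OF split]) (use m n in \<open>simp_all add: dot_scale dot_cross\<close>)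
qed

lemma gradient_components:
  "gradient v = vector [3 * v $ 1 ^ 2 + 2 * v $ 1 * v $ 2 + v $ 2 ^ 2 + v $ 3 * (2 * v $ 1 + v $ 2) - v $ 3 ^ 2,
     v $ 1 ^ 2 + 2 * v $ 1 * v $ 2 + 3 * v $ 2 ^ 2 + v $ 3 * (v $ 1 + 2 * v $ 2) - v $ 3 ^ 2,
     v $ 1 ^ 2 + v $ 1 * v $ 2 + v $ 2 ^ 2 - 2 * v $ 3 * (v $ 1 + v $ 2) - 3 * v $ 3 ^ 2]"
  by (simp add: gradient_def vec_eq_iff forall_3 along_def cubic_form_def axis_def
      pderiv_add pderiv_diff pderiv_minus pderiv_mult pderiv_power pderiv_pCons power2_eq_square power3_eq_cube
      algebra_simps)

text \<open>The last three hypotheses say that the tangent exists and passes through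
  \<open>v\<close> and \<open>w\<close>, hence is the line on which the form splits.\<close>

lemma third_point_tangent:
  assumes split: "splits_on_line v w f f f3" and grad: "gradient (line_zero v w f) \<noteq> 0"
    "dot (gradient (line_zero v w f)) v = 0" "dot (gradient (line_zero v w f)) w = 0"
  shows "third_point (abs_proj_plane (line_zero v w f)) (abs_proj_plane (line_zero v w f))
    = abs_proj_plane (line_zero v w f3)"
proof (rule third_point_eqI)
  fix X
  have n: "cross v w \<noteq> 0" and f: "f \<noteq> (0, 0)"
    using split by (auto simp: splits_on_line_def)
  let ?P = "abs_proj_plane (line_zero v w f)"
  obtain k where k: "k \<noteq> 0" "rep_proj_plane ?P = k *s line_zero v w f"
    using rep_abs_proj_plane[OF line_zero_nonzero[OF n f]] .
  have "gradient (k *s u) = (k ^ 2) *s gradient u" for u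
    unfolding gradient_components vec3_simps by (intro conjI; algebra)
  then have g: "chord_or_tangent ?P ?P = (k ^ 2) *s gradient (line_zero v w f)"
    using k by (simp add: chord_or_tangent_def)
  show "imult (chord_or_tangent ?P ?P) X = count {#?P, ?P, abs_proj_plane (line_zero v w f3)#} X"
    unfolding g
    by (rule imult_splits_on_line[OF split]) (use k(1) grad in \<open>simp_all add: dot_scale vec_eq_iff\<close>)
qed

section \<open>The isomorphism with the projective cubic\<close>

text \<open>The linear change of coordinates taking the Weierstrass form to the given cubic.\<close>

definition wvec :: "rat \<Rightarrow> rat \<Rightarrow> rat \<Rightarrow> rat ^ 3" where
  "wvec X Y Z = vector [8 * Z - X + Y, 8 * Z - X - Y, 4 * X - 8 * Z]"

lemma cubic_form_wvec:
  "cubic_form (wvec X Y Z $ 1) (wvec X Y Z $ 2) (wvec X Y Z $ 3)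
     = 24 * (Y ^ 2 * Z - X ^ 3 - 5 * X ^ 2 * Z + 32 * X * Z ^ 2)"
  unfolding wvec_def vector_3 cubic_form_def by algebra

lemma wvec_combination: "s *s wvec X Y Z + t *s wvec X' Y' Z' = wvec (s * X + t * X') (s * Y + t * Y') (s * Z + t * Z')"
  unfolding wvec_def vec3_simps by (intro conjI; algebra)

lemma wvec_scale: "s *s wvec X Y Z = wvec (s * X) (s * Y) (s * Z)"
  unfolding wvec_def vec3_simps by (intro conjI; algebra)

lemma wvec_eq_iff: "wvec X Y Z = wvec X' Y' Z' \<longleftrightarrow> X = X' \<and> Y = Y' \<and> Z = Z'"
  by (auto simp: wvec_def vec3_simps)

lemma wvec_zero: "wvec 0 0 0 = 0"
  by (simp add: wvec_def vec3_simps)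

lemma wvec_nonzero: "X \<noteq> 0 \<or> Y \<noteq> 0 \<or> Z \<noteq> 0 \<Longrightarrow> wvec X Y Z \<noteq> 0"
  by (metis wvec_zero wvec_eq_iff)

lemma cross_wvec_nonzero:
  assumes "Y * Z' - Z * Y' \<noteq> 0 \<or> Z * X' - X * Z' \<noteq> 0 \<or> X * Y' - Y * X' \<noteq> 0"
  shows "cross (wvec X Y Z) (wvec X' Y' Z') \<noteq> 0"
proof
  assume 0: "cross (wvec X Y Z) (wvec X' Y' Z') = 0"
  have 1: "(8 * Z - X - Y) * (4 * X' - 8 * Z') = (4 * X - 8 * Z) * (8 * Z' - X' - Y')"
    "(4 * X - 8 * Z) * (8 * Z' - X' + Y') = (8 * Z - X + Y) * (4 * X' - 8 * Z')"
    "(8 * Z - X + Y) * (8 * Z' - X' - Y') = (8 * Z - X - Y) * (8 * Z' - X' + Y')"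
    using 0 by (simp_all add: wvec_def vec3_simps)
  have "48 * (Z * X' - X * Z') = 0" "24 * (Y * Z' - Z * Y') = 0" "12 * (X * Y' - Y * X') = 0"
    using 1 by algebra+
  then show False using assms by simp
qed

text \<open>Chain rule: 24 times the directional derivative of the homogeneous Weierstrass form. It
  decides tangency in the Weierstrass coordinates.\<close>

lemma dot_gradient_wvec:
  "dot (gradient (wvec X Y Z)) (wvec X' Y' Z') =
     24 * (2 * Y * Z * Y' + Y ^ 2 * Z' - 3 * X ^ 2 * X' - 10 * X * Z * X' - 5 * X ^ 2 * Z'
       + 32 * Z ^ 2 * X' + 64 * X * Z * Z')"
  unfolding gradient_components dot_def wvec_def vector_3 by algebra

lemma dot_gradient_wvec_affine:
  "dot (gradient (wvec X Y 1)) (wvec X' Y' Z') =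
     24 * (2 * Y * Y' + Y ^ 2 * Z' - 3 * X ^ 2 * X' - 10 * X * X' - 5 * X ^ 2 * Z' + 32 * X' + 64 * X * Z')"
  by (simp add: dot_gradient_wvec)

definition pt_proj :: "wpoint \<Rightarrow> proj_plane" where
  "pt_proj P = (case Rep_wpoint P of None \<Rightarrow> base_point | Some (x, y) \<Rightarrow> abs_proj_plane (wvec x y 1))"

lemma base_point_wvec: "base_point = abs_proj_plane (wvec 0 1 0)"
  by (simp add: base_point_def proj_def wvec_def)

lemma pt_proj_zero: "pt_proj 0 = abs_proj_plane (wvec 0 1 0)"
  by (simp add: pt_proj_def Rep_wpoint_zero base_point_wvec)

lemma pt_proj_pt: "wcurve x y \<Longrightarrow> pt_proj (pt x y) = abs_proj_plane (wvec x y 1)"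
  by (simp add: pt_proj_def Rep_wpoint_pt)

lemma abs_wvec_eq_iff:
  assumes "wvec X Y Z \<noteq> 0" "wvec X' Y' Z' \<noteq> 0"
  shows "abs_proj_plane (wvec X Y Z) = abs_proj_plane (wvec X' Y' Z') \<longleftrightarrow> (\<exists>k. X' = k * X \<and> Y' = k * Y \<and> Z' = k * Z)"
  by (simp add: abs_proj_plane_eq_iff[OF assms] wvec_scale wvec_eq_iff)

lemma abs_wvec_scale:
  assumes "wvec X Y Z \<noteq> 0" "k \<noteq> 0"
  shows "abs_proj_plane (wvec (k * X) (k * Y) (k * Z)) = abs_proj_plane (wvec X Y Z)"
proof -
  have "wvec (k * X) (k * Y) (k * Z) \<noteq> 0"
    using assms by (simp add: vec_eq_iff flip: wvec_scale)
  then show ?thesis using assms(1) by (metis abs_wvec_eq_iff)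
qed

lemma inj_pt_proj: "inj pt_proj"
proof (rule injI)
  fix P Q assume eq: "pt_proj P = pt_proj Q"
  have nz: "wvec 0 1 0 \<noteq> 0" "wvec x y 1 \<noteq> 0" for x y by (auto intro!: wvec_nonzero)
  show "P = Q"
    using eq by (cases P rule: wpoint_cases; cases Q rule: wpoint_cases)
      (auto simp: pt_proj_zero pt_proj_pt abs_wvec_eq_iff nz)
qed

lemma pt_proj_on_curve: "on_curve (pt_proj P)"
proof (cases P rule: wpoint_cases)
  case 1
  then show ?thesis by (simp add: pt_proj_zero on_curve_abs wvec_nonzero cubic_form_wvec)
next
  case (2 x y)
  then show ?thesis by (simp add: pt_proj_pt on_curve_abs wvec_nonzero cubic_form_wvec wcurve_def)
qed

lemma on_curve_imp_pt_proj:
  assumes "on_curve R"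
  shows "R \<in> range pt_proj"
proof -
  define u where "u = rep_proj_plane R"
  have R: "R = abs_proj_plane u" "u \<noteq> 0" by (simp_all add: u_def abs_rep_proj_plane rep_proj_plane_nonzero)
  \<comment> \<open>The inverse of the linear map \<open>wvec\<close>, whose determinant is
    nonzero.\<close>
  define X Y Z where "X = (4 * (u $ 1 + u $ 2) + 8 * u $ 3) / 24" "Y = 12 * (u $ 1 - u $ 2) / 24"
    "Z = (2 * (u $ 1 + u $ 2) + u $ 3) / 24"
  have u: "u = wvec X Y Z" by (simp add: X_Y_Z_def wvec_def vec3_simps field_simps)
  have "Y ^ 2 * Z - X ^ 3 - 5 * X ^ 2 * Z + 32 * X * Z ^ 2 = 0"
    using assms R by (simp add: on_curve_abs u cubic_form_wvec)
  then have c: "Y ^ 2 * Z = X ^ 3 + 5 * X ^ 2 * Z - 32 * X * Z ^ 2" by (simp add: algebra_simps)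
  show ?thesis
  proof (cases "Z = 0")
    case True
    then have "X = 0" using c by simp
    then have "Y \<noteq> 0" using R(2) True unfolding u by (auto simp: wvec_zero)
    then have "abs_proj_plane (wvec (Y * 0) (Y * 1) (Y * 0)) = abs_proj_plane (wvec 0 1 0)"
      by (intro abs_wvec_scale wvec_nonzero) auto
    then have "R = pt_proj 0" unfolding R u using True \<open>X = 0\<close> by (simp add: pt_proj_zero)
    then show ?thesis by blast
  next
    case False
    define x y where "x = X / Z" and "y = Y / Z"
    have XY: "X = Z * x" "Y = Z * y" using False by (simp_all add: x_def y_def)
    have "Z ^ 3 * y ^ 2 = Z ^ 3 * (x ^ 3 + 5 * x ^ 2 - 32 * x)" using c unfolding XY by algebra
    then have "wcurve x y" using False by (simp add: wcurve_def)
    have "abs_proj_plane (wvec (Z * x) (Z * y) (Z * 1)) = abs_proj_plane (wvec x y 1)"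
      using False by (intro abs_wvec_scale wvec_nonzero) auto
    then have "R = pt_proj (pt x y)" unfolding R u XY using \<open>wcurve x y\<close> by (simp add: pt_proj_pt)
    then show ?thesis by blast
  qed
qed

lemma gradient_wvec_nonzero:
  assumes "dot (gradient (wvec X Y Z)) (wvec X' Y' Z') \<noteq> 0"
  shows "gradient (wvec X Y Z) \<noteq> 0"
  using assms by (auto simp: dot_def)

text \<open>At infinity the form restricts to a multiple of a cube, which expresses that O is an
  inflexion.\<close>

lemma splits_infinity: "splits_on_line (wvec 1 0 0) (wvec 0 1 0) (1, 0) (1, 0) (1, 0)"
  unfolding splits_on_line_def
proof (intro conjI exI allI)
  fix s t
  have "cubic_form (wvec s t 0 $ 1) (wvec s t 0 $ 2) (wvec s t 0 $ 3) = - 24 * s * s * s"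
    unfolding cubic_form_wvec by (simp add: power3_eq_cube)
  then show "cubic_form (s * wvec 1 0 0 $ 1 + t * wvec 0 1 0 $ 1) (s * wvec 1 0 0 $ 2 + t * wvec 0 1 0 $ 2)
      (s * wvec 1 0 0 $ 3 + t * wvec 0 1 0 $ 3) =
      - 24 * (fst (1, 0) * s + snd (1, 0) * t) * (fst (1, 0) * s + snd (1, 0) * t) * (fst (1, 0) * s + snd (1, 0) * t)"
    using wvec_combination[of s 1 0 0 t 0 1 0] by (simp flip: vector_smult_component vector_add_component)
qed (auto intro!: cross_wvec_nonzero)

lemma splits_vertical:
  assumes "wcurve x y"
  shows "splits_on_line (wvec x 0 1) (wvec 0 1 0) (1, 0) (- y, 1) (y, 1)"
  unfolding splits_on_line_def
proof (intro conjI exI allI)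
  fix s t
  have "cubic_form (wvec (s * x) t s $ 1) (wvec (s * x) t s $ 2) (wvec (s * x) t s $ 3) = 24 * s * (- y * s + t) * (y * s + t)"
    unfolding cubic_form_wvec using assms unfolding wcurve_def by algebra
  then show "cubic_form (s * wvec x 0 1 $ 1 + t * wvec 0 1 0 $ 1) (s * wvec x 0 1 $ 2 + t * wvec 0 1 0 $ 2)
      (s * wvec x 0 1 $ 3 + t * wvec 0 1 0 $ 3) =
      24 * (fst (1, 0) * s + snd (1, 0) * t) * (fst (- y, 1) * s + snd (- y, 1) * t) * (fst (y, 1) * s + snd (y, 1) * t)"
    using wvec_combination[of s x 0 1 t 0 1 0] by (simp flip: vector_smult_component vector_add_component)
qed (auto intro!: cross_wvec_nonzero)

text \<open>The line \<open>y = l x + n\<close> is spanned by its points over \<open>x = 0\<close>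
  and at infinity; the factorisation is Vieta's formulas read backwards.\<close>

lemma splits_nonvertical:
  assumes "line_section l n x1 x2 x3"
  shows "splits_on_line (wvec 0 n 1) (wvec 1 l 0) (- x1, 1) (- x2, 1) (- x3, 1)"
  unfolding splits_on_line_def
proof (intro conjI exI allI)
  fix s t
  have v: "x1 + x2 + x3 = l ^ 2 - 5" "x1 * x2 + x1 * x3 + x2 * x3 = - 32 - 2 * l * n" "x1 * x2 * x3 = n ^ 2"
    using assms by (auto simp: line_section_def)
  have "cubic_form (wvec t (s * n + t * l) s $ 1) (wvec t (s * n + t * l) s $ 2) (wvec t (s * n + t * l) s $ 3)
      = - 24 * (- x1 * s + t) * (- x2 * s + t) * (- x3 * s + t)"
    unfolding cubic_form_wvec using v by algebra
  then show "cubic_form (s * wvec 0 n 1 $ 1 + t * wvec 1 l 0 $ 1) (s * wvec 0 n 1 $ 2 + t * wvec 1 l 0 $ 2)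
      (s * wvec 0 n 1 $ 3 + t * wvec 1 l 0 $ 3) =
      - 24 * (fst (- x1, 1) * s + snd (- x1, 1) * t) * (fst (- x2, 1) * s + snd (- x2, 1) * t)
        * (fst (- x3, 1) * s + snd (- x3, 1) * t)"
    using wvec_combination[of s 0 n 1 t 1 l 0] by (simp flip: vector_smult_component vector_add_component)
qed (auto intro!: cross_wvec_nonzero)

lemma line_zero_wvec: "line_zero (wvec X Y Z) (wvec X' Y' Z') (p, q) =
    wvec (q * X - p * X') (q * Y - p * Y') (q * Z - p * Z')"
  unfolding line_zero_def wvec_combination by simp

lemma abs_neg_base: "abs_proj_plane (wvec 0 (- 1) 0) = abs_proj_plane (wvec 0 1 0)"
  using abs_wvec_scale[of 0 1 0 "- 1"] by (simp add: wvec_nonzero)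

lemma third_point_zero_zero: "third_point (pt_proj 0) (pt_proj 0) = pt_proj 0"
proof -
  have z: "line_zero (wvec 1 0 0) (wvec 0 1 0) (1, 0) = wvec 0 (- 1) 0"
    by (simp add: line_zero_wvec)
  have "third_point (abs_proj_plane (wvec 0 (- 1) 0)) (abs_proj_plane (wvec 0 (- 1) 0)) = abs_proj_plane (wvec 0 (- 1) 0)"
    using third_point_tangent[OF splits_infinity] gradient_wvec_nonzero[of 0 "- 1" 0 0 0 1]
    unfolding z dot_gradient_wvec by simp
  then show ?thesis by (simp add: pt_proj_zero abs_neg_base)
qed

lemma third_point_vertical:
  assumes "wcurve x y"
  shows "third_point (pt_proj 0) (pt_proj (pt x y)) = pt_proj (pt x (- y))"
    "third_point (pt_proj (pt x y)) (pt_proj 0) = pt_proj (pt x (- y))"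
    "third_point (pt_proj (pt x y)) (pt_proj (pt x (- y))) = pt_proj 0"
proof -
  have z: "line_zero (wvec x 0 1) (wvec 0 1 0) (1, 0) = wvec 0 (- 1) 0"
    "line_zero (wvec x 0 1) (wvec 0 1 0) (- y, 1) = wvec x y 1"
    "line_zero (wvec x 0 1) (wvec 0 1 0) (y, 1) = wvec x (- y) 1" for y
    by (simp_all add: line_zero_wvec)
  have swap: "splits_on_line v w f2 f1 f3" "splits_on_line v w f2 f3 f1"
    if "splits_on_line v w f1 f2 f3" for v w f1 f2 f3
    using that by (auto simp: splits_on_line_def mult_ac)
  note p = pt_proj_pt[OF assms] pt_proj_pt[of x "- y"] pt_proj_zero wcurve_minus assms
  note s = splits_vertical[OF assms]
  show "third_point (pt_proj 0) (pt_proj (pt x y)) = pt_proj (pt x (- y))"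
    using third_point_chord[OF s] by (simp add: p z abs_neg_base)
  show "third_point (pt_proj (pt x y)) (pt_proj 0) = pt_proj (pt x (- y))"
    using third_point_chord[OF swap(1)[OF s]] by (simp add: p z abs_neg_base)
  show "third_point (pt_proj (pt x y)) (pt_proj (pt x (- y))) = pt_proj 0"
  proof (cases "y = 0")
    case False
    then show ?thesis using third_point_chord[OF swap(2)[OF s]] by (simp add: p z abs_neg_base)
  next
    case True
    \<comment> \<open>At ordinate 0 the two points coincide and the vertical line is the tangent;
      smoothness supplies a nonzero gradient.\<close>
    have c: "x ^ 3 + 5 * x ^ 2 - 32 * x = 0" using assms True by (simp add: wcurve_def)
    have "dot (gradient (wvec x 0 1)) (wvec 1 0 0) = - 24 * (3 * x ^ 2 + 10 * x - 32)"
      unfolding dot_gradient_wvec_affine by (simp add: algebra_simps)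
    also have "\<dots> \<noteq> 0" using wcurve_nonsingular[OF c] by auto
    finally have "gradient (wvec x 0 1) \<noteq> 0" by (rule gradient_wvec_nonzero)
    moreover have "dot (gradient (wvec x 0 1)) (wvec x 0 1) = - 72 * (x ^ 3 + 5 * x ^ 2 - 32 * x)"
      unfolding dot_gradient_wvec_affine by (simp add: algebra_simps eval_nat_numeral)
    moreover have "dot (gradient (wvec x 0 1)) (wvec 0 1 0) = 0"
      by (simp add: dot_gradient_wvec_affine)
    ultimately show ?thesis
      using third_point_tangent[of "wvec x 0 1" "wvec 0 1 0" "(0, 1)" "(1, 0)"] swap(2)[OF s] True z(2)[of 0] c assms pt_proj_pt[of x 0]
      by (simp add: p z abs_neg_base)
  qed
qed

lemma third_point_nonvertical:
  assumes sec: "line_section l n x1 x2 x3"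
  shows "third_point (pt_proj (pt x1 (l * x1 + n))) (pt_proj (pt x2 (l * x2 + n))) = pt_proj (pt x3 (l * x3 + n))"
proof -
  have z: "line_zero (wvec 0 n 1) (wvec 1 l 0) (- x, 1) = wvec x (l * x + n) 1" for x
    by (simp add: line_zero_wvec algebra_simps)
  note p = line_section_wcurve[OF sec, THEN pt_proj_pt]
  note s = splits_nonvertical[OF sec]
  show ?thesis
  proof (cases "x1 = x2")
    case False
    then show ?thesis using third_point_chord[OF s] by (simp add: p z)
  next
    case True
    have v: "x1 + x1 + x3 = l ^ 2 - 5" "x1 * x1 + x1 * x3 + x1 * x3 = - 32 - 2 * l * n" "x1 * x1 * x3 = n ^ 2"
      using sec True by (auto simp: line_section_def)
    have "l * x1 + n \<noteq> 0" using line_section_double sec True by auto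
    then have "gradient (wvec x1 (l * x1 + n) 1) \<noteq> 0"
      using gradient_wvec_nonzero[of x1 "l * x1 + n" 1 0 1 0] unfolding dot_gradient_wvec by simp
    moreover have "dot (gradient (wvec x1 (l * x1 + n) 1)) (wvec 0 n 1) = 0"
      "dot (gradient (wvec x1 (l * x1 + n) 1)) (wvec 1 l 0) = 0"
      unfolding dot_gradient_wvec_affine using v by algebra+
    ultimately show ?thesis using third_point_tangent[of "wvec 0 n 1" "wvec 1 l 0" "(- x1, 1)" "(- x3, 1)"] s True
      by (simp add: p z)
  qed
qed

text \<open>Identifies the geometric operation with the sum. Since the third point with O is then
  negation, composing the two gives addition.\<close>

lemma third_point_pt_proj: "third_point (pt_proj P) (pt_proj Q) = pt_proj (- (P + Q))"
proof (cases P rule: wpoint_cases)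
  case P: 1
  then show ?thesis
    by (cases Q rule: wpoint_cases) (simp_all add: third_point_zero_zero third_point_vertical uminus_pt)
next
  case P: (2 x1 y1)
  show ?thesis
  proof (cases Q rule: wpoint_cases)
    case 1
    then show ?thesis using P by (simp add: third_point_vertical uminus_pt)
  next
    case Q: (2 x2 y2)
    show ?thesis using P(2) Q(2)
    proof (cases rule: pt_add_cases)
      case 1
      then show ?thesis using P Q by (simp add: third_point_vertical)
    next
      case (2 l n x3)
      have "wcurve x3 (- (l * x3 + n))" using line_section_wcurve(3)[OF 2(1)] by (simp only: wcurve_minus)
      from uminus_pt[OF this] have "- (P + Q) = pt x3 (l * x3 + n)"
        unfolding P(1) Q(1) 2(4) by (simp only: minus_minus)
      then show ?thesis using third_point_nonvertical[OF 2(1)] 2(2,3) P(1) Q(1) by simp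
    qed
  qed
qed

lemma rational_points_mult:
  "pt_proj P \<otimes>\<^bsub>rational_points\<^esub> pt_proj Q = pt_proj (P + Q)"
proof -
  have "pt_proj P \<otimes>\<^bsub>rational_points\<^esub> pt_proj Q =
      third_point (pt_proj 0) (third_point (pt_proj P) (pt_proj Q))"
    by (simp add: rational_points_def base_point_wvec pt_proj_zero)
  then show ?thesis unfolding third_point_pt_proj by (simp only: add_0_left minus_minus)
qed

lemma carrier_rational_points: "carrier rational_points = range pt_proj"
  using pt_proj_on_curve on_curve_imp_pt_proj by (auto simp: rational_points_def)

lemma one_rational_points: "\<one>\<^bsub>rational_points\<^esub> = pt_proj 0"
  by (simp add: rational_points_def base_point_wvec pt_proj_zero)

lemma pt_proj_iso: "pt_proj \<in> iso wgroup rational_points"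
  using inj_pt_proj
  by (auto simp: iso_def hom_def bij_betw_def carrier_rational_points rational_points_mult)

text \<open>Needed for transferring the commutative group structure along \<open>pt_proj\<close>, as
  the target must already be known to be a monoid.\<close>

lemma monoid_rational_points: "monoid rational_points"
  by (rule monoidI)
     (auto simp: carrier_rational_points one_rational_points rational_points_mult add.assoc)

theorem mainTheorem8:
  "comm_group rational_points \<and>
   rational_points \<cong> integer_group \<times>\<times> integer_mod_group 2"
proof
  show "comm_group rational_points"
    using W.iso_imp_comm_group[OF is_isoI[OF pt_proj_iso] monoid_rational_points] .
  have "integer_group \<times>\<times> integer_mod_group 2 \<cong> rational_points"
    using iso_set_trans[OF mw_map_iso pt_proj_iso] by (rule is_isoI)
  then show "rational_points \<cong> integer_group \<times>\<times> integer_mod_group 2"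
    by (rule group.iso_sym[rotated]) (simp add: DirProd_group)
qed

end
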